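(* Let $\mathsf{C}$ be a strict braided monoidal category. The categories $\mathsf{HTr}^{\star}$, $\mathsf{wtr}\text{-}\mathsf{RB}^{\star}_{\mathsf{iso}}$ and $\mathsf{wt}\text{-}\mathsf{Post}\text{-}\mathsf{Hopf}^{\star}$ are equivalent.
   Context: $\mathsf{C}=(\mathsf{C},\otimes,K,c)$ is a strict braided monoidal category with unit object $K$ and braiding $c_{M,N}\colon M\otimes N\to N\otimes M$. For an object $X$ and a morphism $f$, $X\otimes f$ and $f\otimes X$ denote $\mathrm{id}_X\otimes f$ and $f\otimes \mathrm{id}_X$. A Hopf algebra in $\mathsf{C}$ is $H=(H,\eta_H,\mu_H,\varepsilon_H,\delta_H,\lambda_H)$ (unit, product, counit, coproduct, antipode). A Hopf algebra morphism is an algebra and coalgebra morphism. The tensor product $D\otimes E$ of coalgebras has coproduct $(D\otimes c_{D,E}\otimes E)\circ(\delta_D\otimes\delta_E)$ and counit $\varepsilon_D\otimes\varepsilon_E$. A non-unital bialgebra $(X,\mu_X,\varepsilon_X,\delta_X)$ is a coalgebra with an associative product $\mu_X$ that is a coalgebra morphism (no unit required); a morphism of non-unital bialgebras is a coalgebra morphism preserving products. Hopf truss: $\mathbb{H}=(H_1,H_2,\sigma_H)$ where $(H,\varepsilon_H,\delta_H)$ is a coalgebra, $H_1=(H,\eta_H,\mu_H^1,\varepsilon_H,\delta_H,\lambda_H)$ is a Hopf algebra, $H_2=(H,\mu_H^2,\varepsilon_H,\delta_H)$ is a non-unital bialgebra, and $\sigma_H\colon H\to H$ is a coalgebra morphism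 such that $\mu_{H}^{2}\circ(H\otimes\mu_{H}^{1})=\mu_{H}^{1}\circ(\mu_{H}^{2}\otimes\Gamma_{H_{1}}^{\sigma_{H}})\circ(H\otimes c_{H,H}\otimes H)\circ(\delta_{H}\otimes H\otimes H)$, where $\Gamma_{H_{1}}^{\sigma_{H}}:=\mu_{H}^{1}\circ((\lambda_{H}\circ\sigma_{H})\otimes\mu_{H}^{2})\circ(\delta_{H}\otimes H)$. A morphism of Hopf trusses $(H_1,H_2,\sigma_H)\to(B_1,B_2,\sigma_B)$ is a morphism $f$ that is a Hopf algebra morphism $H_1\to B_1$ and a morphism of non-unital bialgebras $H_2\to B_2$. $\mathsf{HTr}^{\star}$ is the full subcategory on those Hopf trusses with $(\Gamma_{H_{1}}^{\sigma_{H}}\otimes H)\circ(H\otimes c_{H,H})\circ((c_{H,H}\circ\delta_{H})\otimes H)=(\Gamma_{H_{1}}^{\sigma_{H}}\otimes H)\circ(H\otimes c_{H,H})\circ(\delta_{H}\otimes H)$. Weak twisted relative Rota–Baxter operator $(T\colon H\to B,\varphi_H,\Psi_H)$: $H$ is a Hopf algebra, $B=(B,\mu_B,\varepsilon_B,\delta_B)$ a non-unital bialgebra, $\varphi_H\colon B\otimes H\to H$ makes $H$ a non-unital left $B$-module algebra-coalgebra, i.e. $\varphi_H\circ(B\otimes\varphi_H)=\varphi_H\circ(\mu_B\otimes H)$, $\varphi_H\circ(B\otimes\eta_H)=\varepsilon_B\otimes\eta_H$, $\varphi_H\circ(B\otimes\mu_H)=\mu_H\circ(\varphi_H\otimes\varphi_H)\circ(B\otimes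 c_{B,H}\otimes H)\circ(\delta_B\otimes H\otimes H)$, and $\varphi_H$ is a coalgebra morphism; $T\colon H\to B$ and $\Psi_H\colon H\to H$ are coalgebra morphisms such that, with $\mathfrak{m}_H:=\varphi_H\circ(T\otimes H)$, (i) $\mu_{B}\circ(T\otimes T)=T\circ\mu_{H}\circ(\Psi_{H}\otimes\mathfrak{m}_H)\circ(\delta_{H}\otimes H)$ and (ii) $\Psi_{H}\circ\mu_{H}\circ(\Psi_{H}\otimes\mathfrak{m}_H)\circ(\delta_{H}\otimes H)=\mu_{H}\circ(\Psi_{H}\otimes\mathfrak{m}_H)\circ(\delta_{H}\otimes\Psi_{H})$. A morphism $(T\colon H\to B,\varphi_H,\Psi_H)\to(T'\colon H'\to B',\varphi_{H'},\Psi_{H'})$ is a pair $(f,g)$ with $f\colon H\to H'$ a Hopf algebra morphism and $g\colon B\to B'$ a morphism of non-unital bialgebras such that $T'\circ f=g\circ T$, $f\circ\Psi_H=\Psi_{H'}\circ f$, $f\circ\varphi_H=\varphi_{H'}\circ(g\otimes f)$. $\mathsf{wtr}\text{-}\mathsf{RB}^{\star}_{\mathsf{iso}}$ is the full subcategory on those objects with $T$ an isomorphism in $\mathsf{C}$ and $(\mathfrak{m}_{H}\otimes H)\circ(H\otimes c_{H,H})\circ((c_{H,H}\circ\delta_{H})\otimes H)=(\mathfrak{m}_{H}\otimes H)\circ(H\otimes c_{H,H})\circ(\delta_{H}\otimes H)$. Weak twisted post-Hopf algebra: a triple $(H,m_H,\Phi_H)$ with $H$ a Hopf algebra in $\mathsf{C}$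 and morphisms $m_H\colon H\otimes H\to H$, $\Phi_H\colon H\to H$ such that: (i) $m_H$ is a coalgebra morphism; (ii) $\Phi_H$ is a coalgebra morphism; (iii) $\Phi_{H}\circ\mu_{H}\circ(\Phi_{H}\otimes m_{H})\circ(\delta_{H}\otimes H)=\mu_{H}\circ(\Phi_{H}\otimes m_{H})\circ(\delta_{H}\otimes \Phi_{H})$; (iv) $m_{H}\circ(H\otimes m_{H})=m_{H}\circ((\mu_{H}\circ(\Phi_{H}\otimes m_{H})\circ(\delta_{H}\otimes H))\otimes H)$; (v) $m_{H}\circ(H\otimes\mu_{H})=\mu_{H}\circ(m_{H}\otimes m_{H})\circ(H\otimes c_{H,H}\otimes H)\circ(\delta_{H}\otimes H\otimes H)$. A morphism $(H,m_H,\Phi_H)\to(B,m_B,\Phi_B)$ is a Hopf algebra morphism $f\colon H\to B$ with $f\circ m_H=m_B\circ(f\otimes f)$ and $\Phi_B\circ f=f\circ\Phi_H$. $\mathsf{wt}\text{-}\mathsf{Post}\text{-}\mathsf{Hopf}^{\star}$ is the full subcategory on those objects with $(m_{H}\otimes H)\circ(H\otimes c_{H,H})\circ((c_{H,H}\circ\delta_{H})\otimes H)=(m_{H}\otimes H)\circ(H\otimes c_{H,H})\circ(\delta_{H}\otimes H)$. *)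

theory Defs
  imports Main
begin

section \<open>Categories, functors and equivalences\<close>

record ('o, 'a) category =
  Obj :: "'o set"
  Arr :: "'a set"
  Dom :: "'a \<Rightarrow> 'o"
  Cod :: "'a \<Rightarrow> 'o"
  ide :: "'o \<Rightarrow> 'a"
  comp :: "'a \<Rightarrow> 'a \<Rightarrow> 'a" (infixl "\<cdot>\<index>" 55)

definition hom :: "('o, 'a, 'm) category_scheme \<Rightarrow> 'o \<Rightarrow> 'o \<Rightarrow> 'a set" where
  "hom C X Y = {f \<in> Arr C. Dom C f = X \<and> Cod C f = Y}"

text \<open>
  Composition is total as a function, but only constrained on composable pairs.
\<close>

locale category =
  fixes C :: "('o, 'a, 'm) category_scheme" (structure)
  assumes Dom_closed: "f \<in> Arr C \<Longrightarrow> Dom C f \<in> Obj C"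
    and Cod_closed: "f \<in> Arr C \<Longrightarrow> Cod C f \<in> Obj C"
    and ide_hom: "X \<in> Obj C \<Longrightarrow> ide C X \<in> hom C X X"
    and comp_hom: "\<lbrakk>f \<in> hom C X Y; g \<in> hom C Y Z\<rbrakk> \<Longrightarrow> g \<cdot> f \<in> hom C X Z"
    and comp_assoc:
      "\<lbrakk>f \<in> hom C W X; g \<in> hom C X Y; h \<in> hom C Y Z\<rbrakk> \<Longrightarrow> (h \<cdot> g) \<cdot> f = h \<cdot> (g \<cdot> f)"
    and comp_ide_left: "f \<in> hom C X Y \<Longrightarrow> ide C Y \<cdot> f = f"
    and comp_ide_right: "f \<in> hom C X Y \<Longrightarrow> f \<cdot> ide C X = f"

definition iso :: "('o, 'a, 'm) category_scheme \<Rightarrow> 'o \<Rightarrow> 'o \<Rightarrow> 'a set" where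
  "iso C X Y = {f \<in> hom C X Y. \<exists>g \<in> hom C Y X.
     g \<cdot>\<^bsub>C\<^esub> f = ide C X \<and> f \<cdot>\<^bsub>C\<^esub> g = ide C Y}"

definition full_subcategory ::
  "('o, 'a) category \<Rightarrow> ('o \<Rightarrow> bool) \<Rightarrow> ('o, 'a) category" where
  "full_subcategory C P = C\<lparr>
     Obj := {X \<in> Obj C. P X},
     Arr := {f \<in> Arr C. P (Dom C f) \<and> P (Cod C f)}\<rparr>"

locale cat_functor = A: category A + B: category B
  for A :: "('o, 'a, 'm) category_scheme" and B :: "('p, 'b, 'n) category_scheme" +
  fixes Fo :: "'o \<Rightarrow> 'p" and Fa :: "'a \<Rightarrow> 'b"
  assumes Fo_closed: "X \<in> Obj A \<Longrightarrow> Fo X \<in> Obj B"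
    and Fa_hom: "f \<in> hom A X Y \<Longrightarrow> Fa f \<in> hom B (Fo X) (Fo Y)"
    and Fa_ide: "X \<in> Obj A \<Longrightarrow> Fa (ide A X) = ide B (Fo X)"
    and Fa_comp:
      "\<lbrakk>f \<in> hom A X Y; g \<in> hom A Y Z\<rbrakk> \<Longrightarrow> Fa (g \<cdot>\<^bsub>A\<^esub> f) = Fa g \<cdot>\<^bsub>B\<^esub> Fa f"

locale natural_iso =
  F: cat_functor A B Fo Fa + G: cat_functor A B Go Ga
  for A :: "('o, 'a, 'm) category_scheme" and B :: "('p, 'b, 'n) category_scheme"
    and Fo Fa Go Ga +
  fixes t :: "'o \<Rightarrow> 'b"
  assumes component_iso: "X \<in> Obj A \<Longrightarrow> t X \<in> iso B (Fo X) (Go X)"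
    and naturality: "f \<in> hom A X Y \<Longrightarrow> Ga f \<cdot>\<^bsub>B\<^esub> t X = t Y \<cdot>\<^bsub>B\<^esub> Fa f"

definition equivalent_categories ::
  "('o, 'a, 'm) category_scheme \<Rightarrow> ('p, 'b, 'n) category_scheme \<Rightarrow> bool" where
  "equivalent_categories A B \<longleftrightarrow>
     (\<exists>Fo Fa Go Ga s t.
        cat_functor A B Fo Fa \<and> cat_functor B A Go Ga \<and>
        natural_iso A A id id (Go \<circ> Fo) (Ga \<circ> Fa) s \<and>
        natural_iso B B (Fo \<circ> Go) (Fa \<circ> Ga) id id t)"

text \<open>
  Categories of structures over a base category \<open>C\<close>.  The morphisms \<open>S \<rightarrow> T\<close> are described by a set
  \<open>mor S T\<close> of underlying data; an arrow is tagged with its source and target structure, because the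
  same underlying data may be a morphism between different structures.
\<close>

definition structure_category ::
  "('s \<Rightarrow> bool) \<Rightarrow> ('s \<Rightarrow> 's \<Rightarrow> 'f set) \<Rightarrow> ('s \<Rightarrow> 'f) \<Rightarrow> ('f \<Rightarrow> 'f \<Rightarrow> 'f)
    \<Rightarrow> ('s, 's \<times> 'f \<times> 's) category" where
  "structure_category P mor idm cmp = \<lparr>
     Obj = {S. P S},
     Arr = {(S, f, T). P S \<and> P T \<and> f \<in> mor S T},
     Dom = (\<lambda>(S, f, T). S),
     Cod = (\<lambda>(S, f, T). T),
     ide = (\<lambda>S. (S, idm S, S)),
     comp = (\<lambda>(S', g, T) (S, f, T'). (S, cmp g f, T))\<rparr>"


section \<open>Strict braided monoidal categories\<close>

record ('o, 'a) braided_category = "('o, 'a) category" +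
  tensor_obj :: "'o \<Rightarrow> 'o \<Rightarrow> 'o" (infixl "\<otimes>\<^sub>o\<index>" 60)
  tensor :: "'a \<Rightarrow> 'a \<Rightarrow> 'a" (infixl "\<otimes>\<index>" 60)
  unit_obj :: "'o"
  braiding :: "'o \<Rightarrow> 'o \<Rightarrow> 'a"

locale strict_monoidal_category = category C
  for C :: "('o, 'a, 'm) braided_category_scheme" (structure) +
  assumes unit_obj_closed: "unit_obj C \<in> Obj C"
    and tensor_obj_closed: "\<lbrakk>X \<in> Obj C; Y \<in> Obj C\<rbrakk> \<Longrightarrow> X \<otimes>\<^sub>o Y \<in> Obj C"
    and tensor_hom:
      "\<lbrakk>f \<in> hom C X X'; g \<in> hom C Y Y'\<rbrakk> \<Longrightarrow> f \<otimes> g \<in> hom C (X \<otimes>\<^sub>o Y) (X' \<otimes>\<^sub>o Y')"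
    and tensor_ide:
      "\<lbrakk>X \<in> Obj C; Y \<in> Obj C\<rbrakk> \<Longrightarrow> ide C X \<otimes> ide C Y = ide C (X \<otimes>\<^sub>o Y)"
    and tensor_comp:
      "\<lbrakk>f \<in> hom C X Y; g \<in> hom C Y Z; f' \<in> hom C X' Y'; g' \<in> hom C Y' Z'\<rbrakk>
        \<Longrightarrow> (g \<cdot> f) \<otimes> (g' \<cdot> f') = (g \<otimes> g') \<cdot> (f \<otimes> f')"
    and tensor_obj_assoc:
      "\<lbrakk>X \<in> Obj C; Y \<in> Obj C; Z \<in> Obj C\<rbrakk> \<Longrightarrow> (X \<otimes>\<^sub>o Y) \<otimes>\<^sub>o Z = X \<otimes>\<^sub>o (Y \<otimes>\<^sub>o Z)"
    and tensor_obj_unit_left: "X \<in> Obj C \<Longrightarrow> unit_obj C \<otimes>\<^sub>o X = X"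
    and tensor_obj_unit_right: "X \<in> Obj C \<Longrightarrow> X \<otimes>\<^sub>o unit_obj C = X"
    and tensor_assoc:
      "\<lbrakk>f \<in> Arr C; g \<in> Arr C; h \<in> Arr C\<rbrakk> \<Longrightarrow> (f \<otimes> g) \<otimes> h = f \<otimes> (g \<otimes> h)"
    and tensor_unit_left: "f \<in> Arr C \<Longrightarrow> ide C (unit_obj C) \<otimes> f = f"
    and tensor_unit_right: "f \<in> Arr C \<Longrightarrow> f \<otimes> ide C (unit_obj C) = f"

locale strict_braided_monoidal_category = strict_monoidal_category C
  for C :: "('o, 'a, 'm) braided_category_scheme" (structure) +
  assumes braiding_iso:
      "\<lbrakk>X \<in> Obj C; Y \<in> Obj C\<rbrakk> \<Longrightarrow> braiding C X Y \<in> iso C (X \<otimes>\<^sub>o Y) (Y \<otimes>\<^sub>o X)"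
    and braiding_natural:
      "\<lbrakk>f \<in> hom C X X'; g \<in> hom C Y Y'\<rbrakk>
        \<Longrightarrow> (g \<otimes> f) \<cdot> braiding C X Y = braiding C X' Y' \<cdot> (f \<otimes> g)"
    and hexagon_right:
      "\<lbrakk>X \<in> Obj C; Y \<in> Obj C; Z \<in> Obj C\<rbrakk>
        \<Longrightarrow> braiding C X (Y \<otimes>\<^sub>o Z) = (ide C Y \<otimes> braiding C X Z) \<cdot> (braiding C X Y \<otimes> ide C Z)"
    and hexagon_left:
      "\<lbrakk>X \<in> Obj C; Y \<in> Obj C; Z \<in> Obj C\<rbrakk>
        \<Longrightarrow> braiding C (X \<otimes>\<^sub>o Y) Z = (braiding C X Z \<otimes> ide C Y) \<cdot> (ide C X \<otimes> braiding C Y Z)"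


section \<open>Algebraic structures in a strict braided monoidal category\<close>

record ('o, 'a) coalgebra =
  carrier :: 'o
  counit :: 'a
  comult :: 'a

record ('o, 'a) nonunital_bialgebra = "('o, 'a) coalgebra" +
  mult :: 'a

record ('o, 'a) hopf_algebra = "('o, 'a) nonunital_bialgebra" +
  unit_mor :: 'a
  antipode :: 'a

record ('o, 'a) hopf_truss =
  truss_H1 :: "('o, 'a) hopf_algebra"
  truss_H2 :: "('o, 'a) nonunital_bialgebra"
  truss_\<sigma> :: 'a

record ('o, 'a) rota_baxter =
  rb_H :: "('o, 'a) hopf_algebra"
  rb_B :: "('o, 'a) nonunital_bialgebra"
  rb_T :: 'a
  rb_\<phi> :: 'a
  rb_\<Psi> :: 'a

record ('o, 'a) post_hopf =
  ph_H :: "('o, 'a) hopf_algebra"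
  ph_m :: 'a
  ph_\<Phi> :: 'a

text \<open>
  In the equations below a variable such as \<open>H\<close> or \<open>B\<close> bound by \<open>let\<close> is the identity arrow of the
  object in question, so that \<open>H \<otimes> f\<close> denotes \<open>id\<^sub>H \<otimes> f\<close>.
\<close>

context
  fixes C :: "('o, 'a, 'm) braided_category_scheme" (structure)
begin

subsection \<open>Coalgebras, bialgebras and Hopf algebras\<close>

definition coalgebra :: "('o, 'a, 'r) coalgebra_scheme \<Rightarrow> bool" where
  "coalgebra D \<longleftrightarrow>
     (let X = carrier D; H = ide C X; \<epsilon> = counit D; \<delta> = comult D in
      X \<in> Obj C \<and> \<epsilon> \<in> hom C X (unit_obj C) \<and> \<delta> \<in> hom C X (X \<otimes>\<^sub>o X) \<and>
      (\<delta> \<otimes> H) \<cdot> \<delta> = (H \<otimes> \<delta>) \<cdot> \<delta> \<and>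
      (\<epsilon> \<otimes> H) \<cdot> \<delta> = H \<and> (H \<otimes> \<epsilon>) \<cdot> \<delta> = H)"

definition coalgebra_mor ::
  "('o, 'a, 'r) coalgebra_scheme \<Rightarrow> ('o, 'a, 's) coalgebra_scheme \<Rightarrow> 'a set" where
  "coalgebra_mor D E =
     {f \<in> hom C (carrier D) (carrier E).
        counit E \<cdot> f = counit D \<and> comult E \<cdot> f = (f \<otimes> f) \<cdot> comult D}"

definition unit_coalgebra :: "('o, 'a) coalgebra" where
  "unit_coalgebra =
     \<lparr>carrier = unit_obj C, counit = ide C (unit_obj C), comult = ide C (unit_obj C)\<rparr>"

definition tensor_coalgebra ::
  "('o, 'a, 'r) coalgebra_scheme \<Rightarrow> ('o, 'a, 's) coalgebra_scheme \<Rightarrow> ('o, 'a) coalgebra" where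
  "tensor_coalgebra D E = \<lparr>
     carrier = carrier D \<otimes>\<^sub>o carrier E,
     counit = counit D \<otimes> counit E,
     comult = (ide C (carrier D) \<otimes> braiding C (carrier D) (carrier E) \<otimes> ide C (carrier E))
                \<cdot> (comult D \<otimes> comult E)\<rparr>"

definition nonunital_bialgebra :: "('o, 'a, 'r) nonunital_bialgebra_scheme \<Rightarrow> bool" where
  "nonunital_bialgebra B \<longleftrightarrow>
     (let H = ide C (carrier B); \<mu> = mult B in
      coalgebra B \<and> \<mu> \<in> coalgebra_mor (tensor_coalgebra B B) B \<and>
      \<mu> \<cdot> (\<mu> \<otimes> H) = \<mu> \<cdot> (H \<otimes> \<mu>))"

definition nonunital_bialgebra_mor ::
  "('o, 'a, 'r) nonunital_bialgebra_scheme \<Rightarrow> ('o, 'a, 's) nonunital_bialgebra_scheme \<Rightarrow> 'a set" where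
  "nonunital_bialgebra_mor A B =
     {f \<in> coalgebra_mor A B. f \<cdot> mult A = mult B \<cdot> (f \<otimes> f)}"

definition hopf_algebra :: "('o, 'a, 'r) hopf_algebra_scheme \<Rightarrow> bool" where
  "hopf_algebra A \<longleftrightarrow>
     (let X = carrier A; H = ide C X; \<epsilon> = counit A; \<delta> = comult A;
          \<mu> = mult A; \<eta> = unit_mor A; s = antipode A in
      nonunital_bialgebra A \<and>
      \<eta> \<in> coalgebra_mor unit_coalgebra A \<and>
      \<mu> \<cdot> (\<eta> \<otimes> H) = H \<and> \<mu> \<cdot> (H \<otimes> \<eta>) = H \<and>
      s \<in> hom C X X \<and>
      \<mu> \<cdot> (s \<otimes> H) \<cdot> \<delta> = \<eta> \<cdot> \<epsilon> \<and> \<mu> \<cdot> (H \<otimes> s) \<cdot> \<delta> = \<eta> \<cdot> \<epsilon>)"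

definition hopf_algebra_mor ::
  "('o, 'a, 'r) hopf_algebra_scheme \<Rightarrow> ('o, 'a, 's) hopf_algebra_scheme \<Rightarrow> 'a set" where
  "hopf_algebra_mor A B =
     {f \<in> nonunital_bialgebra_mor A B. f \<cdot> unit_mor A = unit_mor B}"

definition star_condition :: "('o, 'a, 'r) coalgebra_scheme \<Rightarrow> 'a \<Rightarrow> bool" where
  "star_condition D m \<longleftrightarrow>
     (let H = ide C (carrier D); \<delta> = comult D; c = braiding C (carrier D) (carrier D) in
      (m \<otimes> H) \<cdot> (H \<otimes> c) \<cdot> ((c \<cdot> \<delta>) \<otimes> H) = (m \<otimes> H) \<cdot> (H \<otimes> c) \<cdot> (\<delta> \<otimes> H))"


subsection \<open>Hopf trusses\<close>

definition truss_\<Gamma> :: "('o, 'a) hopf_truss \<Rightarrow> 'a" where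
  "truss_\<Gamma> S =
     (let H1 = truss_H1 S; H = ide C (carrier H1) in
      mult H1 \<cdot> ((antipode H1 \<cdot> truss_\<sigma> S) \<otimes> mult (truss_H2 S)) \<cdot> (comult H1 \<otimes> H))"

text \<open>The truncation equation says that \<open>H\<^sub>1\<close> and \<open>H\<^sub>2\<close> share the coalgebra \<open>(H, \<epsilon>, \<delta>)\<close>.\<close>

definition hopf_truss :: "('o, 'a) hopf_truss \<Rightarrow> bool" where
  "hopf_truss S \<longleftrightarrow>
     (let H1 = truss_H1 S; H2 = truss_H2 S; X = carrier H1; H = ide C X;
          \<delta> = comult H1; c = braiding C X X; \<mu>1 = mult H1; \<mu>2 = mult H2 in
      hopf_algebra H1 \<and> nonunital_bialgebra H2 \<and>
      coalgebra.truncate H2 = coalgebra.truncate H1 \<and>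
      truss_\<sigma> S \<in> coalgebra_mor H1 H1 \<and>
      \<mu>2 \<cdot> (H \<otimes> \<mu>1) = \<mu>1 \<cdot> (\<mu>2 \<otimes> truss_\<Gamma> S) \<cdot> (H \<otimes> c \<otimes> H) \<cdot> (\<delta> \<otimes> H \<otimes> H))"

definition hopf_truss_mor :: "('o, 'a) hopf_truss \<Rightarrow> ('o, 'a) hopf_truss \<Rightarrow> 'a set" where
  "hopf_truss_mor S S' =
     hopf_algebra_mor (truss_H1 S) (truss_H1 S') \<inter>
     nonunital_bialgebra_mor (truss_H2 S) (truss_H2 S')"

definition HTr ::
  "(('o, 'a) hopf_truss, ('o, 'a) hopf_truss \<times> 'a \<times> ('o, 'a) hopf_truss) category" where
  "HTr = structure_category hopf_truss hopf_truss_mor (\<lambda>S. ide C (carrier (truss_H1 S))) (\<cdot>)"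

definition HTr_star ::
  "(('o, 'a) hopf_truss, ('o, 'a) hopf_truss \<times> 'a \<times> ('o, 'a) hopf_truss) category" where
  "HTr_star = full_subcategory HTr (\<lambda>S. star_condition (truss_H1 S) (truss_\<Gamma> S))"


subsection \<open>Weak twisted relative Rota--Baxter operators\<close>

definition nonunital_module_algebra_coalgebra ::
  "('o, 'a, 'r) nonunital_bialgebra_scheme \<Rightarrow> ('o, 'a, 's) hopf_algebra_scheme \<Rightarrow> 'a \<Rightarrow> bool" where
  "nonunital_module_algebra_coalgebra B' H' \<phi> \<longleftrightarrow>
     (let B = ide C (carrier B'); H = ide C (carrier H');
          c = braiding C (carrier B') (carrier H'); \<mu> = mult H'; \<eta> = unit_mor H' in
      \<phi> \<in> coalgebra_mor (tensor_coalgebra B' H') H' \<and>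
      \<phi> \<cdot> (B \<otimes> \<phi>) = \<phi> \<cdot> (mult B' \<otimes> H) \<and>
      \<phi> \<cdot> (B \<otimes> \<eta>) = counit B' \<otimes> \<eta> \<and>
      \<phi> \<cdot> (B \<otimes> \<mu>) = \<mu> \<cdot> (\<phi> \<otimes> \<phi>) \<cdot> (B \<otimes> c \<otimes> H) \<cdot> (comult B' \<otimes> H \<otimes> H))"

definition rb_m :: "('o, 'a) rota_baxter \<Rightarrow> 'a" where
  "rb_m R = rb_\<phi> R \<cdot> (rb_T R \<otimes> ide C (carrier (rb_H R)))"

definition rota_baxter :: "('o, 'a) rota_baxter \<Rightarrow> bool" where
  "rota_baxter R \<longleftrightarrow>
     (let H' = rb_H R; B' = rb_B R; T = rb_T R; \<Psi> = rb_\<Psi> R; m = rb_m R;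
          H = ide C (carrier H'); \<mu> = mult H'; \<delta> = comult H' in
      hopf_algebra H' \<and> nonunital_bialgebra B' \<and>
      nonunital_module_algebra_coalgebra B' H' (rb_\<phi> R) \<and>
      T \<in> coalgebra_mor H' B' \<and> \<Psi> \<in> coalgebra_mor H' H' \<and>
      mult B' \<cdot> (T \<otimes> T) = T \<cdot> \<mu> \<cdot> (\<Psi> \<otimes> m) \<cdot> (\<delta> \<otimes> H) \<and>
      \<Psi> \<cdot> \<mu> \<cdot> (\<Psi> \<otimes> m) \<cdot> (\<delta> \<otimes> H) = \<mu> \<cdot> (\<Psi> \<otimes> m) \<cdot> (\<delta> \<otimes> \<Psi>))"

definition rota_baxter_mor ::
  "('o, 'a) rota_baxter \<Rightarrow> ('o, 'a) rota_baxter \<Rightarrow> ('a \<times> 'a) set" where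
  "rota_baxter_mor R R' =
     {(f, g). f \<in> hopf_algebra_mor (rb_H R) (rb_H R') \<and>
              g \<in> nonunital_bialgebra_mor (rb_B R) (rb_B R') \<and>
              rb_T R' \<cdot> f = g \<cdot> rb_T R \<and>
              f \<cdot> rb_\<Psi> R = rb_\<Psi> R' \<cdot> f \<and>
              f \<cdot> rb_\<phi> R = rb_\<phi> R' \<cdot> (g \<otimes> f)}"

definition wtr_RB ::
  "(('o, 'a) rota_baxter,
    ('o, 'a) rota_baxter \<times> ('a \<times> 'a) \<times> ('o, 'a) rota_baxter) category" where
  "wtr_RB = structure_category rota_baxter rota_baxter_mor
     (\<lambda>R. (ide C (carrier (rb_H R)), ide C (carrier (rb_B R))))
     (\<lambda>(f', g') (f, g). (f' \<cdot> f, g' \<cdot> g))"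

definition wtr_RB_iso_star ::
  "(('o, 'a) rota_baxter,
    ('o, 'a) rota_baxter \<times> ('a \<times> 'a) \<times> ('o, 'a) rota_baxter) category" where
  "wtr_RB_iso_star = full_subcategory wtr_RB
     (\<lambda>R. rb_T R \<in> iso C (carrier (rb_H R)) (carrier (rb_B R)) \<and>
          star_condition (rb_H R) (rb_m R))"


subsection \<open>Weak twisted post-Hopf algebras\<close>

definition post_hopf :: "('o, 'a) post_hopf \<Rightarrow> bool" where
  "post_hopf P \<longleftrightarrow>
     (let H' = ph_H P; m = ph_m P; \<Phi> = ph_\<Phi> P; X = carrier H'; H = ide C X;
          c = braiding C X X; \<mu> = mult H'; \<delta> = comult H' in
      hopf_algebra H' \<and>
      m \<in> coalgebra_mor (tensor_coalgebra H' H') H' \<and>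
      \<Phi> \<in> coalgebra_mor H' H' \<and>
      \<Phi> \<cdot> \<mu> \<cdot> (\<Phi> \<otimes> m) \<cdot> (\<delta> \<otimes> H) = \<mu> \<cdot> (\<Phi> \<otimes> m) \<cdot> (\<delta> \<otimes> \<Phi>) \<and>
      m \<cdot> (H \<otimes> m) = m \<cdot> ((\<mu> \<cdot> (\<Phi> \<otimes> m) \<cdot> (\<delta> \<otimes> H)) \<otimes> H) \<and>
      m \<cdot> (H \<otimes> \<mu>) = \<mu> \<cdot> (m \<otimes> m) \<cdot> (H \<otimes> c \<otimes> H) \<cdot> (\<delta> \<otimes> H \<otimes> H))"

definition post_hopf_mor :: "('o, 'a) post_hopf \<Rightarrow> ('o, 'a) post_hopf \<Rightarrow> 'a set" where
  "post_hopf_mor P P' =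
     {f \<in> hopf_algebra_mor (ph_H P) (ph_H P').
        f \<cdot> ph_m P = ph_m P' \<cdot> (f \<otimes> f) \<and> ph_\<Phi> P' \<cdot> f = f \<cdot> ph_\<Phi> P}"

definition wt_Post_Hopf ::
  "(('o, 'a) post_hopf, ('o, 'a) post_hopf \<times> 'a \<times> ('o, 'a) post_hopf) category" where
  "wt_Post_Hopf =
     structure_category post_hopf post_hopf_mor (\<lambda>P. ide C (carrier (ph_H P))) (\<cdot>)"

definition wt_Post_Hopf_star ::
  "(('o, 'a) post_hopf, ('o, 'a) post_hopf \<times> 'a \<times> ('o, 'a) post_hopf) category" where
  "wt_Post_Hopf_star =
     full_subcategory wt_Post_Hopf (\<lambda>P. star_condition (ph_H P) (ph_m P))"

end

end

theory Submission
  imports Defs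
begin

text \<open>
  The functors are explicit: a Hopf truss \<open>(H\<^sub>1, H\<^sub>2, \<sigma>)\<close> goes to the post-Hopf algebra
  \<open>(H\<^sub>1, \<Gamma>, \<sigma>)\<close>, a Rota--Baxter operator \<open>(T, \<phi>, \<Psi>)\<close> goes to \<open>(H, \<phi> \<cdot> (T \<otimes> H), \<Psi>)\<close>, and a
  post-Hopf algebra \<open>(H, m, \<Phi>)\<close> gives back the product \<open>a \<circ> b = \<Phi>(a\<^sub>1) m(a\<^sub>2, b)\<close>, hence the truss
  \<open>(H, (H, \<circ>), \<Phi>)\<close> and the operator \<open>(id : H \<rightarrow> (H, \<circ>), m, \<Phi>)\<close>.  Trusses and post-Hopf algebras
  correspond bijectively; a Rota--Baxter operator with invertible \<open>T\<close> returns as an isomorphic one,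
  by means of \<open>(id, T)\<close>.

  The computations avoid string diagrams with many strands.  For a coalgebra \<open>D\<close> write
  \<open>pair D f g = (f \<otimes> g) \<cdot> \<delta>\<^sub>D\<close>, the morphism \<open>d \<mapsto> f(d\<^sub>1) \<otimes> g(d\<^sub>2)\<close>.  It is associative, has the
  counit as a unit, and is compatible with precomposition by coalgebra morphisms.  The axioms become
  equations between convolutions \<open>conv D f g = \<mu> \<cdot> pair D f g\<close> over \<open>D = H\<close>, \<open>H \<otimes> H\<close> or
  \<open>H \<otimes> H \<otimes> H\<close>; for instance \<open>a \<circ> b\<close> is the convolution of \<open>\<Phi> \<cdot> (H \<otimes> \<epsilon>)\<close> and \<open>m\<close>, and \<open>\<Gamma>\<close>
  is the unique solution of the corresponding equation.  The antipode is used only for cancellation: a coalgebra morphism into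
  \<open>H\<close> is convolution invertible (lemmas \<open>module_cancel\<close>, \<open>conv_cancel\<close>).  The star condition says
  that \<open>H \<otimes> \<epsilon>\<close> and the action commute up to the braiding (\<open>star_condition_iff\<close>).  Consequently the
  pair of \<open>\<Phi> \<cdot> (H \<otimes> \<epsilon>)\<close> and \<open>m\<close> is a coalgebra morphism (\<open>commuting_pair_mor\<close>), so that \<open>\<circ>\<close> is one;
  conversely, if \<open>\<circ>\<close> is a coalgebra morphism then so is \<open>\<Gamma>\<close> (\<open>conv_mor_cancel\<close>).

  With these tools the two sets of axioms are matched in \<open>post_imp_truss\<close> and \<open>truss_imp_post\<close>.  In
  the second one, the truss axiom gives \<open>\<Gamma>(a, 1) = \<epsilon>(a) 1\<close>, that is \<open>\<sigma>(a) = a \<circ> 1\<close>, whence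
  \<open>\<sigma>(a \<circ> b) = a \<circ> \<sigma>(b)\<close>, and comparing the expansions of \<open>(a \<circ> b) \<circ> c\<close> and \<open>a \<circ> (b \<circ> c)\<close> yields the
  action law after cancelling \<open>\<sigma>(a \<circ> b)\<close>.  The formula for \<open>\<sigma>\<close> also shows that a Hopf algebra morphism
  preserving \<open>\<circ>\<close> preserves \<open>\<sigma>\<close> and \<open>\<Gamma>\<close> (\<open>twisted_mor\<close>), so the morphisms agree as well.
\<close>

section \<open>Equivalences between categories of structures\<close>

lemma cat_functor_id: "category A \<Longrightarrow> cat_functor A A id id"
  by (simp add: cat_functor_def cat_functor_axioms_def)

lemma cat_functor_comp:
  assumes "cat_functor A B Fo Fa" "cat_functor B D Go Ga"
  shows "cat_functor A D (Go \<circ> Fo) (Ga \<circ> Fa)"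
proof -
  interpret F: cat_functor A B Fo Fa by fact
  interpret G: cat_functor B D Go Ga by fact
  show ?thesis
  proof
    fix f X Y assume f: "f \<in> hom A X Y"
    show "(Ga \<circ> Fa) f \<in> hom D ((Go \<circ> Fo) X) ((Go \<circ> Fo) Y)"
      using G.Fa_hom[OF F.Fa_hom[OF f]] by simp
    fix g Z assume g: "g \<in> hom A Y Z"
    show "(Ga \<circ> Fa) (g \<cdot>\<^bsub>A\<^esub> f) = (Ga \<circ> Fa) g \<cdot>\<^bsub>D\<^esub> (Ga \<circ> Fa) f"
      using F.Fa_comp[OF f g] G.Fa_comp[OF F.Fa_hom[OF f] F.Fa_hom[OF g]] by simp
  qed (simp_all add: F.Fo_closed G.Fo_closed F.Fa_ide G.Fa_ide)
qed

lemma natural_iso_inverse: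
  assumes "natural_iso A B Fo Fa Go Ga t"
  shows "\<exists>t'. natural_iso A B Go Ga Fo Fa t'"
proof -
  interpret natural_iso A B Fo Fa Go Ga t by fact
  have "\<exists>u. u \<in> iso B (Go X) (Fo X) \<and> u \<cdot>\<^bsub>B\<^esub> t X = ide B (Fo X) \<and> t X \<cdot>\<^bsub>B\<^esub> u = ide B (Go X)"
    if "X \<in> Obj A" for X
    using component_iso[OF that] by (auto simp: iso_def)
  then obtain u where u: "\<And>X. X \<in> Obj A \<Longrightarrow> u X \<in> iso B (Go X) (Fo X)"
      "\<And>X. X \<in> Obj A \<Longrightarrow> u X \<cdot>\<^bsub>B\<^esub> t X = ide B (Fo X)" "\<And>X. X \<in> Obj A \<Longrightarrow> t X \<cdot>\<^bsub>B\<^esub> u X = ide B (Go X)"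
    by metis
  have "Fa f \<cdot>\<^bsub>B\<^esub> u X = u Y \<cdot>\<^bsub>B\<^esub> Ga f" if f: "f \<in> hom A X Y" for f X Y
  proof -
    have obj: "X \<in> Obj A" "Y \<in> Obj A"
      using f F.A.Dom_closed F.A.Cod_closed by (auto simp: hom_def)
    have t: "t X \<in> hom B (Fo X) (Go X)" "t Y \<in> hom B (Fo Y) (Go Y)"
      and uh: "u X \<in> hom B (Go X) (Fo X)" "u Y \<in> hom B (Go Y) (Fo Y)"
      using component_iso[OF obj(1)] component_iso[OF obj(2)] u(1)[OF obj(1)] u(1)[OF obj(2)]
      by (simp_all add: iso_def)
    note Ff = F.Fa_hom[OF f] and Gf = G.Fa_hom[OF f]
    note Fu = F.B.comp_hom[OF uh(1) Ff]
    have "Fa f \<cdot>\<^bsub>B\<^esub> u X = (u Y \<cdot>\<^bsub>B\<^esub> t Y) \<cdot>\<^bsub>B\<^esub> (Fa f \<cdot>\<^bsub>B\<^esub> u X)"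
      unfolding u(2)[OF obj(2)] by (rule F.B.comp_ide_left[OF Fu, symmetric])
    also have "\<dots> = u Y \<cdot>\<^bsub>B\<^esub> (t Y \<cdot>\<^bsub>B\<^esub> (Fa f \<cdot>\<^bsub>B\<^esub> u X))"
      by (rule F.B.comp_assoc[OF Fu t(2) uh(2)])
    also have "t Y \<cdot>\<^bsub>B\<^esub> (Fa f \<cdot>\<^bsub>B\<^esub> u X) = (t Y \<cdot>\<^bsub>B\<^esub> Fa f) \<cdot>\<^bsub>B\<^esub> u X"
      by (rule F.B.comp_assoc[OF uh(1) Ff t(2), symmetric])
    also have "\<dots> = Ga f \<cdot>\<^bsub>B\<^esub> (t X \<cdot>\<^bsub>B\<^esub> u X)"
      unfolding naturality[OF f, symmetric] by (rule F.B.comp_assoc[OF uh(1) t(1) Gf])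
    also have "\<dots> = Ga f"
      unfolding u(3)[OF obj(1)] by (rule F.B.comp_ide_right[OF Gf])
    finally show ?thesis .
  qed
  then have "natural_iso A B Go Ga Fo Fa u"
    by (simp add: natural_iso_def natural_iso_axioms_def F.cat_functor_axioms G.cat_functor_axioms u(1))
  then show ?thesis by blast
qed

lemma equivalent_of_section:
  assumes F: "cat_functor A B Fo Fa" and G: "cat_functor B A Go Ga"
    and obj: "\<And>X. X \<in> Obj A \<Longrightarrow> Go (Fo X) = X" and arr: "\<And>f. f \<in> Arr A \<Longrightarrow> Ga (Fa f) = f"
    and t: "natural_iso B B (Fo \<circ> Go) (Fa \<circ> Ga) id id t"
  shows "equivalent_categories A B" "equivalent_categories B A"
proof -
  interpret F: cat_functor A B Fo Fa by fact
  have I: "cat_functor A A id id" "cat_functor A A (Go \<circ> Fo) (Ga \<circ> Fa)"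
    by (rule cat_functor_id cat_functor_comp F G F.A.category_axioms)+
  have ide_iso: "ide A X \<in> iso A X X" if "X \<in> Obj A" for X
    using that F.A.ide_hom F.A.comp_ide_left by (auto simp: iso_def)
  have "f \<cdot>\<^bsub>A\<^esub> ide A X = ide A Y \<cdot>\<^bsub>A\<^esub> f" "Ga (Fa f) = f" if "f \<in> hom A X Y" for f X Y
    using F.A.comp_ide_left[OF that] F.A.comp_ide_right[OF that] that arr by (simp_all add: hom_def)
  then have s: "natural_iso A A id id (Go \<circ> Fo) (Ga \<circ> Fa) (ide A)" "natural_iso A A (Go \<circ> Fo) (Ga \<circ> Fa) id id (ide A)"
    using ide_iso by (simp_all add: natural_iso_def natural_iso_axioms_def I obj)
  show "equivalent_categories A B"
    unfolding equivalent_categories_def using F G s t by blast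
  show "equivalent_categories B A"
    unfolding equivalent_categories_def using F G s natural_iso_inverse[OF t] by blast
qed

lemma structure_hom_iff:
  "a \<in> hom (structure_category P mor idm cmp) S T \<longleftrightarrow> (\<exists>f. a = (S, f, T) \<and> P S \<and> P T \<and> f \<in> mor S T)"
  by (auto simp: hom_def structure_category_def)

lemma structure_simps:
  "Obj (structure_category P mor idm cmp) = {S. P S}"
  "ide (structure_category P mor idm cmp) S = (S, idm S, S)"
  "comp (structure_category P mor idm cmp) (S', g, T) (S, f, T') = (S, cmp g f, T)"
  by (simp_all add: structure_category_def)

lemma category_structure:
  assumes "\<And>S. P S \<Longrightarrow> idm S \<in> mor S S"
    "\<And>R S T f g. \<lbrakk>P R; P S; P T; f \<in> mor R S; g \<in> mor S T\<rbrakk> \<Longrightarrow> cmp g f \<in> mor R T"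
    "\<And>Q R S T f g h. \<lbrakk>P Q; P R; P S; P T; f \<in> mor Q R; g \<in> mor R S; h \<in> mor S T\<rbrakk>
      \<Longrightarrow> cmp (cmp h g) f = cmp h (cmp g f)"
    "\<And>S T f. \<lbrakk>P S; P T; f \<in> mor S T\<rbrakk> \<Longrightarrow> cmp (idm T) f = f"
    "\<And>S T f. \<lbrakk>P S; P T; f \<in> mor S T\<rbrakk> \<Longrightarrow> cmp f (idm S) = f"
  shows "category (structure_category P mor idm cmp)"
proof
  fix f assume "f \<in> Arr (structure_category P mor idm cmp)"
  then show "Dom (structure_category P mor idm cmp) f \<in> Obj (structure_category P mor idm cmp)"
    "Cod (structure_category P mor idm cmp) f \<in> Obj (structure_category P mor idm cmp)"
    by (auto simp: structure_category_def)
qed (use assms in \<open>auto simp: structure_hom_iff structure_simps\<close>)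

lemma full_subcategory_structure:
  "full_subcategory (structure_category P mor idm cmp) Q = structure_category (\<lambda>S. P S \<and> Q S) mor idm cmp"
  unfolding full_subcategory_def structure_category_def by auto

lemma structure_functor:
  assumes "category (structure_category P mor idm cmp)" "category (structure_category P' mor' idm' cmp')"
    "\<And>S. P S \<Longrightarrow> P' (F S)"
    "\<And>S T f. \<lbrakk>P S; P T; f \<in> mor S T\<rbrakk> \<Longrightarrow> \<phi> f \<in> mor' (F S) (F T)"
    "\<And>S. P S \<Longrightarrow> \<phi> (idm S) = idm' (F S)"
    "\<And>f g. \<phi> (cmp g f) = cmp' (\<phi> g) (\<phi> f)"
  shows "cat_functor (structure_category P mor idm cmp) (structure_category P' mor' idm' cmp')
    F (\<lambda>(S, f, T). (F S, \<phi> f, F T))"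
    (is "cat_functor ?A ?B F ?\<Phi>")
  unfolding cat_functor_def cat_functor_axioms_def
proof (intro conjI allI impI assms(1,2))
  fix a b R S T assume a: "a \<in> hom ?A R S"
  then obtain f where f: "a = (R, f, S)" "P R" "P S" "f \<in> mor R S"
    unfolding structure_hom_iff by blast
  then show "?\<Phi> a \<in> hom ?B (F R) (F S)"
    by (simp add: structure_hom_iff assms(3,4))
  assume "b \<in> hom ?A S T"
  then obtain g where "b = (S, g, T)"
    unfolding structure_hom_iff by blast
  with f(1) show "?\<Phi> (b \<cdot>\<^bsub>?A\<^esub> a) = ?\<Phi> b \<cdot>\<^bsub>?B\<^esub> ?\<Phi> a"
    by (simp add: structure_simps assms(6))
qed (simp_all add: structure_simps assms(3,5))

text \<open>
  The form in which all three equivalences are obtained: \<open>G\<close> is a strict left inverse of \<open>F\<close>, the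
  functors act on morphisms by maps \<open>\<phi>\<close>, \<open>\<psi>\<close> that do not depend on source and target, and \<open>u\<close> is a
  natural isomorphism from \<open>F \<circ> G\<close> to the identity.
\<close>

lemma structure_equivalence:
  assumes cat: "category (structure_category P mor idm cmp)" "category (structure_category P' mor' idm' cmp')"
    and F: "\<And>S. P S \<Longrightarrow> P' (F S)" "\<And>S T f. \<lbrakk>P S; P T; f \<in> mor S T\<rbrakk> \<Longrightarrow> \<phi> f \<in> mor' (F S) (F T)"
      "\<And>S. P S \<Longrightarrow> \<phi> (idm S) = idm' (F S)" "\<And>f g. \<phi> (cmp g f) = cmp' (\<phi> g) (\<phi> f)"
    and G: "\<And>S. P' S \<Longrightarrow> P (G S)" "\<And>S T f. \<lbrakk>P' S; P' T; f \<in> mor' S T\<rbrakk> \<Longrightarrow> \<psi> f \<in> mor (G S) (G T)"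
      "\<And>S. P' S \<Longrightarrow> \<psi> (idm' S) = idm (G S)" "\<And>f g. \<psi> (cmp' g f) = cmp (\<psi> g) (\<psi> f)"
    and GF: "\<And>S. P S \<Longrightarrow> G (F S) = S" "\<And>f. \<psi> (\<phi> f) = f"
    and u: "\<And>S. P' S \<Longrightarrow> u S \<in> mor' (F (G S)) S"
      "\<And>S. P' S \<Longrightarrow> \<exists>v \<in> mor' S (F (G S)). cmp' v (u S) = idm' (F (G S)) \<and> cmp' (u S) v = idm' S"
      "\<And>S T f. \<lbrakk>P' S; P' T; f \<in> mor' S T\<rbrakk> \<Longrightarrow> cmp' f (u S) = cmp' (u T) (\<phi> (\<psi> f))"
  shows "equivalent_categories (structure_category P mor idm cmp) (structure_category P' mor' idm' cmp')"
    "equivalent_categories (structure_category P' mor' idm' cmp') (structure_category P mor idm cmp)"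
proof -
  let ?A = "structure_category P mor idm cmp" and ?B = "structure_category P' mor' idm' cmp'"
  have F': "cat_functor ?A ?B F (\<lambda>(S, f, T). (F S, \<phi> f, F T))"
    by (rule structure_functor) (fact cat F)+
  have G': "cat_functor ?B ?A G (\<lambda>(S, f, T). (G S, \<psi> f, G T))"
    by (rule structure_functor) (fact cat G)+
  have "natural_iso ?B ?B (F \<circ> G) ((\<lambda>(S, f, T). (F S, \<phi> f, F T)) \<circ> (\<lambda>(S, f, T). (G S, \<psi> f, G T))) id id
      (\<lambda>S. (F (G S), u S, S))"
    unfolding natural_iso_def natural_iso_axioms_def
  proof (intro conjI allI impI cat_functor_comp[OF G' F'] cat_functor_id[OF cat(2)])
    fix S assume S: "S \<in> Obj ?B"
    then have "P' S" by (simp add: structure_simps)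
    moreover obtain v where "v \<in> mor' S (F (G S))" "cmp' v (u S) = idm' (F (G S))" "cmp' (u S) v = idm' S"
      using u(2)[OF \<open>P' S\<close>] by blast
    ultimately have "(F (G S), u S, S) \<in> hom ?B (F (G S)) S" "(S, v, F (G S)) \<in> hom ?B S (F (G S))"
      "(S, v, F (G S)) \<cdot>\<^bsub>?B\<^esub> (F (G S), u S, S) = ide ?B (F (G S))"
      "(F (G S), u S, S) \<cdot>\<^bsub>?B\<^esub> (S, v, F (G S)) = ide ?B S"
      using u(1) F(1) G(1) by (simp_all add: structure_hom_iff structure_simps)
    then show "(F (G S), u S, S) \<in> iso ?B ((F \<circ> G) S) (id S)"
      unfolding iso_def o_apply id_apply by blast
  next
    fix a S T assume "a \<in> hom ?B S T"
    then obtain f where f: "a = (S, f, T)" "P' S" "P' T" "f \<in> mor' S T"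
      unfolding structure_hom_iff by blast
    show "id a \<cdot>\<^bsub>?B\<^esub> (F (G S), u S, S) =
        (F (G T), u T, T) \<cdot>\<^bsub>?B\<^esub> ((\<lambda>(S, f, T). (F S, \<phi> f, F T)) \<circ> (\<lambda>(S, f, T). (G S, \<psi> f, G T))) a"
      using u(3)[OF f(2-4)] unfolding f(1) by (simp add: structure_simps)
  qed
  from equivalent_of_section[OF F' G' _ _ this] GF(1)
  have "(\<And>f. f \<in> Arr ?A \<Longrightarrow> (\<lambda>(S, f, T). (G S, \<psi> f, G T)) ((\<lambda>(S, f, T). (F S, \<phi> f, F T)) f) = f) \<Longrightarrow>
     equivalent_categories ?A ?B \<and> equivalent_categories ?B ?A"
    by (simp add: structure_simps)
  moreover have "(\<lambda>(S, f, T). (G S, \<psi> f, G T)) ((\<lambda>(S, f, T). (F S, \<phi> f, F T)) a) = a" if "a \<in> Arr ?A" for a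
    using that by (cases a) (simp add: structure_category_def GF)
  ultimately show "equivalent_categories ?A ?B" "equivalent_categories ?B ?A"
    by blast+
qed

section \<open>Composition and tensor products of arrows\<close>

text \<open>
  Membership in hom-sets is expressed through \<open>Arr\<close>, \<open>Dom\<close> and \<open>Cod\<close>, so that the simplifier can
  discharge all composability conditions.  Composites and tensor products are normalised to the right.
\<close>

context category
begin

lemma hom_iff: "f \<in> hom C X Y \<longleftrightarrow> f \<in> Arr C \<and> Dom C f = X \<and> Cod C f = Y"
  by (simp add: hom_def)

lemma comp_type [simp]:
  assumes "f \<in> Arr C" "g \<in> Arr C" "Dom C g = Cod C f"
  shows "g \<cdot> f \<in> Arr C" "Dom C (g \<cdot> f) = Dom C f" "Cod C (g \<cdot> f) = Cod C g"
  using comp_hom[of f "Dom C f" "Cod C f" g "Cod C g"] assms by (auto simp: hom_iff)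

lemma ide_type [simp]:
  assumes "X \<in> Obj C"
  shows "ide C X \<in> Arr C" "Dom C (ide C X) = X" "Cod C (ide C X) = X"
  using ide_hom[OF assms] by (auto simp: hom_iff)

lemma Dom_Obj [simp]: "f \<in> Arr C \<Longrightarrow> Dom C f \<in> Obj C"
  by (rule Dom_closed)

lemma Cod_Obj [simp]: "f \<in> Arr C \<Longrightarrow> Cod C f \<in> Obj C"
  by (rule Cod_closed)

lemma assoc [simp]:
  assumes "f \<in> Arr C" "g \<in> Arr C" "h \<in> Arr C" "Dom C g = Cod C f" "Dom C h = Cod C g"
  shows "(h \<cdot> g) \<cdot> f = h \<cdot> (g \<cdot> f)"
  using assms by (intro comp_assoc) (auto simp: hom_iff)

lemma ide_comp [simp]: "f \<in> Arr C \<Longrightarrow> Cod C f = Y \<Longrightarrow> ide C Y \<cdot> f = f"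
  by (rule comp_ide_left) (auto simp: hom_iff)

lemma comp_ide [simp]: "f \<in> Arr C \<Longrightarrow> Dom C f = X \<Longrightarrow> f \<cdot> ide C X = f"
  by (rule comp_ide_right) (auto simp: hom_iff)

end

context strict_monoidal_category
begin

declare unit_obj_closed [simp] tensor_obj_closed [simp] tensor_obj_assoc [simp]
  tensor_obj_unit_left [simp] tensor_obj_unit_right [simp]
  tensor_assoc [simp] tensor_unit_left [simp] tensor_unit_right [simp]

lemma tensor_type [simp]:
  assumes "f \<in> Arr C" "g \<in> Arr C"
  shows "f \<otimes> g \<in> Arr C" "Dom C (f \<otimes> g) = Dom C f \<otimes>\<^sub>o Dom C g"
    "Cod C (f \<otimes> g) = Cod C f \<otimes>\<^sub>o Cod C g"
  using tensor_hom[of f "Dom C f" "Cod C f" g "Dom C g" "Cod C g"] assms by (auto simp: hom_iff)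

lemma ide_tensor: "X \<in> Obj C \<Longrightarrow> Y \<in> Obj C \<Longrightarrow> ide C (X \<otimes>\<^sub>o Y) = ide C X \<otimes> ide C Y"
  by (simp add: tensor_ide)

lemma interchange:
  assumes "f \<in> Arr C" "g \<in> Arr C" "f' \<in> Arr C" "g' \<in> Arr C"
    "Dom C g = Cod C f" "Dom C g' = Cod C f'"
  shows "(g \<otimes> g') \<cdot> (f \<otimes> f') = (g \<cdot> f) \<otimes> (g' \<cdot> f')"
  using assms by (intro tensor_comp[symmetric]) (auto simp: hom_iff)

lemma interchange':
  assumes "f \<in> Arr C" "g \<in> Arr C" "f' \<in> Arr C" "g' \<in> Arr C" "h \<in> Arr C"
    "Dom C g = Cod C f" "Dom C g' = Cod C f'" "Cod C h = Dom C f \<otimes>\<^sub>o Dom C f'"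
  shows "(g \<otimes> g') \<cdot> ((f \<otimes> f') \<cdot> h) = ((g \<cdot> f) \<otimes> (g' \<cdot> f')) \<cdot> h"
  using assms by (simp flip: assoc add: interchange)

lemma ide_tensor_comp [simp]:
  assumes "f \<in> Arr C" "X \<in> Obj C" "Y \<in> Obj C"
  shows "Cod C f = X \<otimes>\<^sub>o Y \<Longrightarrow> (ide C X \<otimes> ide C Y) \<cdot> f = f"
    "Dom C f = X \<otimes>\<^sub>o Y \<Longrightarrow> f \<cdot> (ide C X \<otimes> ide C Y) = f"
  using assms by (simp_all flip: ide_tensor)

lemma ide_tensor3_comp [simp]:
  assumes "f \<in> Arr C" "X \<in> Obj C" "Y \<in> Obj C" "Z \<in> Obj C"
  shows "Cod C f = X \<otimes>\<^sub>o (Y \<otimes>\<^sub>o Z) \<Longrightarrow> (ide C X \<otimes> (ide C Y \<otimes> ide C Z)) \<cdot> f = f"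
    "Dom C f = X \<otimes>\<^sub>o (Y \<otimes>\<^sub>o Z) \<Longrightarrow> f \<cdot> (ide C X \<otimes> (ide C Y \<otimes> ide C Z)) = f"
  using assms by (simp_all flip: ide_tensor)

lemma tensor_comp_right:
  assumes "f \<in> Arr C" "g \<in> Arr C" "h \<in> Arr C" "Dom C g = Cod C h"
  shows "f \<otimes> (g \<cdot> h) = (ide C (Cod C f) \<otimes> g) \<cdot> (f \<otimes> h)"
  using assms by (simp add: interchange)

text \<open>
  Used in place of \<open>interchange\<close>, which would undo the factorisation on the right-hand side.
\<close>

lemma whisker:
  assumes "X \<in> Obj C" "Y \<in> Obj C" "g \<in> Arr C" "h \<in> Arr C" "Dom C g = Cod C h"
  shows "ide C X \<otimes> ((g \<cdot> h) \<otimes> ide C Y) = (ide C X \<otimes> (g \<otimes> ide C Y)) \<cdot> (ide C X \<otimes> (h \<otimes> ide C Y))"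
  using assms by (simp add: interchange)

lemma tensor_comp_left:
  assumes "f \<in> Arr C" "g \<in> Arr C" "h \<in> Arr C" "Dom C g = Cod C h"
  shows "(g \<cdot> h) \<otimes> f = (g \<otimes> ide C (Cod C f)) \<cdot> (h \<otimes> f)"
  using assms by (simp add: interchange)

end

context strict_braided_monoidal_category
begin

lemma braiding_type [simp]:
  assumes "X \<in> Obj C" "Y \<in> Obj C"
  shows "braiding C X Y \<in> Arr C" "Dom C (braiding C X Y) = X \<otimes>\<^sub>o Y"
    "Cod C (braiding C X Y) = Y \<otimes>\<^sub>o X"
  using braiding_iso[OF assms] by (auto simp: hom_iff iso_def)

lemma braid_nat:
  assumes "f \<in> Arr C" "g \<in> Arr C" "Dom C f = X" "Dom C g = Y"
  shows "braiding C (Cod C f) (Cod C g) \<cdot> (f \<otimes> g) = (g \<otimes> f) \<cdot> braiding C X Y"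
  using assms by (intro braiding_natural[symmetric]) (auto simp: hom_iff)

text \<open>
  An idempotent isomorphism is an identity; this gives the triviality of the braiding with the unit
  object, which the hexagon axioms only show to be idempotent.
\<close>

lemma iso_idem:
  assumes "f \<in> iso C Y Y" "f \<cdot> f = f"
  shows "f = ide C Y"
proof -
  obtain g where g: "g \<in> hom C Y Y" "g \<cdot> f = ide C Y" and f: "f \<in> hom C Y Y"
    using assms by (auto simp: iso_def)
  have "f = (g \<cdot> f) \<cdot> f" using f g by (simp add: hom_iff)
  also have "\<dots> = g \<cdot> (f \<cdot> f)" using f g(1) by (subst assoc) (auto simp: hom_iff)
  finally show ?thesis using assms g by simp
qed

lemma braiding_unit [simp]:
  assumes "X \<in> Obj C"
  shows "braiding C (unit_obj C) X = ide C X" "braiding C X (unit_obj C) = ide C X"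
proof -
  let ?K = "unit_obj C"
  have "braiding C ?K X \<cdot> braiding C ?K X = braiding C ?K X"
    using hexagon_left[of ?K ?K X] assms by simp
  then show "braiding C ?K X = ide C X"
    using braiding_iso[of ?K X] assms by (intro iso_idem) auto
  have "braiding C X ?K \<cdot> braiding C X ?K = braiding C X ?K"
    using hexagon_right[of X ?K ?K] assms by simp
  then show "braiding C X ?K = ide C X"
    using braiding_iso[of X ?K] assms by (intro iso_idem) auto
qed

section \<open>Pairing along a coalgebra\<close>

text \<open>
  The morphism \<open>d \<mapsto> f(d\<^sub>1) \<otimes> g(d\<^sub>2)\<close> in Sweedler notation.
\<close>

definition pair :: "('o, 'a, 'r) coalgebra_scheme \<Rightarrow> 'a \<Rightarrow> 'a \<Rightarrow> 'a" where
  "pair D f g = (f \<otimes> g) \<cdot> comult D"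

lemma coalgebra_type:
  assumes "coalgebra C D"
  shows "carrier D \<in> Obj C"
    "counit D \<in> Arr C" "Dom C (counit D) = carrier D" "Cod C (counit D) = unit_obj C"
    "comult D \<in> Arr C" "Dom C (comult D) = carrier D" "Cod C (comult D) = carrier D \<otimes>\<^sub>o carrier D"
  using assms by (auto simp: coalgebra_def Let_def hom_iff)

lemma pair_type [simp]:
  assumes "coalgebra C D" "f \<in> Arr C" "g \<in> Arr C" "Dom C f = carrier D" "Dom C g = carrier D"
  shows "pair D f g \<in> Arr C" "Dom C (pair D f g) = carrier D"
    "Cod C (pair D f g) = Cod C f \<otimes>\<^sub>o Cod C g"
  using assms by (simp_all add: pair_def coalgebra_type)

lemma tensor_pair:
  assumes "coalgebra C D" "f \<in> Arr C" "g \<in> Arr C" "Dom C f = carrier D" "Dom C g = carrier D"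
    "u \<in> Arr C" "v \<in> Arr C" "Dom C u = Cod C f" "Dom C v = Cod C g"
  shows "(u \<otimes> v) \<cdot> pair D f g = pair D (u \<cdot> f) (v \<cdot> g)"
  using assms by (simp add: pair_def coalgebra_type interchange')

lemma pair_assoc:
  assumes "coalgebra C D" "f \<in> Arr C" "g \<in> Arr C" "h \<in> Arr C"
    "Dom C f = carrier D" "Dom C g = carrier D" "Dom C h = carrier D"
  shows "pair D (pair D f g) h = pair D f (pair D g h)"
proof -
  let ?X = "ide C (carrier D)" and ?\<delta> = "comult D"
  note t = assms coalgebra_type[OF assms(1)]
  have co: "(?\<delta> \<otimes> ?X) \<cdot> ?\<delta> = (?X \<otimes> ?\<delta>) \<cdot> ?\<delta>"
    using assms(1) by (simp add: coalgebra_def Let_def)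
  have "pair D (pair D f g) h = (((f \<otimes> g) \<otimes> h) \<cdot> (?\<delta> \<otimes> ?X)) \<cdot> ?\<delta>"
    using t by (simp add: pair_def interchange del: tensor_assoc)
  also have "\<dots> = (f \<otimes> (g \<otimes> h)) \<cdot> ((?X \<otimes> ?\<delta>) \<cdot> ?\<delta>)"
    using t by (simp flip: co)
  also have "\<dots> = pair D f (pair D g h)"
    using t by (simp add: pair_def interchange')
  finally show ?thesis .
qed

lemma pair_counit [simp]:
  assumes "coalgebra C D" "f \<in> Arr C" "Dom C f = carrier D"
  shows "pair D (counit D) f = f" "pair D f (counit D) = f"
proof -
  let ?X = "ide C (carrier D)"
  note t = assms coalgebra_type[OF assms(1)]
  have co: "(counit D \<otimes> ?X) \<cdot> comult D = ?X" "(?X \<otimes> counit D) \<cdot> comult D = ?X"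
    using assms(1) by (simp_all add: coalgebra_def Let_def)
  have "(ide C (unit_obj C) \<otimes> f) \<cdot> ((counit D \<otimes> ?X) \<cdot> comult D) = f"
    unfolding co using t by simp
  then show "pair D (counit D) f = f"
    using t by (simp add: pair_def interchange' del: tensor_unit_left)
  have "(f \<otimes> ide C (unit_obj C)) \<cdot> ((?X \<otimes> counit D) \<cdot> comult D) = f"
    unfolding co using t by simp
  then show "pair D f (counit D) = f"
    using t by (simp add: pair_def interchange' del: tensor_unit_right)
qed

lemma pair_ide: "coalgebra C D \<Longrightarrow> pair D (ide C (carrier D)) (ide C (carrier D)) = comult D"
  by (simp add: pair_def coalgebra_type flip: ide_tensor)

lemma coalgebra_morD:
  assumes "h \<in> coalgebra_mor C D E"
  shows "h \<in> Arr C" "Dom C h = carrier D" "Cod C h = carrier E"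
    "counit E \<cdot> h = counit D" "comult E \<cdot> h = pair D h h"
  using assms by (auto simp: coalgebra_mor_def hom_iff pair_def)

lemma coalgebra_morI:
  assumes "h \<in> Arr C" "Dom C h = carrier D" "Cod C h = carrier E"
    "counit E \<cdot> h = counit D" "comult E \<cdot> h = pair D h h"
  shows "h \<in> coalgebra_mor C D E"
  using assms by (auto simp: coalgebra_mor_def hom_iff pair_def)

lemma pair_comp:
  assumes "h \<in> coalgebra_mor C D E" "coalgebra C D" "coalgebra C E" "f \<in> Arr C" "g \<in> Arr C"
    "Dom C f = carrier E" "Dom C g = carrier E"
  shows "pair E f g \<cdot> h = pair D (f \<cdot> h) (g \<cdot> h)"
proof -
  note h = coalgebra_morD[OF assms(1)]
  note t = assms(2-) coalgebra_type[OF assms(2)] coalgebra_type[OF assms(3)] h(1-3)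
  have "pair E f g \<cdot> h = (f \<otimes> g) \<cdot> (comult E \<cdot> h)"
    using t by (simp add: pair_def)
  also have "\<dots> = pair D (f \<cdot> h) (g \<cdot> h)"
    unfolding h(5) using t by (simp add: tensor_pair)
  finally show ?thesis .
qed

lemma coalgebra_mor_comp:
  assumes "coalgebra C D" "coalgebra C E" "coalgebra C F"
    "f \<in> coalgebra_mor C D E" "g \<in> coalgebra_mor C E F"
  shows "g \<cdot> f \<in> coalgebra_mor C D F"
proof (rule coalgebra_morI)
  note f = coalgebra_morD[OF assms(4)] and g = coalgebra_morD[OF assms(5)]
  note t = coalgebra_type[OF assms(1)] coalgebra_type[OF assms(2)] coalgebra_type[OF assms(3)] f(1-3) g(1-3)
  show "g \<cdot> f \<in> Arr C" "Dom C (g \<cdot> f) = carrier D" "Cod C (g \<cdot> f) = carrier F"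
    using t by simp_all
  have "counit F \<cdot> (g \<cdot> f) = (counit F \<cdot> g) \<cdot> f" using t by simp
  then show "counit F \<cdot> (g \<cdot> f) = counit D" by (simp add: f g)
  have "comult F \<cdot> (g \<cdot> f) = (comult F \<cdot> g) \<cdot> f" using t by simp
  then show "comult F \<cdot> (g \<cdot> f) = pair D (g \<cdot> f) (g \<cdot> f)"
    using t assms by (simp add: f g pair_comp)
qed

lemma ide_coalgebra_mor:
  "coalgebra C D \<Longrightarrow> ide C (carrier D) \<in> coalgebra_mor C D D"
  by (rule coalgebra_morI) (simp_all add: coalgebra_type pair_ide)

lemma unit_coalgebra: "coalgebra C (unit_coalgebra C)"
  by (simp add: coalgebra_def unit_coalgebra_def Let_def hom_iff)

section \<open>Tensor products of coalgebras\<close>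

lemma tensor_coalgebra_simps [simp]:
  "carrier (tensor_coalgebra C D E) = carrier D \<otimes>\<^sub>o carrier E"
  "counit (tensor_coalgebra C D E) = counit D \<otimes> counit E"
  by (simp_all add: tensor_coalgebra_def)

text \<open>
  The pairing over \<open>D \<otimes> E\<close> of two tensor products.  Naturality moves the braiding of the
  comultiplication past the arrows; all later identities about \<open>D \<otimes> E\<close> are instances.
\<close>

lemma pair_tensor_raw:
  assumes "coalgebra C D" "coalgebra C E"
    "f \<in> Arr C" "f' \<in> Arr C" "Dom C f = carrier D" "Dom C f' = carrier D"
    "g \<in> Arr C" "g' \<in> Arr C" "Dom C g = carrier E" "Dom C g' = carrier E"
  shows "pair (tensor_coalgebra C D E) (f \<otimes> g) (f' \<otimes> g') =
    (ide C (Cod C f) \<otimes> braiding C (Cod C f') (Cod C g) \<otimes> ide C (Cod C g')) \<cdot>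
      (pair D f f' \<otimes> pair E g g')"
proof -
  let ?D = "ide C (carrier D)" and ?E = "ide C (carrier E)"
  let ?c = "braiding C (carrier D) (carrier E)"
  let ?c' = "braiding C (Cod C f') (Cod C g)"
  note t = assms coalgebra_type[OF assms(1)] coalgebra_type[OF assms(2)]
  have "pair (tensor_coalgebra C D E) (f \<otimes> g) (f' \<otimes> g') =
    (f \<otimes> ((g \<otimes> f') \<otimes> g')) \<cdot> ((?D \<otimes> (?c \<otimes> ?E)) \<cdot> (comult D \<otimes> comult E))"
    using t by (simp add: pair_def tensor_coalgebra_def)
  also have "\<dots> = (f \<otimes> (((g \<otimes> f') \<cdot> ?c) \<otimes> g')) \<cdot> (comult D \<otimes> comult E)"
    using t by (simp add: interchange interchange' del: tensor_assoc)
  also have "(g \<otimes> f') \<cdot> ?c = ?c' \<cdot> (f' \<otimes> g)"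
    using t by (simp add: braid_nat)
  also have "(f \<otimes> ((?c' \<cdot> (f' \<otimes> g)) \<otimes> g')) \<cdot> (comult D \<otimes> comult E) =
    (ide C (Cod C f) \<otimes> (?c' \<otimes> ide C (Cod C g'))) \<cdot> ((f \<otimes> ((f' \<otimes> g) \<otimes> g')) \<cdot> (comult D \<otimes> comult E))"
    using t by (simp add: interchange interchange' del: tensor_assoc)
  also have "(f \<otimes> ((f' \<otimes> g) \<otimes> g')) = (f \<otimes> f') \<otimes> (g \<otimes> g')"
    using t by simp
  also have "\<dots> \<cdot> (comult D \<otimes> comult E) = pair D f f' \<otimes> pair E g g'"
    unfolding pair_def using t by (intro interchange) simp_all
  finally show ?thesis using t by simp
qed

text \<open>
  The next two identities compare two ways of shuffling strands, and underlie the coassociativity of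
  \<open>D \<otimes> E\<close> and the associativity of the tensor product of coalgebras.  In both, the hexagon axioms split
  the long crossings, and two crossings on disjoint strands are exchanged.
\<close>

lemma braiding_shuffle_coassoc:
  assumes "X \<in> Obj C" "Y \<in> Obj C"
  shows "(braiding C X Y \<otimes> ide C Y \<otimes> ide C X) \<cdot> (ide C X \<otimes> braiding C X (Y \<otimes>\<^sub>o Y)) =
    (ide C Y \<otimes> ide C X \<otimes> braiding C X Y) \<cdot> (braiding C (X \<otimes>\<^sub>o X) Y \<otimes> ide C Y)"
proof -
  let ?c = "braiding C X Y" and ?X = "ide C X" and ?Y = "ide C Y"
  have split: "?X \<otimes> ((?Y \<otimes> ?c) \<cdot> (?c \<otimes> ?Y)) = (?X \<otimes> ?Y \<otimes> ?c) \<cdot> (?X \<otimes> ?c \<otimes> ?Y)"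
    "((?c \<otimes> ?X) \<cdot> (?X \<otimes> ?c)) \<otimes> ?Y = (?c \<otimes> ?X \<otimes> ?Y) \<cdot> (?X \<otimes> ?c \<otimes> ?Y)"
    using assms by (simp_all add: tensor_comp_left tensor_comp_right)
  have "(?c \<otimes> (?Y \<otimes> ?X)) \<cdot> ((?X \<otimes> ?Y) \<otimes> ?c) = ((?Y \<otimes> ?X) \<otimes> ?c) \<cdot> (?c \<otimes> (?X \<otimes> ?Y))"
    using assms by (simp add: interchange del: tensor_assoc flip: ide_tensor)
  then show ?thesis
    using assms by (simp add: hexagon_right hexagon_left split flip: assoc)
qed

lemma braiding_shuffle_assoc:
  assumes "X \<in> Obj C" "Y \<in> Obj C" "Z \<in> Obj C"
  shows "(braiding C X (Y \<otimes>\<^sub>o Z) \<otimes> ide C Y) \<cdot> (ide C X \<otimes> ide C Y \<otimes> braiding C Y Z) =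
    (ide C Y \<otimes> braiding C (X \<otimes>\<^sub>o Y) Z) \<cdot> (braiding C X Y \<otimes> ide C Y \<otimes> ide C Z)"
proof -
  let ?X = "ide C X" and ?Y = "ide C Y" and ?Z = "ide C Z"
  let ?a = "braiding C X Y" and ?b = "braiding C X Z" and ?d = "braiding C Y Z"
  have split: "((?Y \<otimes> ?b) \<cdot> (?a \<otimes> ?Z)) \<otimes> ?Y = (?Y \<otimes> ?b \<otimes> ?Y) \<cdot> (?a \<otimes> ?Z \<otimes> ?Y)"
    "?Y \<otimes> ((?b \<otimes> ?Y) \<cdot> (?X \<otimes> ?d)) = (?Y \<otimes> ?b \<otimes> ?Y) \<cdot> (?Y \<otimes> ?X \<otimes> ?d)"
    using assms by (simp_all add: tensor_comp_left tensor_comp_right)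
  have "(?a \<otimes> (?Z \<otimes> ?Y)) \<cdot> ((?X \<otimes> ?Y) \<otimes> ?d) = ((?Y \<otimes> ?X) \<otimes> ?d) \<cdot> (?a \<otimes> (?Y \<otimes> ?Z))"
    using assms by (simp add: interchange del: tensor_assoc flip: ide_tensor)
  then show ?thesis
    using assms by (simp add: hexagon_right hexagon_left split)
qed

lemma comult_tensor_type:
  assumes "coalgebra C D" "coalgebra C E"
  shows "comult (tensor_coalgebra C D E) \<in> Arr C"
    "Dom C (comult (tensor_coalgebra C D E)) = carrier D \<otimes>\<^sub>o carrier E"
    "Cod C (comult (tensor_coalgebra C D E)) = carrier D \<otimes>\<^sub>o carrier E \<otimes>\<^sub>o carrier D \<otimes>\<^sub>o carrier E"
  using coalgebra_type[OF assms(1)] coalgebra_type[OF assms(2)] by (simp_all add: tensor_coalgebra_def)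

lemma coalgebra_tensor [simp]:
  assumes "coalgebra C D" "coalgebra C E"
  shows "coalgebra C (tensor_coalgebra C D E)"
proof -
  let ?DE = "tensor_coalgebra C D E"
  let ?X = "carrier D" and ?Y = "carrier E"
  let ?D = "ide C ?X" and ?E = "ide C ?Y"
  let ?c = "braiding C ?X ?Y"
  let ?L = "?D \<otimes> (?c \<otimes> ?E)"
  note t = assms coalgebra_type[OF assms(1)] coalgebra_type[OF assms(2)] comult_tensor_type[OF assms]
  have \<delta>: "comult ?DE = ?L \<cdot> (comult D \<otimes> comult E)"
    using t by (simp add: tensor_coalgebra_def)
  have pD: "pair D (comult D) ?D = pair D ?D (comult D)"
    "pair E (comult E) ?E = pair E ?E (comult E)"
    using pair_assoc[of D ?D ?D ?D] pair_assoc[of E ?E ?E ?E] t by (simp_all add: pair_ide)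
  let ?w = "pair D ?D (comult D) \<otimes> pair E ?E (comult E)"
  have "(comult ?DE \<otimes> ide C (?X \<otimes>\<^sub>o ?Y)) \<cdot> comult ?DE =
      (?L \<otimes> (?D \<otimes> ?E)) \<cdot> pair ?DE (comult D \<otimes> comult E) (?D \<otimes> ?E)"
    unfolding pair_def using t by (simp add: interchange' \<delta> ide_tensor del: tensor_assoc)
  also have "\<dots> = (?L \<otimes> (?D \<otimes> ?E)) \<cdot> (((?D \<otimes> ?D) \<otimes> braiding C ?X (?Y \<otimes>\<^sub>o ?Y) \<otimes> ?E) \<cdot> ?w)"
    using t by (simp add: pair_tensor_raw pD ide_tensor)
  also have "\<dots> = (?D \<otimes> ((?c \<otimes> ?E \<otimes> ?D) \<cdot> (?D \<otimes> braiding C ?X (?Y \<otimes>\<^sub>o ?Y))) \<otimes> ?E) \<cdot> ?w"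
    using t by (simp add: whisker ide_tensor)
  also have "\<dots> = (?D \<otimes> ((?E \<otimes> ?D \<otimes> ?c) \<cdot> (braiding C (?X \<otimes>\<^sub>o ?X) ?Y \<otimes> ?E)) \<otimes> ?E) \<cdot> ?w"
    using t by (subst braiding_shuffle_coassoc) simp_all
  also have "\<dots> = ((?D \<otimes> ?E) \<otimes> ?L) \<cdot> ((?D \<otimes> braiding C (?X \<otimes>\<^sub>o ?X) ?Y \<otimes> (?E \<otimes> ?E)) \<cdot> ?w)"
    using t by (simp add: whisker ide_tensor)
  also have "\<dots> = ((?D \<otimes> ?E) \<otimes> ?L) \<cdot> pair ?DE (?D \<otimes> ?E) (comult D \<otimes> comult E)"
    using t by (simp add: pair_tensor_raw ide_tensor)
  also have "\<dots> = (ide C (?X \<otimes>\<^sub>o ?Y) \<otimes> comult ?DE) \<cdot> comult ?DE"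
    unfolding pair_def using t by (simp add: interchange' \<delta> ide_tensor del: tensor_assoc)
  finally have co: "(comult ?DE \<otimes> ide C (?X \<otimes>\<^sub>o ?Y)) \<cdot> comult ?DE =
    (ide C (?X \<otimes>\<^sub>o ?Y) \<otimes> comult ?DE) \<cdot> comult ?DE" .
  have l: "((counit D \<otimes> counit E) \<otimes> ide C (?X \<otimes>\<^sub>o ?Y)) \<cdot> comult ?DE = ide C (?X \<otimes>\<^sub>o ?Y)"
    using pair_tensor_raw[of D E "counit D" ?D "counit E" ?E] t
    by (simp add: pair_def[of ?DE] ide_tensor)
  have r: "(ide C (?X \<otimes>\<^sub>o ?Y) \<otimes> (counit D \<otimes> counit E)) \<cdot> comult ?DE = ide C (?X \<otimes>\<^sub>o ?Y)"
    using pair_tensor_raw[of D E ?D "counit D" ?E "counit E"] t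
    by (simp add: pair_def[of ?DE] ide_tensor)
  show ?thesis
    unfolding coalgebra_def Let_def using t co l r by (simp add: hom_iff)
qed

lemma tensor_coalgebra_assoc:
  assumes "coalgebra C D" "coalgebra C E" "coalgebra C F"
  shows "tensor_coalgebra C (tensor_coalgebra C D E) F = tensor_coalgebra C D (tensor_coalgebra C E F)"
proof -
  let ?X = "carrier D" and ?Y = "carrier E" and ?Z = "carrier F"
  let ?D = "ide C ?X" and ?E = "ide C ?Y" and ?F = "ide C ?Z"
  let ?w = "comult D \<otimes> comult E \<otimes> comult F"
  let ?c = "braiding C"
  note t = assms coalgebra_type[OF assms(1)] coalgebra_type[OF assms(2)] coalgebra_type[OF assms(3)]
  have "comult (tensor_coalgebra C D (tensor_coalgebra C E F)) =
    (?D \<otimes> ?c ?X (?Y \<otimes>\<^sub>o ?Z) \<otimes> (?E \<otimes> ?F)) \<cdot>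
     (((?D \<otimes> ?D) \<otimes> (?E \<otimes> ?c ?Y ?Z \<otimes> ?F)) \<cdot> ?w)"
    using t by (simp add: tensor_coalgebra_def ide_tensor tensor_comp_right)
  also have "\<dots> = (?D \<otimes> ((?c ?X (?Y \<otimes>\<^sub>o ?Z) \<otimes> ?E) \<cdot> (?D \<otimes> ?E \<otimes> ?c ?Y ?Z)) \<otimes> ?F) \<cdot> ?w"
    using t by (simp add: whisker ide_tensor)
  also have "\<dots> = (?D \<otimes> ((?E \<otimes> ?c (?X \<otimes>\<^sub>o ?Y) ?Z) \<cdot> (?c ?X ?Y \<otimes> ?E \<otimes> ?F)) \<otimes> ?F) \<cdot> ?w"
    using t by (simp only: braiding_shuffle_assoc)
  also have "\<dots> = ((?D \<otimes> ?E) \<otimes> ?c (?X \<otimes>\<^sub>o ?Y) ?Z \<otimes> ?F) \<cdot>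
     (((?D \<otimes> ?c ?X ?Y \<otimes> ?E) \<otimes> (?F \<otimes> ?F)) \<cdot> ?w)"
    using t by (simp add: whisker ide_tensor)
  also have "\<dots> = comult (tensor_coalgebra C (tensor_coalgebra C D E) F)"
    using t by (simp add: tensor_coalgebra_def ide_tensor tensor_comp_left)
  finally show ?thesis
    by (intro coalgebra.equality) (use t in simp_all)
qed

lemma tensor_coalgebra_mor:
  assumes "coalgebra C D" "coalgebra C E" "coalgebra C D'" "coalgebra C E'"
    "f \<in> coalgebra_mor C D D'" "g \<in> coalgebra_mor C E E'"
  shows "f \<otimes> g \<in> coalgebra_mor C (tensor_coalgebra C D E) (tensor_coalgebra C D' E')"
proof (rule coalgebra_morI)
  note f = coalgebra_morD[OF assms(5)] and g = coalgebra_morD[OF assms(6)]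
  note t = assms(1-4) coalgebra_type[OF assms(1)] coalgebra_type[OF assms(2)] coalgebra_type[OF assms(3)] coalgebra_type[OF assms(4)] f(1-3) g(1-3)
  show "f \<otimes> g \<in> Arr C" "Dom C (f \<otimes> g) = carrier (tensor_coalgebra C D E)"
    "Cod C (f \<otimes> g) = carrier (tensor_coalgebra C D' E')"
    using t by simp_all
  show "counit (tensor_coalgebra C D' E') \<cdot> (f \<otimes> g) = counit (tensor_coalgebra C D E)"
    using t by (simp add: interchange f g)
  have "pair (tensor_coalgebra C D E) (f \<otimes> g) (f \<otimes> g) =
     (ide C (carrier D') \<otimes> braiding C (carrier D') (carrier E') \<otimes> ide C (carrier E')) \<cdot>
     ((comult D' \<otimes> comult E') \<cdot> (f \<otimes> g))"
    using t by (simp add: pair_tensor_raw interchange f(5) g(5))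
  then show "comult (tensor_coalgebra C D' E') \<cdot> (f \<otimes> g) =
      pair (tensor_coalgebra C D E) (f \<otimes> g) (f \<otimes> g)"
    using t by (simp add: tensor_coalgebra_def)
qed

text \<open>
  The coalgebra projections \<open>D \<otimes> \<epsilon>\<close> and \<open>\<epsilon> \<otimes> E\<close> of \<open>D \<otimes> E\<close>.
\<close>

definition prj1 :: "('o, 'a, 'r) coalgebra_scheme \<Rightarrow> ('o, 'a, 's) coalgebra_scheme \<Rightarrow> 'a" where
  "prj1 D E = ide C (carrier D) \<otimes> counit E"

definition prj2 :: "('o, 'a, 'r) coalgebra_scheme \<Rightarrow> ('o, 'a, 's) coalgebra_scheme \<Rightarrow> 'a" where
  "prj2 D E = counit D \<otimes> ide C (carrier E)"

lemma prj_type [simp]: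
  assumes "coalgebra C D" "coalgebra C E"
  shows "prj1 D E \<in> Arr C" "Dom C (prj1 D E) = carrier D \<otimes>\<^sub>o carrier E" "Cod C (prj1 D E) = carrier D"
    "prj2 D E \<in> Arr C" "Dom C (prj2 D E) = carrier D \<otimes>\<^sub>o carrier E" "Cod C (prj2 D E) = carrier E"
  using coalgebra_type[OF assms(1)] coalgebra_type[OF assms(2)] by (simp_all add: prj1_def prj2_def)

lemma prj1_mor [simp]:
  assumes "coalgebra C D" "coalgebra C E"
  shows "prj1 D E \<in> coalgebra_mor C (tensor_coalgebra C D E) D"
proof (rule coalgebra_morI)
  let ?D = "ide C (carrier D)"
  note t = assms coalgebra_type[OF assms(1)] coalgebra_type[OF assms(2)]
  show "prj1 D E \<in> Arr C" "Dom C (prj1 D E) = carrier (tensor_coalgebra C D E)"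
    "Cod C (prj1 D E) = carrier D"
    using t by simp_all
  have [simp]: "f \<cdot> prj1 D E = f \<otimes> counit E" if "f \<in> Arr C" "Dom C f = carrier D" for f
    using t that interchange[of ?D f "counit E" "ide C (unit_obj C)"] by (simp add: prj1_def)
  show "counit D \<cdot> prj1 D E = counit (tensor_coalgebra C D E)"
    using t by simp
  have "pair (tensor_coalgebra C D E) (prj1 D E) (prj1 D E) = comult D \<otimes> counit E"
    using t by (simp add: prj1_def pair_tensor_raw pair_ide)
  then show "comult D \<cdot> prj1 D E = pair (tensor_coalgebra C D E) (prj1 D E) (prj1 D E)"
    using t by simp
qed

lemma pair_prj [simp]:
  assumes "coalgebra C D" "coalgebra C E"
  shows "pair (tensor_coalgebra C D E) (prj1 D E) (prj2 D E) = ide C (carrier D \<otimes>\<^sub>o carrier E)"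
  using assms coalgebra_type[OF assms(1)] coalgebra_type[OF assms(2)]
  by (simp add: prj1_def prj2_def pair_tensor_raw ide_tensor interchange)

text \<open>
  In the absence of cocommutativity, a pair of coalgebra morphisms is a coalgebra morphism as soon as
  the two commute up to the braiding.
\<close>

lemma commuting_pair_mor:
  assumes "coalgebra C D" "coalgebra C A" "coalgebra C B"
    "f \<in> coalgebra_mor C D A" "g \<in> coalgebra_mor C D B"
    and comm: "braiding C (carrier A) (carrier B) \<cdot> pair D f g = pair D g f"
  shows "pair D f g \<in> coalgebra_mor C D (tensor_coalgebra C A B)"
proof (rule coalgebra_morI)
  note f = coalgebra_morD[OF assms(4)] and g = coalgebra_morD[OF assms(5)]
  note t = assms(1-3) coalgebra_type[OF assms(1)] coalgebra_type[OF assms(2)] coalgebra_type[OF assms(3)] f(1-3) g(1-3)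
  let ?A = "ide C (carrier A)" and ?B = "ide C (carrier B)" and ?c = "braiding C (carrier A) (carrier B)"
  show "pair D f g \<in> Arr C" "Dom C (pair D f g) = carrier D"
    "Cod C (pair D f g) = carrier (tensor_coalgebra C A B)"
    using t by simp_all
  show "counit (tensor_coalgebra C A B) \<cdot> pair D f g = counit D"
    using t by (simp add: tensor_pair f g)
  have "comult (tensor_coalgebra C A B) \<cdot> pair D f g =
      (?A \<otimes> (?c \<otimes> ?B)) \<cdot> pair D (pair D f f) (pair D g g)"
    using t by (simp add: tensor_coalgebra_def tensor_pair f(5) g(5))
  also have "pair D (pair D f f) (pair D g g) = pair D f (pair D (pair D f g) g)"
    using t by (simp add: pair_assoc)
  also have "(?A \<otimes> (?c \<otimes> ?B)) \<cdot> \<dots> = pair D f (pair D (pair D g f) g)"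
    using t by (simp add: tensor_pair comm)
  also have "\<dots> = pair D (pair D f g) (pair D f g)"
    using t by (simp add: pair_assoc)
  finally show "comult (tensor_coalgebra C A B) \<cdot> pair D f g = pair D (pair D f g) (pair D f g)" .
qed

lemma tensor_comult_left:
  assumes "coalgebra C D" "coalgebra C E" "u \<in> Arr C" "v \<in> Arr C"
    "Dom C u = carrier D" "Dom C v = carrier D \<otimes>\<^sub>o carrier E"
  shows "(u \<otimes> v) \<cdot> (comult D \<otimes> ide C (carrier E)) =
    pair (tensor_coalgebra C D E) (u \<cdot> prj1 D E) v"
proof -
  note t = assms coalgebra_type[OF assms(1)] coalgebra_type[OF assms(2)]
  have "comult D \<otimes> ide C (carrier E) =
      pair (tensor_coalgebra C D E) (prj1 D E) (ide C (carrier D \<otimes>\<^sub>o carrier E))"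
    using t by (simp add: prj1_def ide_tensor pair_tensor_raw pair_ide)
  then show ?thesis
    using t by (simp add: tensor_pair)
qed

text \<open>
  The composite occurring in the distributive laws: \<open>d \<otimes> e \<otimes> f \<mapsto> u(d\<^sub>1, e) \<otimes> v(d\<^sub>2, f)\<close>.
\<close>

lemma tensor_comult_distrib:
  assumes "coalgebra C D" "coalgebra C E" "coalgebra C F" "u \<in> Arr C" "v \<in> Arr C"
    "Dom C u = carrier D \<otimes>\<^sub>o carrier E" "Dom C v = carrier D \<otimes>\<^sub>o carrier F"
  shows "(u \<otimes> v) \<cdot> ((ide C (carrier D) \<otimes> braiding C (carrier D) (carrier E) \<otimes> ide C (carrier F)) \<cdot>
      (comult D \<otimes> ide C (carrier E) \<otimes> ide C (carrier F))) =
    pair (tensor_coalgebra C D (tensor_coalgebra C E F))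
      (u \<cdot> (ide C (carrier D) \<otimes> prj1 E F)) (v \<cdot> (ide C (carrier D) \<otimes> prj2 E F))"
proof -
  note t = assms coalgebra_type[OF assms(1)] coalgebra_type[OF assms(2)] coalgebra_type[OF assms(3)]
  have eq: "pair (tensor_coalgebra C D (tensor_coalgebra C E F))
      (ide C (carrier D) \<otimes> prj1 E F) (ide C (carrier D) \<otimes> prj2 E F) =
     (ide C (carrier D) \<otimes> braiding C (carrier D) (carrier E) \<otimes> ide C (carrier F)) \<cdot>
      (comult D \<otimes> ide C (carrier E) \<otimes> ide C (carrier F))"
    using t by (simp add: pair_tensor_raw pair_ide ide_tensor)
  show ?thesis
    unfolding eq[symmetric] using t by (subst tensor_pair) simp_all
qed

lemma prj1_tensor:
  assumes "coalgebra C D" "coalgebra C E" "coalgebra C D'" "coalgebra C E'"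
    "f \<in> Arr C" "Dom C f = carrier D" "Cod C f = carrier D'" "g \<in> coalgebra_mor C E E'"
  shows "prj1 D' E' \<cdot> (f \<otimes> g) = f \<cdot> prj1 D E"
proof -
  note g = coalgebra_morD[OF assms(8)]
  note t = assms(1-7) coalgebra_type[OF assms(1)] coalgebra_type[OF assms(2)] coalgebra_type[OF assms(3)] coalgebra_type[OF assms(4)] g
  show ?thesis
    using t interchange[of "ide C (carrier D)" f "counit E" "ide C (unit_obj C)"]
    by (simp add: prj1_def interchange)
qed

lemma prj_pair:
  assumes "coalgebra C D" "coalgebra C A" "coalgebra C B"
    "f \<in> coalgebra_mor C D A" "g \<in> coalgebra_mor C D B"
  shows "prj1 A B \<cdot> pair D f g = f" "prj2 A B \<cdot> pair D f g = g"
proof -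
  note f = coalgebra_morD[OF assms(4)] and g = coalgebra_morD[OF assms(5)]
  note t = assms(1-3) coalgebra_type[OF assms(1)] coalgebra_type[OF assms(2)] coalgebra_type[OF assms(3)] f(1-4) g(1-4)
  show "prj1 A B \<cdot> pair D f g = f" "prj2 A B \<cdot> pair D f g = g"
    using t by (simp_all add: prj1_def prj2_def tensor_pair)
qed

lemma comult_braid_left:
  assumes "coalgebra C D" "coalgebra C E"
  shows "(ide C (carrier D) \<otimes> braiding C (carrier D) (carrier E)) \<cdot> (comult D \<otimes> ide C (carrier E)) =
    pair (tensor_coalgebra C D E) (ide C (carrier D \<otimes>\<^sub>o carrier E)) (prj1 D E)"
  using assms coalgebra_type[OF assms(1)] coalgebra_type[OF assms(2)]
  by (simp add: prj1_def ide_tensor pair_tensor_raw pair_ide)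

lemma star_condition_iff:
  assumes "coalgebra C D" "m \<in> Arr C" "Dom C m = carrier D \<otimes>\<^sub>o carrier D" "Cod C m = carrier D"
  shows "star_condition C D m \<longleftrightarrow>
    braiding C (carrier D) (carrier D) \<cdot> pair (tensor_coalgebra C D D) (prj1 D D) m =
    pair (tensor_coalgebra C D D) m (prj1 D D)"
proof -
  let ?D = "ide C (carrier D)" and ?c = "braiding C (carrier D) (carrier D)"
  let ?DD = "tensor_coalgebra C D D"
  note t = assms coalgebra_type[OF assms(1)]
  have nat: "(m \<otimes> ?D) \<cdot> braiding C (carrier D) (carrier D \<otimes>\<^sub>o carrier D) = ?c \<cdot> (?D \<otimes> m)"
    using t braid_nat[of ?D m "carrier D" "carrier D \<otimes>\<^sub>o carrier D"] by simp
  have r: "(m \<otimes> ?D) \<cdot> (?D \<otimes> ?c) \<cdot> (comult D \<otimes> ?D) = pair ?DD m (prj1 D D)"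
    using t by (simp add: comult_braid_left tensor_pair)
  have "(m \<otimes> ?D) \<cdot> (?D \<otimes> ?c) \<cdot> ((?c \<cdot> comult D) \<otimes> ?D) =
      (m \<otimes> ?D) \<cdot> (((?D \<otimes> ?c) \<cdot> (?c \<otimes> ?D)) \<cdot> (comult D \<otimes> ?D))"
    using t by (simp add: tensor_comp_left)
  also have "\<dots> = ((m \<otimes> ?D) \<cdot> braiding C (carrier D) (carrier D \<otimes>\<^sub>o carrier D)) \<cdot> (comult D \<otimes> ?D)"
    using t by (simp add: hexagon_right)
  also have "\<dots> = ?c \<cdot> ((?D \<otimes> m) \<cdot> (comult D \<otimes> ?D))"
    using t by (simp add: nat flip: assoc)
  also have "\<dots> = ?c \<cdot> pair ?DD (prj1 D D) m"
    using t by (simp add: tensor_comult_left)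
  finally show ?thesis
    unfolding star_condition_def Let_def r by simp
qed

end

section \<open>Convolution and cancellation in a Hopf algebra\<close>

text \<open>
  A Hopf algebra \<open>H\<close> on the object \<open>X\<close> with identity arrow \<open>I\<close>; \<open>HH\<close> and \<open>HHH\<close> are the coalgebras
  \<open>H \<otimes> H\<close> and \<open>H \<otimes> (H \<otimes> H)\<close>, and \<open>P\<close> is the projection \<open>a \<otimes> b \<mapsto> a \<epsilon>(b)\<close>.
\<close>

locale hopf = strict_braided_monoidal_category C
  for C :: "('o, 'a, 'm) braided_category_scheme" (structure) +
  fixes H :: "('o, 'a) hopf_algebra"
  assumes hopf: "hopf_algebra C H"
begin

abbreviation "X \<equiv> carrier H"
abbreviation "I \<equiv> ide C (carrier H)"
abbreviation "\<mu> \<equiv> mult H"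
abbreviation "\<eta> \<equiv> unit_mor H"
abbreviation "S \<equiv> antipode H"
abbreviation "HH \<equiv> tensor_coalgebra C H H"
abbreviation "HHH \<equiv> tensor_coalgebra C H HH"
abbreviation "P \<equiv> prj1 H H"

lemma coalgebra_H [simp]: "coalgebra C H"
  using hopf by (simp add: hopf_algebra_def nonunital_bialgebra_def Let_def)

lemmas H_type [simp] = coalgebra_type[OF coalgebra_H]

lemma mult_mor: "\<mu> \<in> coalgebra_mor C HH H"
  and unit_mor: "\<eta> \<in> coalgebra_mor C (unit_coalgebra C) H"
  using hopf by (simp_all add: hopf_algebra_def nonunital_bialgebra_def Let_def)

lemma mult_type [simp]: "\<mu> \<in> Arr C" "Dom C \<mu> = X \<otimes>\<^sub>o X" "Cod C \<mu> = X"
  using coalgebra_morD[OF mult_mor] by simp_all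

lemma unit_type [simp]: "\<eta> \<in> Arr C" "Dom C \<eta> = unit_obj C" "Cod C \<eta> = X"
  "counit H \<cdot> \<eta> = ide C (unit_obj C)"
  using coalgebra_morD[OF unit_mor] by (simp_all add: unit_coalgebra_def)

lemma antipode_type [simp]: "S \<in> Arr C" "Dom C S = X" "Cod C S = X"
  using hopf by (simp_all add: hopf_algebra_def Let_def hom_iff)

lemma hopf_laws:
  "\<mu> \<cdot> (\<mu> \<otimes> I) = \<mu> \<cdot> (I \<otimes> \<mu>)"
  "\<mu> \<cdot> (\<eta> \<otimes> I) = I" "\<mu> \<cdot> (I \<otimes> \<eta>) = I"
  "\<mu> \<cdot> pair H S I = \<eta> \<cdot> counit H" "\<mu> \<cdot> pair H I S = \<eta> \<cdot> counit H"
  using hopf by (simp_all add: hopf_algebra_def nonunital_bialgebra_def Let_def pair_def)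

text \<open>
  The convolution product of morphisms from a coalgebra to \<open>H\<close>.
\<close>

definition conv :: "('o, 'a, 'r) coalgebra_scheme \<Rightarrow> 'a \<Rightarrow> 'a \<Rightarrow> 'a" where
  "conv D f g = \<mu> \<cdot> pair D f g"

lemma conv_type [simp]:
  assumes "coalgebra C D" "f \<in> Arr C" "g \<in> Arr C" "Dom C f = carrier D" "Dom C g = carrier D"
    "Cod C f = X" "Cod C g = X"
  shows "conv D f g \<in> Arr C" "Dom C (conv D f g) = carrier D" "Cod C (conv D f g) = X"
  using assms by (simp_all add: conv_def)

lemma conv_assoc:
  assumes "coalgebra C D" "f \<in> Arr C" "g \<in> Arr C" "h \<in> Arr C"
    "Dom C f = carrier D" "Dom C g = carrier D" "Dom C h = carrier D"
    "Cod C f = X" "Cod C g = X" "Cod C h = X"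
  shows "conv D (conv D f g) h = conv D f (conv D g h)"
proof -
  have "conv D (conv D f g) h = (\<mu> \<cdot> (\<mu> \<otimes> I)) \<cdot> pair D (pair D f g) h"
    using assms by (simp add: conv_def tensor_pair)
  also have "\<dots> = conv D f (conv D g h)"
    unfolding hopf_laws(1) using assms by (simp add: conv_def tensor_pair pair_assoc)
  finally show ?thesis .
qed

lemma conv_comp:
  assumes "h \<in> coalgebra_mor C D E" "coalgebra C D" "coalgebra C E" "f \<in> Arr C" "g \<in> Arr C"
    "Dom C f = carrier E" "Dom C g = carrier E" "Cod C f = X" "Cod C g = X"
  shows "conv E f g \<cdot> h = conv D (f \<cdot> h) (g \<cdot> h)"
  using assms coalgebra_morD[OF assms(1)] by (simp add: conv_def pair_comp)

lemma conv_unit: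
  assumes "coalgebra C D" "f \<in> Arr C" "Dom C f = carrier D" "Cod C f = X"
  shows "conv D (\<eta> \<cdot> counit D) f = f" "conv D f (\<eta> \<cdot> counit D) = f"
proof -
  note t = assms coalgebra_type[OF assms(1)]
  have "conv D (\<eta> \<cdot> counit D) f = (\<mu> \<cdot> (\<eta> \<otimes> I)) \<cdot> pair D (counit D) f"
    using t by (simp add: conv_def tensor_pair del: pair_counit)
  then show "conv D (\<eta> \<cdot> counit D) f = f"
    unfolding hopf_laws using t by simp
  have "conv D f (\<eta> \<cdot> counit D) = (\<mu> \<cdot> (I \<otimes> \<eta>)) \<cdot> pair D f (counit D)"
    using t by (simp add: conv_def tensor_pair del: pair_counit)
  then show "conv D f (\<eta> \<cdot> counit D) = f"
    unfolding hopf_laws using t by simp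
qed

lemma conv_antipode:
  assumes "coalgebra C D" "s \<in> coalgebra_mor C D H"
  shows "conv D (S \<cdot> s) s = \<eta> \<cdot> counit D" "conv D s (S \<cdot> s) = \<eta> \<cdot> counit D"
proof -
  note s = coalgebra_morD[OF assms(2)]
  note t = assms coalgebra_type[OF assms(1)] s(1-3)
  have "conv D (S \<cdot> s) s = (\<mu> \<cdot> pair H S I) \<cdot> s" "conv D s (S \<cdot> s) = (\<mu> \<cdot> pair H I S) \<cdot> s"
    using t by (simp_all add: conv_def pair_comp)
  then show "conv D (S \<cdot> s) s = \<eta> \<cdot> counit D" "conv D s (S \<cdot> s) = \<eta> \<cdot> counit D"
    using t by (simp_all add: hopf_laws s)
qed

text \<open>
  Cancellation for a left \<open>H\<close>-module \<open>(Y, \<kappa>)\<close>: acting by \<open>s(d\<^sub>2)\<close> and then by the antipode of \<open>s(d\<^sub>1)\<close>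
  does nothing.
\<close>

lemma module_antipode:
  assumes "Y \<in> Obj C" "\<kappa> \<in> hom C (X \<otimes>\<^sub>o Y) Y"
    "\<kappa> \<cdot> (I \<otimes> \<kappa>) = \<kappa> \<cdot> (\<mu> \<otimes> ide C Y)" "\<kappa> \<cdot> (\<eta> \<otimes> ide C Y) = ide C Y"
    "coalgebra C D" "s \<in> coalgebra_mor C D H" "w \<in> hom C (carrier D) Y"
  shows "\<kappa> \<cdot> pair D (S \<cdot> s) (\<kappa> \<cdot> pair D s w) = w"
proof -
  note s = coalgebra_morD[OF assms(6)]
  note t = assms(1,2,5-7)[unfolded hom_iff] coalgebra_type[OF assms(5)] s(1-3)
  have "\<kappa> \<cdot> pair D (S \<cdot> s) (\<kappa> \<cdot> pair D s w) = (\<kappa> \<cdot> (I \<otimes> \<kappa>)) \<cdot> pair D (S \<cdot> s) (pair D s w)"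
    using t by (simp add: tensor_pair)
  also have "\<dots> = \<kappa> \<cdot> pair D (conv D (S \<cdot> s) s) w"
    unfolding assms(3) using t by (simp add: tensor_pair conv_def flip: pair_assoc)
  also have "\<dots> = (\<kappa> \<cdot> (\<eta> \<otimes> ide C Y)) \<cdot> pair D (counit D) w"
    using t by (simp add: conv_antipode tensor_pair del: pair_counit)
  also have "\<dots> = w"
    unfolding assms(4) using t by simp
  finally show ?thesis .
qed

lemma module_cancel:
  assumes "Y \<in> Obj C" "\<kappa> \<in> hom C (X \<otimes>\<^sub>o Y) Y"
    "\<kappa> \<cdot> (I \<otimes> \<kappa>) = \<kappa> \<cdot> (\<mu> \<otimes> ide C Y)" "\<kappa> \<cdot> (\<eta> \<otimes> ide C Y) = ide C Y"
    "coalgebra C D" "s \<in> coalgebra_mor C D H" "w \<in> hom C (carrier D) Y" "w' \<in> hom C (carrier D) Y"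
    "\<kappa> \<cdot> pair D s w = \<kappa> \<cdot> pair D s w'"
  shows "w = w'"
  using module_antipode[OF assms(1-6,7)] module_antipode[OF assms(1-6,8)] unfolding assms(9)
  by (rule trans[OF sym])

lemma conv_cancel:
  assumes "coalgebra C D" "s \<in> coalgebra_mor C D H" "w \<in> hom C (carrier D) X" "w' \<in> hom C (carrier D) X"
    "conv D s w = conv D s w'"
  shows "w = w'"
proof (rule module_cancel[of X \<mu> D s w w'])
  show "\<mu> \<cdot> (I \<otimes> \<mu>) = \<mu> \<cdot> (\<mu> \<otimes> ide C X)" "\<mu> \<cdot> (\<eta> \<otimes> ide C X) = ide C X"
    by (simp_all add: hopf_laws)
  show "\<mu> \<cdot> pair D s w = \<mu> \<cdot> pair D s w'"
    using assms(5) by (simp add: conv_def)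
qed (use assms(1-4) in \<open>simp_all add: hom_iff\<close>)

text \<open>
  \<open>H \<otimes> H\<close> is a left \<open>H\<close>-module through multiplication on the second factor, with the acting element
  passing over the first factor by the braiding.
\<close>

lemma braided_module:
  defines "\<kappa> \<equiv> (I \<otimes> \<mu>) \<cdot> (braiding C X X \<otimes> I)"
  shows "\<kappa> \<cdot> (I \<otimes> \<kappa>) = \<kappa> \<cdot> (\<mu> \<otimes> ide C (X \<otimes>\<^sub>o X))" "\<kappa> \<cdot> (\<eta> \<otimes> ide C (X \<otimes>\<^sub>o X)) = ide C (X \<otimes>\<^sub>o X)"
proof -
  let ?c = "braiding C X X"
  have nat: "?c \<cdot> (\<mu> \<otimes> I) = (I \<otimes> \<mu>) \<cdot> braiding C (X \<otimes>\<^sub>o X) X" "?c \<cdot> (\<eta> \<otimes> I) = I \<otimes> \<eta>"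
    using braid_nat[of \<mu> I "X \<otimes>\<^sub>o X" X] braid_nat[of \<eta> I "unit_obj C" X] by simp_all
  have sw: "(?c \<otimes> I) \<cdot> ((I \<otimes> I) \<otimes> \<mu>) = ((I \<otimes> I) \<otimes> \<mu>) \<cdot> (?c \<otimes> (I \<otimes> I))"
    by (simp add: interchange del: tensor_assoc)
  have "\<kappa> \<cdot> (I \<otimes> \<kappa>) = (I \<otimes> \<mu>) \<cdot> (((?c \<otimes> I) \<cdot> ((I \<otimes> I) \<otimes> \<mu>)) \<cdot> (I \<otimes> ?c \<otimes> I))"
    unfolding \<kappa>_def by (simp add: tensor_comp_right)
  also have "\<dots> = ((I \<otimes> \<mu>) \<cdot> (I \<otimes> (I \<otimes> \<mu>))) \<cdot> (((?c \<otimes> I) \<cdot> (I \<otimes> ?c)) \<otimes> I)"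
    unfolding sw by (simp add: tensor_comp_left)
  also have "(I \<otimes> \<mu>) \<cdot> (I \<otimes> (I \<otimes> \<mu>)) = (I \<otimes> \<mu>) \<cdot> (I \<otimes> (\<mu> \<otimes> I))"
    by (simp add: interchange hopf_laws)
  also have "\<dots> \<cdot> (((?c \<otimes> I) \<cdot> (I \<otimes> ?c)) \<otimes> I) = (I \<otimes> \<mu>) \<cdot> ((?c \<cdot> (\<mu> \<otimes> I)) \<otimes> I)"
    by (simp add: nat tensor_comp_left hexagon_left)
  also have "\<dots> = \<kappa> \<cdot> (\<mu> \<otimes> ide C (X \<otimes>\<^sub>o X))"
    unfolding \<kappa>_def by (simp add: tensor_comp_left ide_tensor)
  finally show "\<kappa> \<cdot> (I \<otimes> \<kappa>) = \<kappa> \<cdot> (\<mu> \<otimes> ide C (X \<otimes>\<^sub>o X))" .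
  have "\<kappa> \<cdot> (\<eta> \<otimes> ide C (X \<otimes>\<^sub>o X)) = (I \<otimes> \<mu>) \<cdot> ((?c \<cdot> (\<eta> \<otimes> I)) \<otimes> I)"
    unfolding \<kappa>_def by (simp add: ide_tensor tensor_comp_left)
  also have "\<dots> = I \<otimes> (\<mu> \<cdot> (\<eta> \<otimes> I))"
    by (simp add: nat interchange)
  finally show "\<kappa> \<cdot> (\<eta> \<otimes> ide C (X \<otimes>\<^sub>o X)) = ide C (X \<otimes>\<^sub>o X)"
    by (simp add: hopf_laws ide_tensor)
qed

lemma structure_mors [simp]: "\<mu> \<in> coalgebra_mor C HH H" "\<eta> \<in> coalgebra_mor C (unit_coalgebra C) H"
  "I \<in> coalgebra_mor C H H"
  by (simp_all add: mult_mor unit_mor ide_coalgebra_mor)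

lemma prj1_commute:
  assumes "f \<in> hom C X X" "g \<in> hom C (X \<otimes>\<^sub>o X) X"
    "braiding C X X \<cdot> pair HH P g = pair HH g P"
  shows "braiding C X X \<cdot> pair HH (f \<cdot> P) g = pair HH g (f \<cdot> P)"
proof -
  note t = assms(1,2)[unfolded hom_iff]
  have "braiding C X X \<cdot> pair HH (f \<cdot> P) g = (braiding C X X \<cdot> (f \<otimes> I)) \<cdot> pair HH P g"
    using t by (simp add: tensor_pair)
  also have "braiding C X X \<cdot> (f \<otimes> I) = (I \<otimes> f) \<cdot> braiding C X X"
    using t braid_nat[of f I X X] by simp
  also have "\<dots> \<cdot> pair HH P g = pair HH g (f \<cdot> P)"
    using t by (simp add: assms(3) tensor_pair)
  finally show ?thesis .
qed

text \<open>
  If \<open>q\<close> and the convolution of \<open>q\<close> and \<open>g\<close> are coalgebra morphisms, and \<open>q\<close> commutes with \<open>g\<close>, then \<open>g\<close> is a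
  coalgebra morphism.  Applied to \<open>q = \<sigma> \<cdot> P\<close>, this shows that \<open>\<Gamma>\<close> is a coalgebra morphism, without
  computing the comultiplication of the antipode.
\<close>

lemma conv_mor_cancel:
  assumes "coalgebra C D" "q \<in> coalgebra_mor C D H" "g \<in> hom C (carrier D) X"
    and comm: "braiding C X X \<cdot> pair D q g = pair D g q"
    and mor: "conv D q g \<in> coalgebra_mor C D H"
  shows "g \<in> coalgebra_mor C D H"
proof (rule coalgebra_morI)
  note q = coalgebra_morD[OF assms(2)]
  note t = assms(1,2) assms(3)[unfolded hom_iff] q(1-3) coalgebra_type[OF assms(1)]
  let ?c = "braiding C X X"
  show "g \<in> Arr C" "Dom C g = carrier D" "Cod C g = carrier H"
    using t by simp_all
  have "counit H \<cdot> conv D q g = (counit H \<otimes> counit H) \<cdot> pair D q g"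
    using t coalgebra_morD(4)[OF mult_mor] unfolding conv_def by (subst assoc[symmetric]) simp_all
  also have "\<dots> = counit H \<cdot> g"
    using t by (simp add: tensor_pair q(4))
  finally show "counit H \<cdot> g = counit D"
    using coalgebra_morD(4)[OF mor] by simp
  let ?\<kappa> = "(I \<otimes> \<mu>) \<cdot> (?c \<otimes> I)"
  let ?L = "I \<otimes> ?c \<otimes> I"
  \<comment> \<open>Multiplying both factors by \<open>q\<close> is the composite of two module actions, each of which can be cancelled.\<close>
  have factor: "(\<mu> \<otimes> \<mu>) \<cdot> (?L \<cdot> pair D q (pair D q w)) = (\<mu> \<otimes> I) \<cdot> pair D q (?\<kappa> \<cdot> pair D q w)"
    if "w \<in> hom C (carrier D) (X \<otimes>\<^sub>o X)" for w
  proof -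
    have "(\<mu> \<otimes> \<mu>) = (\<mu> \<otimes> I) \<cdot> ((I \<otimes> I) \<otimes> \<mu>)"
      by (simp add: interchange del: tensor_assoc)
    moreover have "I \<otimes> (?\<kappa> \<cdot> pair D q w) = I \<otimes> ((I \<otimes> \<mu>) \<cdot> ((?c \<otimes> I) \<cdot> pair D q w))"
      using t that by (simp add: hom_iff)
    ultimately show ?thesis
      using t that by (simp add: hom_iff tensor_pair)
  qed
  have "comult H \<cdot> conv D q g = (comult H \<cdot> \<mu>) \<cdot> pair D q g"
    using t by (simp add: conv_def)
  also have "comult H \<cdot> \<mu> = (\<mu> \<otimes> \<mu>) \<cdot> (?L \<cdot> (comult H \<otimes> comult H))"
    using coalgebra_morD(5)[OF mult_mor] by (simp add: pair_def tensor_coalgebra_def)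
  also have "\<dots> \<cdot> pair D q g = (\<mu> \<otimes> \<mu>) \<cdot> (?L \<cdot> pair D (pair D q q) (comult H \<cdot> g))"
    using t by (simp add: tensor_pair q(5))
  also have "\<dots> = (\<mu> \<otimes> I) \<cdot> pair D q (?\<kappa> \<cdot> pair D q (comult H \<cdot> g))"
    using t by (subst factor[symmetric]) (simp_all add: pair_assoc hom_iff)
  finally have 1: "comult H \<cdot> conv D q g = (\<mu> \<otimes> I) \<cdot> pair D q (?\<kappa> \<cdot> pair D q (comult H \<cdot> g))" .
  have "pair D (conv D q g) (conv D q g) = (\<mu> \<otimes> \<mu>) \<cdot> pair D q (pair D (pair D g q) g)"
    using t by (simp add: conv_def tensor_pair pair_assoc flip: tensor_pair)
  also have "pair D q (pair D (pair D g q) g) = ?L \<cdot> pair D q (pair D q (pair D g g))"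
    using t by (simp add: tensor_pair flip: comm pair_assoc[of D q g g])
  also have "(\<mu> \<otimes> \<mu>) \<cdot> \<dots> = (\<mu> \<otimes> I) \<cdot> pair D q (?\<kappa> \<cdot> pair D q (pair D g g))"
    using t by (subst factor[symmetric]) (simp_all add: hom_iff)
  finally have 2: "(\<mu> \<otimes> I) \<cdot> pair D q (?\<kappa> \<cdot> pair D q (comult H \<cdot> g)) =
      (\<mu> \<otimes> I) \<cdot> pair D q (?\<kappa> \<cdot> pair D q (pair D g g))"
    using 1 coalgebra_morD(5)[OF mor] by simp
  have "?\<kappa> \<cdot> pair D q (comult H \<cdot> g) = ?\<kappa> \<cdot> pair D q (pair D g g)"
  proof (rule module_cancel[OF _ _ _ _ assms(1,2) _ _ 2])
    show "(\<mu> \<otimes> I) \<cdot> (I \<otimes> (\<mu> \<otimes> I)) = (\<mu> \<otimes> I) \<cdot> (\<mu> \<otimes> ide C (X \<otimes>\<^sub>o X))"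
      by (simp add: ide_tensor interchange hopf_laws flip: tensor_assoc)
    show "(\<mu> \<otimes> I) \<cdot> (\<eta> \<otimes> ide C (X \<otimes>\<^sub>o X)) = ide C (X \<otimes>\<^sub>o X)"
      by (simp add: ide_tensor interchange hopf_laws flip: tensor_assoc)
  qed (use t in \<open>simp_all add: hom_iff\<close>)
  then show "comult H \<cdot> g = pair D g g"
    by (rule module_cancel[OF _ _ braided_module assms(1,2), rotated 4]) (use t in \<open>simp_all add: hom_iff\<close>)
qed

text \<open>
  The product \<open>a \<circ> b = s(a\<^sub>1) m(a\<^sub>2, b)\<close> determined by \<open>s\<close> and an action \<open>m\<close>.
\<close>

definition circ :: "'a \<Rightarrow> 'a \<Rightarrow> 'a" where
  "circ s m = conv HH (s \<cdot> P) m"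

lemma circ_eq:
  assumes "s \<in> hom C X X" "m \<in> hom C (X \<otimes>\<^sub>o X) X"
  shows "\<mu> \<cdot> (s \<otimes> m) \<cdot> (comult H \<otimes> I) = circ s m"
  using assms by (simp add: hom_iff circ_def conv_def tensor_comult_left)

end

section \<open>Post-Hopf axioms versus truss axioms\<close>

text \<open>
  The data common to star post-Hopf algebras \<open>(H, m, s)\<close> and star Hopf trusses, where \<open>m\<close> is \<open>\<Gamma>\<close> and
  \<open>s\<close> is \<open>\<sigma>\<close>, before the laws relating them.  The last assumption is the star condition.
\<close>

locale twisted_hopf = hopf C H
  for C :: "('o, 'a, 'm) braided_category_scheme" (structure)
    and H :: "('o, 'a) hopf_algebra" +
  fixes s m :: 'a
  assumes s_mor: "s \<in> coalgebra_mor C H H" and m_mor: "m \<in> coalgebra_mor C HH H"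
    and commute: "braiding C X X \<cdot> pair HH P m = pair HH m P"
begin

abbreviation "n \<equiv> circ s m"

lemma s_type [simp]: "s \<in> Arr C" "Dom C s = X" "Cod C s = X"
  and m_type [simp]: "m \<in> Arr C" "Dom C m = X \<otimes>\<^sub>o X" "Cod C m = X"
  using coalgebra_morD[OF s_mor] coalgebra_morD[OF m_mor] by simp_all

lemma circ_type [simp]: "n \<in> Arr C" "Dom C n = X \<otimes>\<^sub>o X" "Cod C n = X"
  by (simp_all add: circ_def)

lemma sP_mor: "s \<cdot> P \<in> coalgebra_mor C HH H"
  by (rule coalgebra_mor_comp[of HH H]) (simp_all add: s_mor)

text \<open>
  The morphism \<open>a \<otimes> b \<mapsto> s(a\<^sub>1) \<otimes> m(a\<^sub>2, b)\<close>, whose product is \<open>a \<circ> b\<close>.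
\<close>

definition W :: 'a where "W = pair HH (s \<cdot> P) m"

lemma W_type [simp]: "W \<in> Arr C" "Dom C W = X \<otimes>\<^sub>o X" "Cod C W = X \<otimes>\<^sub>o X"
  by (simp_all add: W_def)

lemma W_mor: "W \<in> coalgebra_mor C HH HH"
  unfolding W_def by (rule commuting_pair_mor) (simp_all add: sP_mor m_mor prj1_commute commute hom_iff)

lemma circ_eq_mult_W: "n = \<mu> \<cdot> W"
  by (simp add: circ_def conv_def W_def)

lemma circ_mor: "n \<in> coalgebra_mor C HH H"
  unfolding circ_eq_mult_W by (rule coalgebra_mor_comp[of HH HH]) (simp_all add: W_mor)

text \<open>
  Multiplying \<open>a \<circ> b\<close> on the left by the antipode of \<open>s\<close> recovers the action: for the truss with product
  \<open>\<circ>\<close> this says \<open>\<Gamma> = m\<close>.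
\<close>

lemma action_eq: "conv HH (S \<cdot> s \<cdot> P) n = m"
proof -
  have "conv HH (S \<cdot> (s \<cdot> P)) (conv HH (s \<cdot> P) m) = m"
    unfolding conv_def
    by (rule module_antipode[of X \<mu>]) (simp_all add: hom_iff hopf_laws sP_mor)
  then show ?thesis
    by (simp add: circ_def)
qed

lemma ide_tensor_mor:
  assumes "f \<in> coalgebra_mor C HH D" "coalgebra C D"
  shows "I \<otimes> f \<in> coalgebra_mor C HHH (tensor_coalgebra C H D)"
  using assms by (intro tensor_coalgebra_mor) simp_all

text \<open>
  The projections \<open>a \<otimes> b \<otimes> c \<mapsto> a \<epsilon>(b) \<epsilon>(c)\<close>, \<open>a \<otimes> b \<epsilon>(c)\<close> and \<open>a \<otimes> \<epsilon>(b) c\<close>.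
\<close>

abbreviation "Q \<equiv> prj1 H HH"
abbreviation "P12 \<equiv> I \<otimes> P"
abbreviation "P13 \<equiv> I \<otimes> prj2 H H"

lemma P_ide_tensor:
  assumes "f \<in> coalgebra_mor C HH H"
  shows "P \<cdot> (I \<otimes> f) = Q"
  using prj1_tensor[of H HH H H I f] assms by simp

lemma n_ide_tensor:
  assumes "f \<in> coalgebra_mor C HH H"
  shows "n \<cdot> (I \<otimes> f) = conv HHH (s \<cdot> Q) (m \<cdot> (I \<otimes> f))"
proof -
  note f = coalgebra_morD[OF assms]
  have "n \<cdot> (I \<otimes> f) = conv HHH ((s \<cdot> P) \<cdot> (I \<otimes> f)) (m \<cdot> (I \<otimes> f))"
    unfolding circ_def by (rule conv_comp[OF ide_tensor_mor[OF assms]]) simp_all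
  then show ?thesis
    using f by (simp add: P_ide_tensor[OF assms])
qed

text \<open>
  A distributive law for \<open>f\<close> turns \<open>f(a, b \<circ> c)\<close> into \<open>g(a\<^sub>1, s(b\<^sub>1)) m(a\<^sub>2, m(b\<^sub>2, c))\<close>.
\<close>

lemma distrib_W:
  assumes "f \<in> hom C (X \<otimes>\<^sub>o X) X" "g \<in> hom C (X \<otimes>\<^sub>o X) X"
    "f \<cdot> (I \<otimes> \<mu>) = conv HHH (g \<cdot> P12) (m \<cdot> P13)"
  shows "f \<cdot> (I \<otimes> n) = conv HHH (g \<cdot> (I \<otimes> (s \<cdot> P))) (m \<cdot> (I \<otimes> m))"
proof -
  note t = assms(1,2)[unfolded hom_iff]
  have W: "P \<cdot> W = s \<cdot> P" "prj2 H H \<cdot> W = m"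
    unfolding W_def by (simp_all add: prj_pair sP_mor m_mor)
  have "f \<cdot> (I \<otimes> n) = (f \<cdot> (I \<otimes> \<mu>)) \<cdot> (I \<otimes> W)"
    using t by (simp add: circ_eq_mult_W interchange)
  also have "\<dots> = conv HHH ((g \<cdot> P12) \<cdot> (I \<otimes> W)) ((m \<cdot> P13) \<cdot> (I \<otimes> W))"
    unfolding assms(3) by (rule conv_comp[OF ide_tensor_mor[OF W_mor]]) (use t in simp_all)
  finally show ?thesis
    using t by (simp add: interchange W)
qed

lemma n_tensor_ide: "n \<cdot> (n \<otimes> I) = conv HHH (s \<cdot> n \<cdot> P12) (m \<cdot> (n \<otimes> I))"
proof -
  have mor: "n \<otimes> I \<in> coalgebra_mor C HHH HH"
    using tensor_coalgebra_mor[of HH H H H n I] by (simp add: circ_mor tensor_coalgebra_assoc)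
  have "P \<cdot> (n \<otimes> I) = n \<cdot> prj1 HH H"
    by (rule prj1_tensor) simp_all
  also have "prj1 HH H = P12"
    by (simp add: prj1_def ide_tensor)
  finally have P: "P \<cdot> (n \<otimes> I) = n \<cdot> P12" .
  have "n \<cdot> (n \<otimes> I) = conv HHH ((s \<cdot> P) \<cdot> (n \<otimes> I)) (m \<cdot> (n \<otimes> I))"
    unfolding circ_def[of s m] by (rule conv_comp) (use mor in \<open>simp_all add: circ_def\<close>)
  then show ?thesis
    by (simp add: P)
qed

theorem post_imp_truss:
  assumes s: "s \<cdot> n = n \<cdot> (I \<otimes> s)" and assoc: "m \<cdot> (I \<otimes> m) = m \<cdot> (n \<otimes> I)"
    and distrib: "m \<cdot> (I \<otimes> \<mu>) = conv HHH (m \<cdot> P12) (m \<cdot> P13)"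
  shows "n \<cdot> (n \<otimes> I) = n \<cdot> (I \<otimes> n)" "n \<cdot> (I \<otimes> \<mu>) = conv HHH (n \<cdot> P12) (m \<cdot> P13)"
proof -
  have "n \<cdot> (I \<otimes> \<mu>) = conv HHH (s \<cdot> Q) (conv HHH (m \<cdot> P12) (m \<cdot> P13))"
    by (simp add: n_ide_tensor distrib)
  also have "\<dots> = conv HHH (n \<cdot> P12) (m \<cdot> P13)"
    by (simp add: n_ide_tensor conv_assoc)
  finally show "n \<cdot> (I \<otimes> \<mu>) = conv HHH (n \<cdot> P12) (m \<cdot> P13)" .
  then have "n \<cdot> (I \<otimes> n) = conv HHH (n \<cdot> (I \<otimes> (s \<cdot> P))) (m \<cdot> (I \<otimes> m))"
    by (intro distrib_W) (simp_all add: hom_iff)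
  also have "n \<cdot> (I \<otimes> (s \<cdot> P)) = (s \<cdot> n) \<cdot> P12"
    by (simp add: s interchange)
  finally show "n \<cdot> (n \<otimes> I) = n \<cdot> (I \<otimes> n)"
    by (simp add: n_tensor_ide assoc)
qed

lemma ide_unit_mor: "I \<otimes> \<eta> \<in> coalgebra_mor C H HH" "I \<otimes> (\<eta> \<otimes> \<eta>) \<in> coalgebra_mor C H HHH"
proof -
  let ?K = "unit_coalgebra C"
  have [simp]: "carrier ?K = unit_obj C" "counit ?K = ide C (unit_obj C)" "comult ?K = ide C (unit_obj C)"
    by (simp_all add: unit_coalgebra_def)
  have tK: "tensor_coalgebra C H ?K = coalgebra.truncate H"
    by (simp add: tensor_coalgebra_def coalgebra.truncate_def)
  have [simp]: "coalgebra_mor C (coalgebra.truncate H) E = coalgebra_mor C H E" for E :: "('o, 'a) coalgebra"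
    by (simp add: coalgebra_mor_def coalgebra.truncate_def)
  have "I \<otimes> \<eta> \<in> coalgebra_mor C (tensor_coalgebra C H ?K) HH"
    by (intro tensor_coalgebra_mor) (simp_all add: unit_coalgebra)
  then show e: "I \<otimes> \<eta> \<in> coalgebra_mor C H HH"
    unfolding tK by simp
  have "I \<otimes> \<eta> \<otimes> \<eta> \<in> coalgebra_mor C (tensor_coalgebra C H ?K) (tensor_coalgebra C HH H)"
    by (intro tensor_coalgebra_mor) (simp_all add: unit_coalgebra e)
  then show "I \<otimes> (\<eta> \<otimes> \<eta>) \<in> coalgebra_mor C H HHH"
    unfolding tK by (simp add: tensor_coalgebra_assoc)
qed

text \<open>
  \<open>m(a, 1) = \<epsilon>(a) 1\<close>: the left-hand side is a convolution idempotent coalgebra morphism, hence trivial.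
\<close>

lemma action_unit:
  assumes distrib: "m \<cdot> (I \<otimes> \<mu>) = conv HHH (m \<cdot> P12) (m \<cdot> P13)"
  shows "m \<cdot> (I \<otimes> \<eta>) = \<eta> \<cdot> counit H"
proof -
  let ?h = "m \<cdot> (I \<otimes> \<eta>)"
  have h: "?h \<in> coalgebra_mor C H H"
    by (rule coalgebra_mor_comp[OF _ _ _ ide_unit_mor(1) m_mor]) simp_all
  have \<eta>\<eta>: "\<mu> \<cdot> (\<eta> \<otimes> \<eta>) = \<eta>" "P \<cdot> (\<eta> \<otimes> \<eta>) = \<eta>" "prj2 H H \<cdot> (\<eta> \<otimes> \<eta>) = \<eta>"
  proof -
    have "\<mu> \<cdot> (\<eta> \<otimes> \<eta>) = (\<mu> \<cdot> (\<eta> \<otimes> I)) \<cdot> \<eta>"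
      using interchange[of "ide C (unit_obj C)" \<eta> \<eta> I] by simp
    then show "\<mu> \<cdot> (\<eta> \<otimes> \<eta>) = \<eta>" by (simp add: hopf_laws)
  qed (simp_all add: prj1_def prj2_def interchange)
  have "?h = (m \<cdot> (I \<otimes> \<mu>)) \<cdot> (I \<otimes> (\<eta> \<otimes> \<eta>))"
    by (simp add: interchange \<eta>\<eta>)
  also have "\<dots> = conv H ((m \<cdot> P12) \<cdot> (I \<otimes> (\<eta> \<otimes> \<eta>))) ((m \<cdot> P13) \<cdot> (I \<otimes> (\<eta> \<otimes> \<eta>)))"
    unfolding distrib by (rule conv_comp[OF ide_unit_mor(2)]) simp_all
  also have "\<dots> = conv H ?h ?h"
    by (simp add: interchange \<eta>\<eta>)
  finally have "conv H ?h ?h = conv H ?h (\<eta> \<cdot> counit H)"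
    by (simp add: conv_unit)
  then show ?thesis
    by (rule conv_cancel[OF _ h, rotated 3]) (simp_all add: hom_iff)
qed

theorem truss_imp_post:
  assumes assoc: "n \<cdot> (n \<otimes> I) = n \<cdot> (I \<otimes> n)" and distrib: "n \<cdot> (I \<otimes> \<mu>) = conv HHH (n \<cdot> P12) (m \<cdot> P13)"
  shows "s \<cdot> n = n \<cdot> (I \<otimes> s)" "m \<cdot> (I \<otimes> m) = m \<cdot> (n \<otimes> I)"
    "m \<cdot> (I \<otimes> \<mu>) = conv HHH (m \<cdot> P12) (m \<cdot> P13)" "s = n \<cdot> (I \<otimes> \<eta>)"
proof -
  have sQ: "s \<cdot> Q \<in> coalgebra_mor C HHH H"
    by (rule coalgebra_mor_comp[of HHH H]) (simp_all add: s_mor)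
  \<comment> \<open>Both sides are \<open>a \<circ> (b c)\<close>; cancelling \<open>s(a)\<close> leaves the distributive law of the action.\<close>
  have "conv HHH (s \<cdot> Q) (m \<cdot> (I \<otimes> \<mu>)) = conv HHH (s \<cdot> Q) (conv HHH (m \<cdot> P12) (m \<cdot> P13))"
    using distrib by (simp add: n_ide_tensor conv_assoc)
  then show m: "m \<cdot> (I \<otimes> \<mu>) = conv HHH (m \<cdot> P12) (m \<cdot> P13)"
    by (rule conv_cancel[OF _ sQ, rotated 3]) (simp_all add: hom_iff)
  have P: "P \<cdot> (I \<otimes> \<eta>) = I"
    by (simp add: prj1_def interchange)
  have "n \<cdot> (I \<otimes> \<eta>) = conv H ((s \<cdot> P) \<cdot> (I \<otimes> \<eta>)) (m \<cdot> (I \<otimes> \<eta>))"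
    unfolding circ_def by (rule conv_comp[OF ide_unit_mor(1)]) simp_all
  also have "\<dots> = s"
    by (simp add: P action_unit[OF m] conv_unit)
  finally show s: "s = n \<cdot> (I \<otimes> \<eta>)" ..
  \<comment> \<open>\<open>s(a \<circ> b) = (a \<circ> b) \<circ> 1 = a \<circ> (b \<circ> 1) = a \<circ> s(b)\<close>\<close>
  have "s \<cdot> n = (n \<cdot> (I \<otimes> \<eta>)) \<cdot> n"
    by (rule arg_cong[OF s])
  also have "\<dots> = (n \<cdot> (n \<otimes> I)) \<cdot> ((I \<otimes> I) \<otimes> \<eta>)"
    using interchange[of n I "ide C (unit_obj C)" \<eta>] interchange[of "I \<otimes> I" n \<eta> I] by simp
  also have "\<dots> = n \<cdot> (I \<otimes> (n \<cdot> (I \<otimes> \<eta>)))"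
    unfolding assoc by (simp add: interchange)
  finally show sn: "s \<cdot> n = n \<cdot> (I \<otimes> s)"
    unfolding s[symmetric] .
  have snP: "s \<cdot> n \<cdot> P12 \<in> coalgebra_mor C HHH H"
    by (intro coalgebra_mor_comp[of HHH HH] coalgebra_mor_comp[of HH H] ide_tensor_mor)
      (simp_all add: s_mor circ_mor)
  have "n \<cdot> (I \<otimes> n) = conv HHH (n \<cdot> (I \<otimes> (s \<cdot> P))) (m \<cdot> (I \<otimes> m))"
    using distrib by (intro distrib_W) (simp_all add: hom_iff)
  also have "n \<cdot> (I \<otimes> (s \<cdot> P)) = (s \<cdot> n) \<cdot> P12"
    by (simp add: sn interchange)
  finally have "conv HHH (s \<cdot> n \<cdot> P12) (m \<cdot> (I \<otimes> m)) = conv HHH (s \<cdot> n \<cdot> P12) (m \<cdot> (n \<otimes> I))"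
    using n_tensor_ide assoc by simp
  then show "m \<cdot> (I \<otimes> m) = m \<cdot> (n \<otimes> I)"
    by (rule conv_cancel[OF _ snP, rotated 3]) (simp_all add: hom_iff)
qed

end

section \<open>The constructions on objects\<close>

text \<open>
  The coalgebra \<open>D\<close> equipped with the product \<open>p\<close>.
\<close>

definition bialg :: "('o, 'a, 'r) coalgebra_scheme \<Rightarrow> 'a \<Rightarrow> ('o, 'a) nonunital_bialgebra" where
  "bialg D p = \<lparr>carrier = carrier D, counit = counit D, comult = comult D, mult = p\<rparr>"

lemma bialg_simps [simp]:
  "carrier (bialg D p) = carrier D" "counit (bialg D p) = counit D" "comult (bialg D p) = comult D"
  "mult (bialg D p) = p"
  by (simp_all add: bialg_def)

lemma bialg_coalgebra [simp]:
  "coalgebra C (bialg D p) = coalgebra C D"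
  "coalgebra_mor C (bialg D p) E = coalgebra_mor C D E"
  "coalgebra_mor C E (bialg D p) = coalgebra_mor C E D"
  "tensor_coalgebra C (bialg D p) E = tensor_coalgebra C D E"
  "tensor_coalgebra C E (bialg D p) = tensor_coalgebra C E D"
  by (simp_all add: coalgebra_def coalgebra_mor_def tensor_coalgebra_def)

definition post_of_truss :: "('o, 'a, 'm) braided_category_scheme \<Rightarrow> ('o, 'a) hopf_truss \<Rightarrow> ('o, 'a) post_hopf" where
  "post_of_truss C A = \<lparr>ph_H = truss_H1 A, ph_m = truss_\<Gamma> C A, ph_\<Phi> = truss_\<sigma> A\<rparr>"

text \<open>
  The product \<open>a \<circ> b = \<Phi>(a\<^sub>1) m(a\<^sub>2, b)\<close> of a post-Hopf algebra.
\<close>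

definition post_mult :: "('o, 'a, 'm) braided_category_scheme \<Rightarrow> ('o, 'a) post_hopf \<Rightarrow> 'a" where
  "post_mult C A = mult (ph_H A) \<cdot>\<^bsub>C\<^esub> (ph_\<Phi> A \<otimes>\<^bsub>C\<^esub> ph_m A) \<cdot>\<^bsub>C\<^esub> (comult (ph_H A) \<otimes>\<^bsub>C\<^esub> ide C (carrier (ph_H A)))"

definition truss_of_post :: "('o, 'a, 'm) braided_category_scheme \<Rightarrow> ('o, 'a) post_hopf \<Rightarrow> ('o, 'a) hopf_truss" where
  "truss_of_post C A = \<lparr>truss_H1 = ph_H A, truss_H2 = bialg (ph_H A) (post_mult C A), truss_\<sigma> = ph_\<Phi> A\<rparr>"

definition post_of_rb :: "('o, 'a, 'm) braided_category_scheme \<Rightarrow> ('o, 'a) rota_baxter \<Rightarrow> ('o, 'a) post_hopf" where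
  "post_of_rb C A = \<lparr>ph_H = rb_H A, ph_m = rb_m C A, ph_\<Phi> = rb_\<Psi> A\<rparr>"

definition rb_of_post :: "('o, 'a, 'm) braided_category_scheme \<Rightarrow> ('o, 'a) post_hopf \<Rightarrow> ('o, 'a) rota_baxter" where
  "rb_of_post C A = \<lparr>rb_H = ph_H A, rb_B = bialg (ph_H A) (post_mult C A), rb_T = ide C (carrier (ph_H A)),
     rb_\<phi> = ph_m A, rb_\<Psi> = ph_\<Phi> A\<rparr>"

text \<open>
  Membership in the three full subcategories, so that these are again categories of structures.
\<close>

definition star_truss where
  "star_truss C A \<longleftrightarrow> hopf_truss C A \<and> star_condition C (truss_H1 A) (truss_\<Gamma> C A)"

definition star_post where
  "star_post C A \<longleftrightarrow> post_hopf C A \<and> star_condition C (ph_H A) (ph_m A)"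

definition star_rb where
  "star_rb C A \<longleftrightarrow> rota_baxter C A \<and> rb_T A \<in> iso C (carrier (rb_H A)) (carrier (rb_B A)) \<and>
    star_condition C (rb_H A) (rb_m C A)"

context hopf
begin

lemma distrib_eq:
  assumes "coalgebra C D" "f \<in> hom C (carrier D \<otimes>\<^sub>o X) X" "g \<in> hom C (carrier D \<otimes>\<^sub>o X) X"
  shows "\<mu> \<cdot> (f \<otimes> g) \<cdot> (ide C (carrier D) \<otimes> braiding C (carrier D) X \<otimes> I) \<cdot> (comult D \<otimes> I \<otimes> I) =
    conv (tensor_coalgebra C D HH) (f \<cdot> (ide C (carrier D) \<otimes> P)) (g \<cdot> (ide C (carrier D) \<otimes> prj2 H H))"
proof -
  note t = assms coalgebra_type[OF assms(1)]
  have "\<mu> \<cdot> (f \<otimes> g) \<cdot> (ide C (carrier D) \<otimes> braiding C (carrier D) X \<otimes> I) \<cdot> (comult D \<otimes> I \<otimes> I) =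
    \<mu> \<cdot> ((f \<otimes> g) \<cdot> ((ide C (carrier D) \<otimes> braiding C (carrier D) X \<otimes> I) \<cdot> (comult D \<otimes> I \<otimes> I)))"
    using t by (simp add: hom_iff)
  also have "\<dots> = conv (tensor_coalgebra C D HH) (f \<cdot> (ide C (carrier D) \<otimes> P)) (g \<cdot> (ide C (carrier D) \<otimes> prj2 H H))"
    unfolding conv_def by (subst tensor_comult_distrib[of D H H f g]) (use t in \<open>simp_all add: hom_iff\<close>)
  finally show ?thesis .
qed

lemma star_iff:
  assumes "g \<in> hom C (X \<otimes>\<^sub>o X) X"
  shows "star_condition C H g \<longleftrightarrow> braiding C X X \<cdot> pair HH P g = pair HH g P"
  using assms by (intro star_condition_iff) (simp_all add: hom_iff)

lemma bialg_iff: "nonunital_bialgebra C (bialg H p) \<longleftrightarrow>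
    p \<in> coalgebra_mor C HH H \<and> p \<cdot> (p \<otimes> I) = p \<cdot> (I \<otimes> p)"
  by (simp add: nonunital_bialgebra_def Let_def)

lemma circ_twist:
  assumes "s \<in> hom C X X" "m \<in> hom C (X \<otimes>\<^sub>o X) X"
  shows "s \<cdot> \<mu> \<cdot> (s \<otimes> m) \<cdot> (comult H \<otimes> I) = s \<cdot> circ s m"
    "\<mu> \<cdot> (s \<otimes> m) \<cdot> (comult H \<otimes> s) = circ s m \<cdot> (I \<otimes> s)"
proof -
  note t = assms[unfolded hom_iff]
  show "s \<cdot> \<mu> \<cdot> (s \<otimes> m) \<cdot> (comult H \<otimes> I) = s \<cdot> circ s m"
    using t by (simp flip: circ_eq[OF assms])
  have "comult H \<otimes> s = (comult H \<otimes> I) \<cdot> (I \<otimes> s)"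
    using t by (simp add: interchange)
  then show "\<mu> \<cdot> (s \<otimes> m) \<cdot> (comult H \<otimes> s) = circ s m \<cdot> (I \<otimes> s)"
    using t by (simp flip: circ_eq[OF assms])
qed

lemma star_post_iff:
  assumes "ph_H A = H" "ph_m A = m" "ph_\<Phi> A = s"
  shows "star_post C A \<longleftrightarrow> twisted_hopf C H s m \<and> s \<cdot> circ s m = circ s m \<cdot> (I \<otimes> s) \<and>
     m \<cdot> (I \<otimes> m) = m \<cdot> (circ s m \<otimes> I) \<and>
     m \<cdot> (I \<otimes> \<mu>) = conv HHH (m \<cdot> (I \<otimes> P)) (m \<cdot> (I \<otimes> prj2 H H))"
proof (cases "s \<in> coalgebra_mor C H H \<and> m \<in> coalgebra_mor C HH H")
  case True
  then have t: "s \<in> hom C X X" "m \<in> hom C (X \<otimes>\<^sub>o X) X"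
    by (auto simp: coalgebra_mor_def)
  show ?thesis
    using True hopf hopf_axioms
    by (simp add: star_post_def post_hopf_def Let_def assms star_iff t circ_twist circ_eq distrib_eq
      twisted_hopf_def twisted_hopf_axioms_def conj_ac del: tensor_assoc assoc)
next
  case False
  then show ?thesis
    by (auto simp: star_post_def post_hopf_def Let_def assms twisted_hopf_def twisted_hopf_axioms_def)
qed

lemma truss_\<Gamma>_eq:
  assumes "truss_H1 A = H" "truss_\<sigma> A = s" "mult (truss_H2 A) = p"
    "s \<in> hom C X X" "p \<in> hom C (X \<otimes>\<^sub>o X) X"
  shows "truss_\<Gamma> C A = conv HH (S \<cdot> s \<cdot> P) p"
  using assms circ_eq[of "S \<cdot> s" p] by (simp add: truss_\<Gamma>_def Let_def circ_def hom_iff)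

text \<open>
  The non-trivial content from left to right is that \<open>\<Gamma>\<close> is a coalgebra morphism.
\<close>

lemma star_truss_iff:
  assumes "truss_H1 A = H" "truss_H2 A = bialg H p" "truss_\<sigma> A = s" "truss_\<Gamma> C A = g"
  shows "star_truss C A \<longleftrightarrow> twisted_hopf C H s g \<and> p = circ s g \<and> p \<cdot> (p \<otimes> I) = p \<cdot> (I \<otimes> p) \<and>
    p \<cdot> (I \<otimes> \<mu>) = conv HHH (p \<cdot> (I \<otimes> P)) (g \<cdot> (I \<otimes> prj2 H H))"
    (is "_ \<longleftrightarrow> ?R")
proof -
  have iff: "star_truss C A \<longleftrightarrow> s \<in> coalgebra_mor C H H \<and> p \<in> coalgebra_mor C HH H \<and>
      p \<cdot> (p \<otimes> I) = p \<cdot> (I \<otimes> p) \<and> braiding C X X \<cdot> pair HH P g = pair HH g P \<and>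
      p \<cdot> (I \<otimes> \<mu>) = conv HHH (p \<cdot> (I \<otimes> P)) (g \<cdot> (I \<otimes> prj2 H H))"
    if "s \<in> coalgebra_mor C H H" "p \<in> coalgebra_mor C HH H"
  proof -
    have t: "s \<in> hom C X X" "p \<in> hom C (X \<otimes>\<^sub>o X) X"
      using that by (auto simp: coalgebra_mor_def)
    then have g: "g \<in> hom C (X \<otimes>\<^sub>o X) X"
      using truss_\<Gamma>_eq[of A s p] assms by (simp add: hom_iff)
    have "coalgebra.truncate (bialg H p) = coalgebra.truncate H"
      by (simp add: coalgebra.truncate_def)
    then show ?thesis
      using that by (simp add: star_truss_def hopf_truss_def Let_def assms hopf bialg_iff star_iff[OF g]
        distrib_eq[OF coalgebra_H t(2) g] conj_ac del: tensor_assoc assoc)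
  qed
  show ?thesis
  proof
    assume *: "star_truss C A"
    then have mor: "s \<in> coalgebra_mor C H H" "p \<in> coalgebra_mor C HH H"
      by (simp_all add: star_truss_def hopf_truss_def Let_def assms bialg_iff)
    note mor_type = coalgebra_morD[OF mor(1)] coalgebra_morD[OF mor(2)]
    note eqs = iff[OF mor, THEN iffD1, OF *]
    have sP: "s \<cdot> P \<in> coalgebra_mor C HH H"
      by (rule coalgebra_mor_comp[of HH H]) (simp_all add: mor)
    have g: "g = conv HH (S \<cdot> (s \<cdot> P)) p"
      using truss_\<Gamma>_eq[of A s p] mor_type assms by (simp add: hom_iff)
    then have gt: "g \<in> hom C (X \<otimes>\<^sub>o X) X"
      using mor_type by (simp add: hom_iff)
    have p: "conv HH (s \<cdot> P) g = p"
      unfolding g using mor_type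
      by (subst conv_assoc[symmetric]) (simp_all add: conv_antipode[OF _ sP, simplified] conv_unit[of HH, simplified])
    have "g \<in> coalgebra_mor C HH H"
      by (rule conv_mor_cancel[of HH "s \<cdot> P"]) (use gt sP p mor eqs prj1_commute[of s g] mor_type in \<open>simp_all add: hom_iff\<close>)
    then show ?R
      using mor eqs p by (simp add: twisted_hopf_def twisted_hopf_axioms_def hopf circ_def hopf_axioms)
  next
    assume R: ?R
    then interpret twisted_hopf C H s g by blast
    have "p \<in> coalgebra_mor C HH H"
      using circ_mor R by simp
    from iff[OF s_mor this] show "star_truss C A"
      using R s_mor commute \<open>p \<in> coalgebra_mor C HH H\<close> by blast
  qed
qed

end

context strict_braided_monoidal_category
begin

lemma post_of_truss:
  assumes "star_truss C A"
  shows "star_post C (post_of_truss C A)" "truss_of_post C (post_of_truss C A) = A"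
proof -
  let ?H = "truss_H1 A" and ?p = "mult (truss_H2 A)" and ?s = "truss_\<sigma> A" and ?g = "truss_\<Gamma> C A"
  interpret hopf C ?H
    by unfold_locales (use assms in \<open>simp add: star_truss_def hopf_truss_def Let_def\<close>)
  have H2: "truss_H2 A = bialg ?H ?p"
    using assms by (cases "truss_H2 A")
      (simp add: star_truss_def hopf_truss_def Let_def coalgebra.truncate_def bialg_def)
  note R = star_truss_iff[OF refl H2 refl refl, THEN iffD1, OF assms]
  interpret twisted_hopf C ?H ?s ?g using R by blast
  have "?p = n" using R by blast
  have laws: "n \<cdot> (n \<otimes> I) = n \<cdot> (I \<otimes> n)" "n \<cdot> (I \<otimes> mult ?H) = conv HHH (n \<cdot> P12) (?g \<cdot> P13)"
    using R unfolding \<open>?p = n\<close> by blast+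
  have post: "ph_H (post_of_truss C A) = ?H" "ph_m (post_of_truss C A) = ?g" "ph_\<Phi> (post_of_truss C A) = ?s"
    by (simp_all add: post_of_truss_def)
  show "star_post C (post_of_truss C A)"
    unfolding star_post_iff[OF post] using truss_imp_post[OF laws] twisted_hopf_axioms by blast
  have "post_mult C (post_of_truss C A) = n"
    using circ_eq[of ?s ?g] by (simp add: post_mult_def post_of_truss_def hom_iff)
  then show "truss_of_post C (post_of_truss C A) = A"
    using \<open>?p = n\<close> H2 by (cases A) (simp add: truss_of_post_def post_of_truss_def)
qed

lemma star_postD:
  assumes "star_post C A"
  shows "twisted_hopf C (ph_H A) (ph_\<Phi> A) (ph_m A)"
    "post_mult C A = hopf.circ C (ph_H A) (ph_\<Phi> A) (ph_m A)"
proof -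
  interpret hopf C "ph_H A"
    by unfold_locales (use assms in \<open>simp add: star_post_def post_hopf_def Let_def\<close>)
  interpret twisted_hopf C "ph_H A" "ph_\<Phi> A" "ph_m A"
    using star_post_iff[OF refl refl refl] assms by blast
  show "twisted_hopf C (ph_H A) (ph_\<Phi> A) (ph_m A)" ..
  show "post_mult C A = circ (ph_\<Phi> A) (ph_m A)"
    using circ_eq[of "ph_\<Phi> A" "ph_m A"] by (simp add: post_mult_def hom_iff)
qed

lemma truss_of_post:
  assumes "star_post C A"
  shows "star_truss C (truss_of_post C A)" "post_of_truss C (truss_of_post C A) = A"
proof -
  interpret twisted_hopf C "ph_H A" "ph_\<Phi> A" "ph_m A"
    by (rule star_postD[OF assms])
  note n = star_postD(2)[OF assms]
  let ?A = "truss_of_post C A"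
  have A: "truss_H1 ?A = ph_H A" "truss_H2 ?A = bialg (ph_H A) n" "truss_\<sigma> ?A = ph_\<Phi> A"
    by (simp_all add: truss_of_post_def n)
  have g: "truss_\<Gamma> C ?A = ph_m A"
    using action_eq truss_\<Gamma>_eq[OF A(1,3), of n] A by (simp add: hom_iff)
  note eqs = star_post_iff[OF refl refl refl, THEN iffD1, OF assms]
  show "star_truss C ?A"
    using post_imp_truss eqs twisted_hopf_axioms by (subst star_truss_iff[OF A g]) blast
  show "post_of_truss C ?A = A"
    by (cases A) (use A g in \<open>simp add: post_of_truss_def\<close>)
qed

lemma star_rbD:
  assumes "star_rb C A"
  shows "hopf_algebra C (rb_H A)" "nonunital_bialgebra C (rb_B A)"
    "nonunital_module_algebra_coalgebra C (rb_B A) (rb_H A) (rb_\<phi> A)"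
    "rb_T A \<in> coalgebra_mor C (rb_H A) (rb_B A)" "rb_\<Psi> A \<in> coalgebra_mor C (rb_H A) (rb_H A)"
    "rb_T A \<in> iso C (carrier (rb_H A)) (carrier (rb_B A))"
    "star_condition C (rb_H A) (rb_m C A)"
  using assms by (simp_all add: star_rb_def rota_baxter_def Let_def)

lemma bialgebraD:
  assumes "nonunital_bialgebra C B"
  shows "coalgebra C B" "mult B \<in> coalgebra_mor C (tensor_coalgebra C B B) B"
    "mult B \<in> Arr C" "Dom C (mult B) = carrier B \<otimes>\<^sub>o carrier B" "Cod C (mult B) = carrier B"
  using assms coalgebra_morD[of "mult B" "tensor_coalgebra C B B" B]
  by (simp_all add: nonunital_bialgebra_def Let_def)

lemma actionD:
  assumes "nonunital_module_algebra_coalgebra C B H a" "coalgebra C B" "coalgebra C H"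
  shows "a \<in> coalgebra_mor C (tensor_coalgebra C B H) H"
    "a \<in> Arr C" "Dom C a = carrier B \<otimes>\<^sub>o carrier H" "Cod C a = carrier H"
    "a \<cdot> (ide C (carrier B) \<otimes> a) = a \<cdot> (mult B \<otimes> ide C (carrier H))"
  using assms coalgebra_morD[of a "tensor_coalgebra C B H" H]
  by (simp_all add: nonunital_module_algebra_coalgebra_def Let_def)

text \<open>
  The post-Hopf laws for \<open>m\<close> are those of the action of \<open>B\<close> on \<open>H\<close>, restricted along the coalgebra
  morphism \<open>T\<close>.
\<close>

lemma post_of_rb:
  assumes "star_rb C A"
  shows "star_post C (post_of_rb C A)"
proof -
  let ?H = "rb_H A" and ?B = "rb_B A" and ?T = "rb_T A" and ?a = "rb_\<phi> A" and ?s = "rb_\<Psi> A" and ?m = "rb_m C A"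
  let ?BI = "ide C (carrier ?B)"
  note rb = star_rbD[OF assms]
  interpret hopf C ?H by unfold_locales (rule rb)
  note B = bialgebraD[OF rb(2)]
  note a = actionD[OF rb(3) B(1) coalgebra_H]
  note T = coalgebra_morD(1-3)[OF rb(4)] and s = coalgebra_morD(1-3)[OF rb(5)]
  note t = B(1,3-) coalgebra_type[OF B(1)] a(2-4) T s
  have m: "?m = ?a \<cdot> (?T \<otimes> I)"
    by (simp add: rb_m_def)
  have m_comp: "?m \<cdot> x = ?a \<cdot> ((?T \<otimes> I) \<cdot> x)" if "x \<in> Arr C" "Cod C x = X \<otimes>\<^sub>o X" for x
    unfolding m using t that by simp
  have TI: "?T \<otimes> I \<in> coalgebra_mor C HH (tensor_coalgebra C ?B ?H)"
    by (rule tensor_coalgebra_mor) (simp_all add: B rb(4))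
  have m_mor: "?m \<in> coalgebra_mor C HH ?H"
    unfolding m by (rule coalgebra_mor_comp[OF _ _ _ TI a(1)]) (simp_all add: B)
  note mt = coalgebra_morD(1-3)[OF m_mor]
  have hom: "?s \<in> hom C X X" "?m \<in> hom C (X \<otimes>\<^sub>o X) X"
    using s mt by (simp_all add: hom_iff)
  interpret twisted_hopf C ?H ?s ?m
    by unfold_locales (use rb hom m_mor star_iff in simp_all)
  have T_mult: "mult ?B \<cdot> (?T \<otimes> ?T) = ?T \<cdot> n"
  proof -
    have "mult ?B \<cdot> (?T \<otimes> ?T) = ?T \<cdot> \<mu> \<cdot> (?s \<otimes> ?m) \<cdot> (comult ?H \<otimes> I)"
      using assms by (simp add: star_rb_def rota_baxter_def Let_def del: assoc)
    also have "\<dots> = ?T \<cdot> (\<mu> \<cdot> (?s \<otimes> ?m) \<cdot> (comult ?H \<otimes> I))"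
      using t mt by simp
    finally show ?thesis unfolding circ_eq[OF hom] .
  qed
  have "?s \<cdot> \<mu> \<cdot> (?s \<otimes> ?m) \<cdot> (comult ?H \<otimes> I) = \<mu> \<cdot> (?s \<otimes> ?m) \<cdot> (comult ?H \<otimes> ?s)"
    using assms by (simp add: star_rb_def rota_baxter_def Let_def del: assoc)
  then have 1: "?s \<cdot> n = n \<cdot> (I \<otimes> ?s)"
    unfolding circ_twist[OF hom] .
  have "?m \<cdot> (I \<otimes> ?m) = (?a \<cdot> (?BI \<otimes> ?a)) \<cdot> (?T \<otimes> (?T \<otimes> I))"
    unfolding m using t by (simp add: interchange)
  also have "\<dots> = ?a \<cdot> ((mult ?B \<cdot> (?T \<otimes> ?T)) \<otimes> I)"
    unfolding a(5) using t by (simp add: interchange flip: tensor_assoc)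
  also have "\<dots> = ?m \<cdot> (n \<otimes> I)"
    using m_comp[of "n \<otimes> I"] t unfolding T_mult by (simp add: interchange)
  finally have 2: "?m \<cdot> (I \<otimes> ?m) = ?m \<cdot> (n \<otimes> I)" .
  let ?BHH = "tensor_coalgebra C ?B HH"
  have "?a \<cdot> (?BI \<otimes> \<mu>) = \<mu> \<cdot> (?a \<otimes> ?a) \<cdot> (?BI \<otimes> braiding C (carrier ?B) X \<otimes> I) \<cdot> (comult ?B \<otimes> I \<otimes> I)"
    using rb(3) by (simp add: nonunital_module_algebra_coalgebra_def Let_def del: assoc tensor_assoc)
  also have "\<dots> = conv ?BHH (?a \<cdot> (?BI \<otimes> P)) (?a \<cdot> (?BI \<otimes> prj2 ?H ?H))"
    using t by (intro distrib_eq) (simp_all add: hom_iff)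
  finally have dist: "?a \<cdot> (?BI \<otimes> \<mu>) = conv ?BHH (?a \<cdot> (?BI \<otimes> P)) (?a \<cdot> (?BI \<otimes> prj2 ?H ?H))" .
  have TII: "?T \<otimes> (I \<otimes> I) \<in> coalgebra_mor C HHH ?BHH"
    by (intro tensor_coalgebra_mor) (simp_all add: B rb(4))
  have "?m \<cdot> (I \<otimes> \<mu>) = (?a \<cdot> (?BI \<otimes> \<mu>)) \<cdot> (?T \<otimes> (I \<otimes> I))"
    unfolding m using t by (simp add: interchange)
  also have "\<dots> = conv HHH ((?a \<cdot> (?BI \<otimes> P)) \<cdot> (?T \<otimes> (I \<otimes> I))) ((?a \<cdot> (?BI \<otimes> prj2 ?H ?H)) \<cdot> (?T \<otimes> (I \<otimes> I)))"
    unfolding dist by (rule conv_comp[OF TII]) (use t in simp_all)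
  also have "\<dots> = conv HHH (?m \<cdot> P12) (?m \<cdot> P13)"
    unfolding m using t by (simp add: interchange)
  finally have 3: "?m \<cdot> (I \<otimes> \<mu>) = conv HHH (?m \<cdot> P12) (?m \<cdot> P13)" .
  have post: "ph_H (post_of_rb C A) = ?H" "ph_m (post_of_rb C A) = ?m" "ph_\<Phi> (post_of_rb C A) = ?s"
    by (simp_all add: post_of_rb_def)
  show ?thesis
    unfolding star_post_iff[OF post] using 1 2 3 twisted_hopf_axioms by blast
qed

text \<open>
  \<open>T\<close> is multiplicative from \<open>(H, \<circ>)\<close> to \<open>B\<close>.
\<close>

lemma rb_T_mult:
  assumes "star_rb C A"
  shows "mult (rb_B A) \<cdot> (rb_T A \<otimes> rb_T A) = rb_T A \<cdot> post_mult C (post_of_rb C A)"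
proof -
  note rb = star_rbD[OF assms] and p = star_postD[OF post_of_rb[OF assms]]
  interpret twisted_hopf C "rb_H A" "rb_\<Psi> A" "rb_m C A"
    using p(1) by (simp add: post_of_rb_def)
  have "mult (rb_B A) \<cdot> (rb_T A \<otimes> rb_T A) = rb_T A \<cdot> \<mu> \<cdot> (rb_\<Psi> A \<otimes> rb_m C A) \<cdot> (comult (rb_H A) \<otimes> I)"
    using assms by (simp add: star_rb_def rota_baxter_def Let_def del: assoc)
  then show ?thesis
    using coalgebra_morD(1-3)[OF rb(4)] by (simp add: post_mult_def post_of_rb_def)
qed

lemma rb_of_post:
  assumes "star_post C A"
  shows "star_rb C (rb_of_post C A)" "post_of_rb C (rb_of_post C A) = A"
proof -
  interpret twisted_hopf C "ph_H A" "ph_\<Phi> A" "ph_m A"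
    by (rule star_postD[OF assms])
  let ?A = "rb_of_post C A"
  note n = star_postD(2)[OF assms]
  note eqs = star_post_iff[OF refl refl refl, THEN iffD1, OF assms]
  have A: "rb_H ?A = ph_H A" "rb_B ?A = bialg (ph_H A) n" "rb_T ?A = I" "rb_\<phi> ?A = ph_m A" "rb_\<Psi> ?A = ph_\<Phi> A"
    by (simp_all add: rb_of_post_def n)
  have m: "rb_m C ?A = ph_m A"
    by (simp add: rb_m_def A)
  have hom: "ph_\<Phi> A \<in> hom C X X" "ph_m A \<in> hom C (X \<otimes>\<^sub>o X) X"
    by (simp_all add: hom_iff)
  have nn: "n \<cdot> (n \<otimes> I) = n \<cdot> (I \<otimes> n)"
    using eqs by (intro post_imp_truss) blast+
  have unit: "ph_m A \<cdot> (I \<otimes> \<eta>) = counit (ph_H A) \<otimes> \<eta>"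
    using eqs action_unit interchange[of "counit (ph_H A)" "ide C (unit_obj C)" "ide C (unit_obj C)" \<eta>] by simp
  have dist: "ph_m A \<cdot> (I \<otimes> \<mu>) = \<mu> \<cdot> (ph_m A \<otimes> ph_m A) \<cdot> (I \<otimes> braiding C X X \<otimes> I) \<cdot> (comult (ph_H A) \<otimes> I \<otimes> I)"
    using eqs distrib_eq[OF coalgebra_H hom(2,2)] by simp
  have act: "nonunital_module_algebra_coalgebra C (bialg (ph_H A) n) (ph_H A) (ph_m A)"
    unfolding nonunital_module_algebra_coalgebra_def Let_def bialg_simps bialg_coalgebra
    using eqs m_mor unit dist by blast
  have star: "star_condition C (ph_H A) (ph_m A)"
    using assms by (simp add: star_post_def)
  have "I \<in> iso C X X"
    by (auto simp: iso_def hom_iff intro!: bexI[of _ I])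
  have "rota_baxter C ?A"
    unfolding rota_baxter_def Let_def A m
    using hopf bialg_iff nn circ_mor act s_mor eqs
    by (simp add: circ_twist[OF hom] circ_eq[OF hom] del: assoc tensor_assoc)
  then show "star_rb C ?A"
    using star \<open>I \<in> iso C X X\<close> by (simp add: star_rb_def A m)
  show "post_of_rb C ?A = A"
    by (cases A) (use A m in \<open>simp add: post_of_rb_def\<close>)
qed

section \<open>The constructions on morphisms\<close>

lemma bialgebra_morD:
  assumes "f \<in> nonunital_bialgebra_mor C A B"
  shows "f \<in> coalgebra_mor C A B" "f \<cdot> mult A = mult B \<cdot> (f \<otimes> f)"
    "f \<in> Arr C" "Dom C f = carrier A" "Cod C f = carrier B"
  using assms coalgebra_morD[of f A B] by (simp_all add: nonunital_bialgebra_mor_def)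

lemma hopf_morD:
  assumes "f \<in> hopf_algebra_mor C A B"
  shows "f \<in> nonunital_bialgebra_mor C A B" "f \<in> coalgebra_mor C A B" "f \<cdot> mult A = mult B \<cdot> (f \<otimes> f)"
    "f \<cdot> unit_mor A = unit_mor B"
    "f \<in> Arr C" "Dom C f = carrier A" "Cod C f = carrier B"
  using assms bialgebra_morD[of f A B] by (simp_all add: hopf_algebra_mor_def)

lemma bialgebra_mor_ide:
  assumes "nonunital_bialgebra C A"
  shows "ide C (carrier A) \<in> nonunital_bialgebra_mor C A A"
  using bialgebraD[OF assms] by (simp add: nonunital_bialgebra_mor_def ide_coalgebra_mor coalgebra_type)

lemma bialgebra_mor_comp:
  assumes "nonunital_bialgebra C A" "nonunital_bialgebra C B" "nonunital_bialgebra C D"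
    "f \<in> nonunital_bialgebra_mor C A B" "g \<in> nonunital_bialgebra_mor C B D"
  shows "g \<cdot> f \<in> nonunital_bialgebra_mor C A D"
proof -
  note A = bialgebraD[OF assms(1)] and B = bialgebraD[OF assms(2)] and D = bialgebraD[OF assms(3)]
  note f = bialgebra_morD[OF assms(4)] and g = bialgebra_morD[OF assms(5)]
  note t = A(1,3-) B(1,3-) D(1,3-) f(3-) g(3-)
  have "g \<cdot> f \<cdot> mult A = (g \<cdot> mult B) \<cdot> (f \<otimes> f)"
    using t by (simp add: f(2))
  also have "\<dots> = mult D \<cdot> ((g \<cdot> f) \<otimes> (g \<cdot> f))"
    using t by (simp add: g(2) interchange)
  finally show ?thesis
    using coalgebra_mor_comp[OF A(1) B(1) D(1) f(1) g(1)] by (simp add: nonunital_bialgebra_mor_def)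
qed

lemma hopf_nonunital: "hopf_algebra C A \<Longrightarrow> nonunital_bialgebra C A"
  by (simp add: hopf_algebra_def Let_def)

lemma hopf_mor_ide:
  fixes A :: "('o, 'a) hopf_algebra"
  assumes "hopf_algebra C A"
  shows "ide C (carrier A) \<in> hopf_algebra_mor C A A"
proof -
  interpret hopf C A by unfold_locales fact
  show ?thesis
    using bialgebra_mor_ide[OF hopf_nonunital[OF assms]] by (simp add: hopf_algebra_mor_def)
qed

lemma hopf_mor_comp:
  fixes A B D :: "('o, 'a) hopf_algebra"
  assumes "hopf_algebra C A" "hopf_algebra C B" "hopf_algebra C D"
    "f \<in> hopf_algebra_mor C A B" "g \<in> hopf_algebra_mor C B D"
  shows "g \<cdot> f \<in> hopf_algebra_mor C A D"
proof -
  interpret A: hopf C A by unfold_locales fact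
  note f = hopf_morD[OF assms(4)] and g = hopf_morD[OF assms(5)]
  show ?thesis
    using bialgebra_mor_comp[OF hopf_nonunital[OF assms(1)] hopf_nonunital[OF assms(2)] hopf_nonunital[OF assms(3)] f(1) g(1)] f g
    by (simp add: hopf_algebra_mor_def)
qed

lemma bialgebra_mor_inverse:
  assumes "nonunital_bialgebra C A" "nonunital_bialgebra C B" "f \<in> nonunital_bialgebra_mor C A B"
    "g \<in> hom C (carrier B) (carrier A)" "g \<cdot> f = ide C (carrier A)" "f \<cdot> g = ide C (carrier B)"
  shows "g \<in> nonunital_bialgebra_mor C B A"
proof -
  note A = bialgebraD[OF assms(1)] and B = bialgebraD[OF assms(2)]
  note f = bialgebra_morD[OF assms(3)] and g = assms(4)[unfolded hom_iff]
  note t = A(1,3-) B(1,3-) coalgebra_type[OF A(1)] coalgebra_type[OF B(1)] f(3-) g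
  have cancel: "x = y" if "f \<cdot> x = f \<cdot> y" "x \<in> Arr C" "y \<in> Arr C" "Cod C x = carrier A" "Cod C y = carrier A" for x y
  proof -
    have "(g \<cdot> f) \<cdot> x = (g \<cdot> f) \<cdot> y"
      using t that by simp
    then show ?thesis
      unfolding assms(5) using that t by simp
  qed
  have "counit A \<cdot> g = counit B \<cdot> (f \<cdot> g)"
    using t by (simp flip: assoc add: coalgebra_morD(4)[OF f(1)])
  then have 1: "counit A \<cdot> g = counit B"
    using t by (simp add: assms)
  have "comult A \<cdot> g = ((g \<otimes> g) \<cdot> (f \<otimes> f)) \<cdot> (comult A \<cdot> g)"
    using t by (simp add: interchange assms(5))
  also have "\<dots> = (g \<otimes> g) \<cdot> ((comult B \<cdot> f) \<cdot> g)"
    using t unfolding coalgebra_morD(5)[OF f(1)] pair_def by simp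
  also have "\<dots> = (g \<otimes> g) \<cdot> comult B"
    using t by (simp add: assms(6))
  finally have 2: "comult A \<cdot> g = (g \<otimes> g) \<cdot> comult B" .
  have "f \<cdot> (g \<cdot> mult B) = (f \<cdot> g) \<cdot> mult B"
    using t by simp
  also have "\<dots> = (mult B \<cdot> (f \<otimes> f)) \<cdot> (g \<otimes> g)"
    using t by (simp add: interchange assms(6))
  also have "\<dots> = f \<cdot> (mult A \<cdot> (g \<otimes> g))"
    unfolding f(2)[symmetric] using t by simp
  finally have 3: "g \<cdot> mult B = mult A \<cdot> (g \<otimes> g)"
    by (rule cancel) (use t in simp_all)
  show ?thesis
    unfolding nonunital_bialgebra_mor_def coalgebra_mor_def using 1 2 3 assms(4) by simp
qed

lemma conv_map:
  assumes "hopf_algebra C H" "hopf_algebra C H'" "f \<in> hopf_algebra_mor C H H'"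
    "coalgebra C D" "a \<in> hom C (carrier D) (carrier H)" "b \<in> hom C (carrier D) (carrier H)"
  shows "f \<cdot> hopf.conv C H D a b = hopf.conv C H' D (f \<cdot> a) (f \<cdot> b)"
proof -
  interpret A: hopf C H by unfold_locales fact
  interpret B: hopf C H' by unfold_locales fact
  note f = hopf_morD[OF assms(3)]
  note t = f(5-) assms(4-)[unfolded hom_iff]
  have "f \<cdot> A.conv D a b = (f \<cdot> mult H) \<cdot> pair D a b"
    using t by (simp add: A.conv_def)
  also have "\<dots> = B.conv D (f \<cdot> a) (f \<cdot> b)"
    unfolding f(3) using t by (simp add: tensor_pair B.conv_def)
  finally show ?thesis .
qed

text \<open>
  A Hopf algebra morphism preserves \<open>\<circ>\<close> if it preserves \<open>m\<close> and \<open>s\<close>.  The converse uses \<open>s(a) = a \<circ> 1\<close>,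
  after which \<open>m\<close> is obtained by cancelling \<open>s\<close>.
\<close>

lemma twisted_mor:
  assumes "twisted_hopf C H s m" "twisted_hopf C H' s' m'" "f \<in> hopf_algebra_mor C H H'"
  defines "n \<equiv> hopf.circ C H s m" and "n' \<equiv> hopf.circ C H' s' m'"
  shows "f \<cdot> m = m' \<cdot> (f \<otimes> f) \<Longrightarrow> f \<cdot> s = s' \<cdot> f \<Longrightarrow> f \<cdot> n = n' \<cdot> (f \<otimes> f)"
    "f \<cdot> n = n' \<cdot> (f \<otimes> f) \<Longrightarrow> s = n \<cdot> (ide C (carrier H) \<otimes> unit_mor H) \<Longrightarrow>
      s' = n' \<cdot> (ide C (carrier H') \<otimes> unit_mor H') \<Longrightarrow> f \<cdot> s = s' \<cdot> f \<and> f \<cdot> m = m' \<cdot> (f \<otimes> f)"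
proof -
  interpret A: twisted_hopf C H s m by fact
  interpret B: twisted_hopf C H' s' m' by fact
  note f = hopf_morD[OF assms(3)]
  note t = f(5-)
  have ff: "f \<otimes> f \<in> coalgebra_mor C A.HH B.HH"
    by (intro tensor_coalgebra_mor) (simp_all add: f)
  have P: "B.P \<cdot> (f \<otimes> f) = f \<cdot> A.P"
    by (rule prj1_tensor) (simp_all add: f)
  have l: "f \<cdot> n = B.conv A.HH (f \<cdot> (s \<cdot> A.P)) (f \<cdot> m)"
    unfolding n_def A.circ_def by (rule conv_map) (simp_all add: assms(3) A.hopf B.hopf hom_iff)
  have "n' \<cdot> (f \<otimes> f) = B.conv A.HH ((s' \<cdot> B.P) \<cdot> (f \<otimes> f)) (m' \<cdot> (f \<otimes> f))"
    unfolding n'_def B.circ_def by (rule B.conv_comp[OF ff]) simp_all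
  then have r: "n' \<cdot> (f \<otimes> f) = B.conv A.HH (s' \<cdot> (f \<cdot> A.P)) (m' \<cdot> (f \<otimes> f))"
    using t by (simp add: P)
  have nt: "n \<in> Arr C" "Dom C n = carrier H \<otimes>\<^sub>o carrier H" "Cod C n = carrier H"
     "n' \<in> Arr C" "Dom C n' = carrier H' \<otimes>\<^sub>o carrier H'" "Cod C n' = carrier H'"
    by (simp_all add: n_def n'_def)
  {
    assume "f \<cdot> m = m' \<cdot> (f \<otimes> f)" "f \<cdot> s = s' \<cdot> f"
    moreover have "f \<cdot> (s \<cdot> A.P) = (f \<cdot> s) \<cdot> A.P" using t by simp
    ultimately show "f \<cdot> n = n' \<cdot> (f \<otimes> f)"
      unfolding l r using t by simp
  next
    assume n: "f \<cdot> n = n' \<cdot> (f \<otimes> f)" and s: "s = n \<cdot> (ide C (carrier H) \<otimes> unit_mor H)"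
      "s' = n' \<cdot> (ide C (carrier H') \<otimes> unit_mor H')"
    have "(ide C (carrier H') \<otimes> unit_mor H') \<cdot> f = (f \<otimes> f) \<cdot> (ide C (carrier H) \<otimes> unit_mor H)"
      using t interchange[of f "ide C (carrier H')" "ide C (unit_obj C)" "unit_mor H'"] by (simp add: interchange f(4))
    then have "n' \<cdot> (ide C (carrier H') \<otimes> unit_mor H') \<cdot> f = (f \<cdot> n) \<cdot> (ide C (carrier H) \<otimes> unit_mor H)"
      unfolding n using t nt by simp
    then have fs: "f \<cdot> s = s' \<cdot> f"
      using t nt s by simp
    have sP: "f \<cdot> (s \<cdot> A.P) = s' \<cdot> (f \<cdot> A.P)"
      using arg_cong[OF fs, of "\<lambda>x. x \<cdot> A.P"] t by simp
    have mor: "f \<cdot> (s \<cdot> A.P) \<in> coalgebra_mor C A.HH H'"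
      by (rule coalgebra_mor_comp[of A.HH H]) (simp_all add: A.sP_mor f)
    have "B.conv A.HH (f \<cdot> (s \<cdot> A.P)) (f \<cdot> m) = B.conv A.HH (f \<cdot> (s \<cdot> A.P)) (m' \<cdot> (f \<otimes> f))"
      using n unfolding l r sP .
    then have "f \<cdot> m = m' \<cdot> (f \<otimes> f)"
      by (rule B.conv_cancel[OF _ mor, rotated 3]) (use t in \<open>simp_all add: hom_iff\<close>)
    with fs show "f \<cdot> s = s' \<cdot> f \<and> f \<cdot> m = m' \<cdot> (f \<otimes> f)" by blast
  }
qed

lemma bialgebra_mor_hom: "f \<in> nonunital_bialgebra_mor C A B \<Longrightarrow> f \<in> hom C (carrier A) (carrier B)"
  by (simp add: nonunital_bialgebra_mor_def coalgebra_mor_def)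

lemma hopf_mor_hom: "f \<in> hopf_algebra_mor C A B \<Longrightarrow> f \<in> hom C (carrier A) (carrier B)"
  by (simp add: hopf_algebra_mor_def bialgebra_mor_hom)

lemma star_post_unit:
  assumes "star_post C A"
  shows "ph_\<Phi> A = post_mult C A \<cdot> (ide C (carrier (ph_H A)) \<otimes> unit_mor (ph_H A))"
proof -
  interpret twisted_hopf C "ph_H A" "ph_\<Phi> A" "ph_m A"
    by (rule star_postD[OF assms])
  note eqs = star_post_iff[OF refl refl refl, THEN iffD1, OF assms]
  have laws: "n \<cdot> (n \<otimes> I) = n \<cdot> (I \<otimes> n)" "n \<cdot> (I \<otimes> \<mu>) = conv HHH (n \<cdot> P12) (ph_m A \<cdot> P13)"
    using post_imp_truss eqs by blast+
  show ?thesis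
    unfolding star_postD(2)[OF assms] by (rule truss_imp_post(4)[OF laws])
qed

lemma post_mor_iff:
  assumes "star_post C A" "star_post C B"
  shows "f \<in> post_hopf_mor C A B \<longleftrightarrow>
    f \<in> hopf_algebra_mor C (ph_H A) (ph_H B) \<and> f \<cdot> post_mult C A = post_mult C B \<cdot> (f \<otimes> f)"
  using twisted_mor[OF star_postD(1)[OF assms(1)] star_postD(1)[OF assms(2)], of f]
    star_post_unit[OF assms(1)] star_post_unit[OF assms(2)]
  unfolding post_hopf_mor_def star_postD(2)[OF assms(1), symmetric] star_postD(2)[OF assms(2), symmetric]
  by auto

lemma truss_mor_eq:
  assumes "star_post C A" "star_post C B"
  shows "hopf_truss_mor C (truss_of_post C A) (truss_of_post C B) = post_hopf_mor C A B"
proof (rule set_eqI)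
  fix f
  show "f \<in> hopf_truss_mor C (truss_of_post C A) (truss_of_post C B) \<longleftrightarrow> f \<in> post_hopf_mor C A B"
    unfolding post_mor_iff[OF assms] using hopf_morD(2)
    by (auto simp: hopf_truss_mor_def truss_of_post_def nonunital_bialgebra_mor_def)
qed

lemma rb_mor_of_post_mor:
  assumes "star_post C A" "star_post C B" "f \<in> post_hopf_mor C A B"
  shows "(f, f) \<in> rota_baxter_mor C (rb_of_post C A) (rb_of_post C B)"
proof -
  have f: "f \<in> hopf_algebra_mor C (ph_H A) (ph_H B)" "f \<cdot> post_mult C A = post_mult C B \<cdot> (f \<otimes> f)"
    using assms post_mor_iff by blast+
  then show ?thesis
    using assms(3) hopf_morD[OF f(1)]
    by (simp add: rota_baxter_mor_def rb_of_post_def post_hopf_mor_def nonunital_bialgebra_mor_def)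
qed

lemma post_mor_of_rb_mor:
  assumes "star_rb C A" "star_rb C B" "(f, g) \<in> rota_baxter_mor C A B"
  shows "f \<in> post_hopf_mor C (post_of_rb C A) (post_of_rb C B)"
proof -
  have fg: "f \<in> hopf_algebra_mor C (rb_H A) (rb_H B)" "g \<in> nonunital_bialgebra_mor C (rb_B A) (rb_B B)"
    "rb_T B \<cdot> f = g \<cdot> rb_T A" "f \<cdot> rb_\<Psi> A = rb_\<Psi> B \<cdot> f" "f \<cdot> rb_\<phi> A = rb_\<phi> B \<cdot> (g \<otimes> f)"
    using assms(3) by (simp_all add: rota_baxter_mor_def)
  note A = star_rbD[OF assms(1)] and B = star_rbD[OF assms(2)]
  interpret HA: hopf C "rb_H A" by unfold_locales (rule A)
  interpret HB: hopf C "rb_H B" by unfold_locales (rule B)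
  note t = hopf_morD(5-)[OF fg(1)] bialgebra_morD(3-)[OF fg(2)] bialgebraD(1,3-)[OF A(2)] bialgebraD(1,3-)[OF B(2)]
    actionD(2-4)[OF A(3) bialgebraD(1)[OF A(2)] HA.coalgebra_H] actionD(2-4)[OF B(3) bialgebraD(1)[OF B(2)] HB.coalgebra_H]
    coalgebra_morD(1-3)[OF A(4)] coalgebra_morD(1-3)[OF B(4)]
  have "f \<cdot> rb_m C A = (f \<cdot> rb_\<phi> A) \<cdot> (rb_T A \<otimes> ide C (carrier (rb_H A)))"
    unfolding rb_m_def using t by simp
  also have "\<dots> = rb_m C B \<cdot> (f \<otimes> f)"
    unfolding rb_m_def fg(5) using t by (simp add: interchange fg(3))
  finally show ?thesis
    using fg by (simp add: post_hopf_mor_def post_of_rb_def)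
qed

text \<open>
  \<open>(id, T)\<close> is an isomorphism from the Rota--Baxter operator rebuilt from its post-Hopf algebra to the
  original one.
\<close>

lemma rb_counit:
  assumes "star_rb C A"
  defines "A' \<equiv> rb_of_post C (post_of_rb C A)" and "u \<equiv> (ide C (carrier (rb_H A)), rb_T A)"
  shows "u \<in> rota_baxter_mor C A' A"
    "\<exists>v \<in> rota_baxter_mor C A A'.
      fst v \<cdot> fst u = ide C (carrier (rb_H A)) \<and> snd v \<cdot> snd u = ide C (carrier (rb_H A)) \<and>
      fst u \<cdot> fst v = ide C (carrier (rb_H A)) \<and> snd u \<cdot> snd v = ide C (carrier (rb_B A))"
proof -
  note A = star_rbD[OF assms(1)]
  let ?H = "rb_H A" and ?T = "rb_T A" and ?n = "post_mult C (post_of_rb C A)"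
  let ?I = "ide C (carrier ?H)"
  interpret hopf C ?H by unfold_locales (rule A)
  note n = star_postD[OF post_of_rb[OF assms(1)]]
  interpret twisted_hopf C ?H "rb_\<Psi> A" "rb_m C A"
    using n(1) by (simp add: post_of_rb_def)
  have A': "rb_H A' = ?H" "rb_B A' = bialg ?H ?n" "rb_T A' = ?I" "rb_\<phi> A' = rb_m C A" "rb_\<Psi> A' = rb_\<Psi> A"
    by (simp_all add: A'_def rb_of_post_def post_of_rb_def)
  have nn: "nonunital_bialgebra C (bialg ?H ?n)"
    using star_rbD(2)[OF rb_of_post(1)[OF post_of_rb[OF assms(1)]]] A'(2) unfolding A'_def by simp
  have T: "?T \<in> nonunital_bialgebra_mor C (bialg ?H ?n) (rb_B A)"
    using A(4) rb_T_mult[OF assms(1)] by (simp add: nonunital_bialgebra_mor_def)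
  note t = coalgebra_morD(1-3)[OF A(4)] bialgebraD(1,3-)[OF A(2)] actionD(2-4)[OF A(3) bialgebraD(1)[OF A(2)] coalgebra_H]
    coalgebra_type[OF bialgebraD(1)[OF A(2)]]
  show "u \<in> rota_baxter_mor C A' A"
    using hopf_mor_ide[OF hopf] T t by (simp add: rota_baxter_mor_def A' u_def rb_m_def)
  obtain v where v: "v \<in> hom C (carrier (rb_B A)) X" "v \<cdot> ?T = I" "?T \<cdot> v = ide C (carrier (rb_B A))"
    using A(6) by (auto simp: iso_def)
  have "v \<in> nonunital_bialgebra_mor C (rb_B A) (bialg ?H ?n)"
    by (rule bialgebra_mor_inverse[OF nn A(2) T]) (use v in simp_all)
  then have "(I, v) \<in> rota_baxter_mor C A A'"
    using hopf_mor_ide[OF hopf] t v by (simp add: rota_baxter_mor_def A' rb_m_def hom_iff interchange ide_tensor[symmetric])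
  then show "\<exists>v \<in> rota_baxter_mor C A A'.
      fst v \<cdot> fst u = I \<and> snd v \<cdot> snd u = I \<and> fst u \<cdot> fst v = I \<and> snd u \<cdot> snd v = ide C (carrier (rb_B A))"
    using v by (intro bexI[of _ "(I, v)"]) (simp_all add: u_def)
qed

section \<open>The equivalences\<close>

lemma HTr_star_eq:
  "HTr_star C = structure_category (star_truss C) (hopf_truss_mor C) (\<lambda>S. ide C (carrier (truss_H1 S))) (\<cdot>)"
  unfolding HTr_star_def HTr_def full_subcategory_structure star_truss_def[abs_def] ..

lemma wtr_RB_iso_star_eq:
  "wtr_RB_iso_star C = structure_category (star_rb C) (rota_baxter_mor C)
     (\<lambda>R. (ide C (carrier (rb_H R)), ide C (carrier (rb_B R)))) (\<lambda>(f', g') (f, g). (f' \<cdot> f, g' \<cdot> g))"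
  unfolding wtr_RB_iso_star_def wtr_RB_def full_subcategory_structure star_rb_def[abs_def] ..

lemma wt_Post_Hopf_star_eq:
  "wt_Post_Hopf_star C = structure_category (star_post C) (post_hopf_mor C) (\<lambda>P. ide C (carrier (ph_H P))) (\<cdot>)"
  unfolding wt_Post_Hopf_star_def wt_Post_Hopf_def full_subcategory_structure star_post_def[abs_def] ..

lemma category_wt_Post_Hopf_star: "category (wt_Post_Hopf_star C)"
  unfolding wt_Post_Hopf_star_eq
proof (rule category_structure)
  fix A assume A: "star_post C A"
  then interpret twisted_hopf C "ph_H A" "ph_\<Phi> A" "ph_m A" by (rule star_postD)
  show "I \<in> post_hopf_mor C A A"
    using hopf_mor_ide[OF hopf] by (simp add: post_hopf_mor_def)
next
  fix A B D f g
  assume "star_post C A" "star_post C B" "star_post C D" and fg: "f \<in> post_hopf_mor C A B" "g \<in> post_hopf_mor C B D"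
  then interpret A: twisted_hopf C "ph_H A" "ph_\<Phi> A" "ph_m A"
    + B: twisted_hopf C "ph_H B" "ph_\<Phi> B" "ph_m B"
    + D: twisted_hopf C "ph_H D" "ph_\<Phi> D" "ph_m D"
    by (auto intro: star_postD)
  have f: "f \<in> hopf_algebra_mor C (ph_H A) (ph_H B)" "f \<cdot> ph_m A = ph_m B \<cdot> (f \<otimes> f)" "ph_\<Phi> B \<cdot> f = f \<cdot> ph_\<Phi> A"
    and g: "g \<in> hopf_algebra_mor C (ph_H B) (ph_H D)" "g \<cdot> ph_m B = ph_m D \<cdot> (g \<otimes> g)" "ph_\<Phi> D \<cdot> g = g \<cdot> ph_\<Phi> B"
    using fg by (simp_all add: post_hopf_mor_def)
  note t = hopf_morD(5-)[OF f(1)] hopf_morD(5-)[OF g(1)]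
  have "(g \<cdot> f) \<cdot> ph_m A = (g \<cdot> ph_m B) \<cdot> (f \<otimes> f)"
    using t by (simp add: f(2))
  then have 1: "(g \<cdot> f) \<cdot> ph_m A = ph_m D \<cdot> ((g \<cdot> f) \<otimes> (g \<cdot> f))"
    unfolding g(2) using t by (simp add: interchange)
  have "ph_\<Phi> D \<cdot> (g \<cdot> f) = (ph_\<Phi> D \<cdot> g) \<cdot> f"
    using t by simp
  then have "ph_\<Phi> D \<cdot> (g \<cdot> f) = (g \<cdot> f) \<cdot> ph_\<Phi> A"
    unfolding g(3) using t by (simp add: f(3))
  with 1 show "g \<cdot> f \<in> post_hopf_mor C A D"
    using hopf_mor_comp[OF A.hopf B.hopf D.hopf f(1) g(1)] unfolding post_hopf_mor_def by blast
qed (auto simp: post_hopf_mor_def hom_iff dest!: hopf_mor_hom)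

lemma category_HTr_star: "category (HTr_star C)"
  unfolding HTr_star_eq
proof (rule category_structure)
  fix A assume "star_truss C A"
  then have "hopf_algebra C (truss_H1 A)" "nonunital_bialgebra C (truss_H2 A)"
    "carrier (truss_H2 A) = carrier (truss_H1 A)"
    by (auto simp: star_truss_def hopf_truss_def Let_def coalgebra.truncate_def)
  then show "ide C (carrier (truss_H1 A)) \<in> hopf_truss_mor C A A"
    using hopf_mor_ide bialgebra_mor_ide[of "truss_H2 A"] by (simp add: hopf_truss_mor_def)
next
  fix A B D f g
  assume "star_truss C A" "star_truss C B" "star_truss C D" "f \<in> hopf_truss_mor C A B" "g \<in> hopf_truss_mor C B D"
  then show "g \<cdot> f \<in> hopf_truss_mor C A D"
    by (auto simp: hopf_truss_mor_def star_truss_def hopf_truss_def Let_def intro: hopf_mor_comp bialgebra_mor_comp)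
qed (auto simp: hopf_truss_mor_def hom_iff dest!: hopf_mor_hom)

lemma category_wtr_RB_iso_star: "category (wtr_RB_iso_star C)"
  unfolding wtr_RB_iso_star_eq
proof (rule category_structure)
  fix A assume A: "star_rb C A"
  note rb = star_rbD[OF A]
  interpret hopf C "rb_H A" by unfold_locales (rule rb)
  note t = bialgebraD(1,3-)[OF rb(2)] actionD(2-4)[OF rb(3) bialgebraD(1)[OF rb(2)] coalgebra_H]
    coalgebra_morD(1-3)[OF rb(4)] coalgebra_morD(1-3)[OF rb(5)] coalgebra_type[OF bialgebraD(1)[OF rb(2)]]
  show "(I, ide C (carrier (rb_B A))) \<in> rota_baxter_mor C A A"
    using hopf_mor_ide[OF hopf] bialgebra_mor_ide[OF rb(2)] t by (simp add: rota_baxter_mor_def)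
next
  fix A B D x y
  assume st: "star_rb C A" "star_rb C B" "star_rb C D"
    and xy: "x \<in> rota_baxter_mor C A B" "y \<in> rota_baxter_mor C B D"
  obtain f g f' g' where [simp]: "x = (f, g)" "y = (f', g')" by (cases x, cases y)
  have f: "f \<in> hopf_algebra_mor C (rb_H A) (rb_H B)" "g \<in> nonunital_bialgebra_mor C (rb_B A) (rb_B B)"
    "rb_T B \<cdot> f = g \<cdot> rb_T A" "f \<cdot> rb_\<Psi> A = rb_\<Psi> B \<cdot> f" "f \<cdot> rb_\<phi> A = rb_\<phi> B \<cdot> (g \<otimes> f)"
    and f': "f' \<in> hopf_algebra_mor C (rb_H B) (rb_H D)" "g' \<in> nonunital_bialgebra_mor C (rb_B B) (rb_B D)"
    "rb_T D \<cdot> f' = g' \<cdot> rb_T B" "f' \<cdot> rb_\<Psi> B = rb_\<Psi> D \<cdot> f'" "f' \<cdot> rb_\<phi> B = rb_\<phi> D \<cdot> (g' \<otimes> f')"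
    using xy by (simp_all add: rota_baxter_mor_def)
  note A = star_rbD[OF st(1)] and B = star_rbD[OF st(2)] and D = star_rbD[OF st(3)]
  interpret HA: hopf C "rb_H A" by unfold_locales (rule A)
  interpret HB: hopf C "rb_H B" by unfold_locales (rule B)
  interpret HD: hopf C "rb_H D" by unfold_locales (rule D)
  note t = hopf_morD(5-)[OF f(1)] bialgebra_morD(3-)[OF f(2)] hopf_morD(5-)[OF f'(1)] bialgebra_morD(3-)[OF f'(2)]
    actionD(2-4)[OF A(3) bialgebraD(1)[OF A(2)] HA.coalgebra_H] actionD(2-4)[OF B(3) bialgebraD(1)[OF B(2)] HB.coalgebra_H]
    actionD(2-4)[OF D(3) bialgebraD(1)[OF D(2)] HD.coalgebra_H]
    coalgebra_morD(1-3)[OF A(4)] coalgebra_morD(1-3)[OF B(4)] coalgebra_morD(1-3)[OF D(4)]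
    coalgebra_morD(1-3)[OF A(5)] coalgebra_morD(1-3)[OF B(5)] coalgebra_morD(1-3)[OF D(5)]
  have "rb_T D \<cdot> (f' \<cdot> f) = (rb_T D \<cdot> f') \<cdot> f" using t by simp
  then have 1: "rb_T D \<cdot> (f' \<cdot> f) = (g' \<cdot> g) \<cdot> rb_T A" unfolding f'(3) using t by (simp add: f(3))
  have "rb_\<Psi> D \<cdot> (f' \<cdot> f) = (rb_\<Psi> D \<cdot> f') \<cdot> f" using t by simp
  then have 2: "(f' \<cdot> f) \<cdot> rb_\<Psi> A = rb_\<Psi> D \<cdot> (f' \<cdot> f)" unfolding f'(4)[symmetric] using t by (simp add: f(4))
  have "(f' \<cdot> f) \<cdot> rb_\<phi> A = (f' \<cdot> rb_\<phi> B) \<cdot> (g \<otimes> f)" using t by (simp add: f(5))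
  then have 3: "(f' \<cdot> f) \<cdot> rb_\<phi> A = rb_\<phi> D \<cdot> ((g' \<cdot> g) \<otimes> (f' \<cdot> f))"
    unfolding f'(5) using t by (simp add: interchange)
  show "(case y of (f', g') \<Rightarrow> \<lambda>(f, g). (f' \<cdot> f, g' \<cdot> g)) x \<in> rota_baxter_mor C A D"
    using 1 2 3 hopf_mor_comp[OF HA.hopf HB.hopf HD.hopf f(1) f'(1)] bialgebra_mor_comp[OF A(2) B(2) D(2) f(2) f'(2)]
    unfolding rota_baxter_mor_def by simp
qed (auto simp: rota_baxter_mor_def hom_iff dest!: hopf_mor_hom bialgebra_mor_hom)

lemma equivalent_HTr_Post:
  "equivalent_categories (HTr_star C) (wt_Post_Hopf_star C)"
  unfolding HTr_star_eq wt_Post_Hopf_star_eq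
proof (rule structure_equivalence(1)[where F = "post_of_truss C" and G = "truss_of_post C"
      and \<phi> = id and \<psi> = id and u = "\<lambda>P. ide C (carrier (ph_H P))"])
  fix A B f assume "star_truss C A" "star_truss C B" "f \<in> hopf_truss_mor C A B"
  then show "id f \<in> post_hopf_mor C (post_of_truss C A) (post_of_truss C B)"
    using post_of_truss truss_mor_eq by (metis id_apply)
next
  fix A assume A: "star_post C A"
  then interpret twisted_hopf C "ph_H A" "ph_\<Phi> A" "ph_m A" by (rule star_postD)
  show I: "I \<in> post_hopf_mor C (post_of_truss C (truss_of_post C A)) A"
    using hopf_mor_ide[OF hopf] truss_of_post(2)[OF A] by (simp add: post_hopf_mor_def)
  show "\<exists>v \<in> post_hopf_mor C A (post_of_truss C (truss_of_post C A)).
     v \<cdot> I = ide C (carrier (ph_H (post_of_truss C (truss_of_post C A)))) \<and> I \<cdot> v = I"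
    using I truss_of_post(2)[OF A] by (intro bexI[of _ I]) simp_all
next
  fix A B f assume "star_post C A" "star_post C B" "f \<in> post_hopf_mor C A B"
  then show "f \<cdot> ide C (carrier (ph_H A)) = ide C (carrier (ph_H B)) \<cdot> id (id f)"
    by (auto simp: post_hopf_mor_def hom_iff dest!: hopf_mor_hom)
qed (use category_HTr_star category_wt_Post_Hopf_star post_of_truss truss_of_post truss_mor_eq in
    \<open>auto simp: HTr_star_eq wt_Post_Hopf_star_eq post_of_truss_def truss_of_post_def\<close>)

lemma rb_counit_mor:
  assumes A: "star_rb C A" and A': "A' = rb_of_post C (post_of_rb C A)"
  shows "(ide C (carrier (rb_H A)), rb_T A) \<in> rota_baxter_mor C A' A"
    "\<exists>v \<in> rota_baxter_mor C A A'.
       (case v of (f', g') \<Rightarrow> \<lambda>(f, g). (f' \<cdot> f, g' \<cdot> g)) (ide C (carrier (rb_H A)), rb_T A) =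
         (ide C (carrier (rb_H A')), ide C (carrier (rb_B A'))) \<and>
       (case (ide C (carrier (rb_H A)), rb_T A) of (f', g') \<Rightarrow> \<lambda>(f, g). (f' \<cdot> f, g' \<cdot> g)) v =
         (ide C (carrier (rb_H A)), ide C (carrier (rb_B A)))"
  using rb_counit[OF A] unfolding A' by (auto simp: rb_of_post_def post_of_rb_def split_beta)

lemma rb_counit_natural:
  assumes "star_rb C A" "star_rb C B" "x \<in> rota_baxter_mor C A B"
  shows "(case x of (f', g') \<Rightarrow> \<lambda>(f, g). (f' \<cdot> f, g' \<cdot> g)) (ide C (carrier (rb_H A)), rb_T A) =
    (case (ide C (carrier (rb_H B)), rb_T B) of (f', g') \<Rightarrow> \<lambda>(f, g). (f' \<cdot> f, g' \<cdot> g)) (fst x, fst x)"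
  using assms(3) by (auto simp: rota_baxter_mor_def hom_iff dest!: hopf_mor_hom)

lemma equivalent_RB_Post:
  "equivalent_categories (wtr_RB_iso_star C) (wt_Post_Hopf_star C)"
  unfolding wtr_RB_iso_star_eq wt_Post_Hopf_star_eq
proof (rule structure_equivalence(2)[where F = "rb_of_post C" and G = "post_of_rb C"
      and \<phi> = "\<lambda>f. (f, f)" and \<psi> = fst and u = "\<lambda>R. (ide C (carrier (rb_H R)), rb_T R)"])
  fix A B x assume AB: "star_rb C A" "star_rb C B" "x \<in> rota_baxter_mor C A B"
  then show "fst x \<in> post_hopf_mor C (post_of_rb C A) (post_of_rb C B)"
    by (intro post_mor_of_rb_mor[of A B _ "snd x"]) simp_all
  show "(case x of (f', g') \<Rightarrow> \<lambda>(f, g). (f' \<cdot> f, g' \<cdot> g)) (ide C (carrier (rb_H A)), rb_T A) =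
    (case (ide C (carrier (rb_H B)), rb_T B) of (f', g') \<Rightarrow> \<lambda>(f, g). (f' \<cdot> f, g' \<cdot> g)) (fst x, fst x)"
    by (rule rb_counit_natural[OF AB])
qed (use category_wtr_RB_iso_star category_wt_Post_Hopf_star rb_of_post post_of_rb rb_mor_of_post_mor
      rb_counit_mor[OF _ refl] in
    \<open>simp_all add: wtr_RB_iso_star_eq wt_Post_Hopf_star_eq post_of_rb_def rb_of_post_def split_beta\<close>)

lemma equivalent_HTr_RB:
  "equivalent_categories (HTr_star C) (wtr_RB_iso_star C)"
  unfolding wtr_RB_iso_star_eq HTr_star_eq
proof (rule structure_equivalence(1)[where F = "\<lambda>S. rb_of_post C (post_of_truss C S)"
      and G = "\<lambda>R. truss_of_post C (post_of_rb C R)"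
      and \<phi> = "\<lambda>f. (f, f)" and \<psi> = fst and u = "\<lambda>R. (ide C (carrier (rb_H R)), rb_T R)"])
  show "category (structure_category (star_truss C) (hopf_truss_mor C) (\<lambda>S. ide C (carrier (truss_H1 S))) (\<cdot>))"
    "category (structure_category (star_rb C) (rota_baxter_mor C)
     (\<lambda>R. (ide C (carrier (rb_H R)), ide C (carrier (rb_B R)))) (\<lambda>(f', g') (f, g). (f' \<cdot> f, g' \<cdot> g)))"
    by (rule category_HTr_star[unfolded HTr_star_eq] category_wtr_RB_iso_star[unfolded wtr_RB_iso_star_eq])+
next
  fix A B f assume AB: "star_truss C A" "star_truss C B" "f \<in> hopf_truss_mor C A B"
  note A = post_of_truss[OF AB(1)] and B = post_of_truss[OF AB(2)]
  show "(f, f) \<in> rota_baxter_mor C (rb_of_post C (post_of_truss C A)) (rb_of_post C (post_of_truss C B))"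
    using truss_mor_eq[OF A(1) B(1)] AB(3) by (intro rb_mor_of_post_mor A B) (simp add: A B)
next
  fix A B x assume AB: "star_rb C A" "star_rb C B" "x \<in> rota_baxter_mor C A B"
  then show "fst x \<in> hopf_truss_mor C (truss_of_post C (post_of_rb C A)) (truss_of_post C (post_of_rb C B))"
    unfolding truss_mor_eq[OF post_of_rb[OF AB(1)] post_of_rb[OF AB(2)]]
    by (intro post_mor_of_rb_mor[of A B _ "snd x"]) simp_all
  show "(case x of (f', g') \<Rightarrow> \<lambda>(f, g). (f' \<cdot> f, g' \<cdot> g)) (ide C (carrier (rb_H A)), rb_T A) =
    (case (ide C (carrier (rb_H B)), rb_T B) of (f', g') \<Rightarrow> \<lambda>(f, g). (f' \<cdot> f, g' \<cdot> g)) (fst x, fst x)"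
    by (rule rb_counit_natural[OF AB])
next
  fix A assume A: "star_rb C A"
  have eq: "rb_of_post C (post_of_truss C (truss_of_post C (post_of_rb C A))) = rb_of_post C (post_of_rb C A)"
    by (simp add: truss_of_post(2)[OF post_of_rb[OF A]])
  note u = rb_counit_mor[OF A eq]
  show "(ide C (carrier (rb_H A)), rb_T A)
         \<in> rota_baxter_mor C (rb_of_post C (post_of_truss C (truss_of_post C (post_of_rb C A)))) A"
    by (rule u(1))
  let ?A = "rb_of_post C (post_of_truss C (truss_of_post C (post_of_rb C A)))"
  show "\<exists>v \<in> rota_baxter_mor C A ?A.
       (case v of (f', g') \<Rightarrow> \<lambda>(f, g). (f' \<cdot> f, g' \<cdot> g)) (ide C (carrier (rb_H A)), rb_T A) =
         (ide C (carrier (rb_H ?A)), ide C (carrier (rb_B ?A))) \<and>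
       (case (ide C (carrier (rb_H A)), rb_T A) of (f', g') \<Rightarrow> \<lambda>(f, g). (f' \<cdot> f, g' \<cdot> g)) v =
         (ide C (carrier (rb_H A)), ide C (carrier (rb_B A)))"
    by (rule u(2))
qed (simp_all add: post_of_truss truss_of_post rb_of_post post_of_rb split_beta,
    simp_all add: post_of_rb_def rb_of_post_def post_of_truss_def truss_of_post_def)

end

theorem corollary4p13:
  fixes C :: "('o, 'a, 'm) braided_category_scheme"
  assumes "strict_braided_monoidal_category C"
  shows "equivalent_categories (HTr_star C) (wtr_RB_iso_star C) \<and>
         equivalent_categories (wtr_RB_iso_star C) (wt_Post_Hopf_star C) \<and>
         equivalent_categories (HTr_star C) (wt_Post_Hopf_star C)"
proof -
  interpret strict_braided_monoidal_category C by fact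
  show ?thesis
    using equivalent_HTr_RB equivalent_RB_Post equivalent_HTr_Post by blast
qed

end
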